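(* Let $(G_{\mathbb{C}},H_{\mathbb{C}})$ be a non-symmetric reductive spherical pair of rank-one type, i.e. one of $(SO(7,\mathbb{C}),G_2(\mathbb{C}))$, $(Spin(7,\mathbb{C}),G_2(\mathbb{C}))$, $(G_2(\mathbb{C}),SL(3,\mathbb{C}))$. Let $\theta$ be a Cartan involution of $G_{\mathbb{C}}$ with $\theta(H_{\mathbb{C}})=H_{\mathbb{C}}$ and $G_u=G_{\mathbb{C}}^{\theta}$. Then the $G_u$-action (by left translation) on $D=G_{\mathbb{C}}/H_{\mathbb{C}}$ is strongly visible, and one can find a one-dimensional slice $S$ for this strongly visible action. That is, there exist a one-dimensional real submanifold $S$ of $D$ and an anti-holomorphic diffeomorphism $\sigma$ of $D$ such that $D=G_u\cdot S$, $\sigma|_S=\operatorname{id}_S$, and $\sigma(x)\in G_u\cdot x$ for all $x\in D$.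
   Context: Strongly visible: a holomorphic action of a Lie group $G$ on a connected complex manifold $D$ is called strongly visible if there exist a real submanifold $S$ of $D$ (called a slice) and an anti-holomorphic diffeomorphism $\sigma$ of $D$ such that (V.1) $D=G\cdot S$; (S.1) $\sigma|_S=\operatorname{id}_S$; (S.2) $\sigma(x)\in G\cdot x$ for all $x\in D$. Cayley algebra: $\mathfrak{C}$ is the 8-dimensional real algebra with basis $e_0,\dots,e_7$, where $e_0$ is the unit, $e_i^2=-e_0$ for $i\ge 1$, $e_ie_j=-e_je_i$ for distinct $i,j\geq 1$, and $e_1e_2=e_3$, $e_1e_4=e_5$, $e_1e_6=e_7$, $e_2e_5=e_7$, $e_2e_6=e_4$, $e_3e_5=e_6$, $e_3e_4=e_7$ (each listed relation $e_ie_j=e_k$ also gives $e_je_k=e_i$ and $e_ke_i=e_j$). $\mathfrak{C}_{\mathbb{C}}=\mathfrak{C}\otimes_{\mathbb{R}}\mathbb{C}$ carries the complex symmetric bilinear form with $(e_i,e_j)=\delta_{ij}$. Groups: $SO(8,\mathbb{C})=\{g\in SL(8,\mathbb{C}):{}^tgg=I_8\}$ acts on $\mathfrak{C}_{\mathbb{C}}$ via the basis $e_0,\dots,e_7$, and $SO(7,\mathbb{C})=\{g\in SO(8,\mathbb{C}):ge_0=e_0\}$. $G_2(\mathbb{C})=\{g\in SO(8,\mathbb{C}):(gx)(gy)=g(xy)\ \forall x,y\in\mathfrak{C}_{\mathbb{C}}\}\subset SO(7,\mathbb{C})$. $Spin(7,\mathbb{C})=\{g\in SO(8,\mathbb{C}):\exists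 g_0\in SO(7,\mathbb{C})\text{ with }(g_0x)(gy)=g(xy)\ \forall x,y\in\mathfrak{C}_{\mathbb{C}}\}$; it contains $G_2(\mathbb{C})$ as the stabilizer of $e_0$. $SL(3,\mathbb{C})$ is realized as $\{g\in G_2(\mathbb{C}):ge_1=e_1\}$. A Cartan involution $\theta$ of the complex group $G_{\mathbb{C}}$ (regarded as a real Lie group) is an involutive automorphism whose fixed point group $G_u$ is a maximal compact subgroup of $G_{\mathbb{C}}$. *)

theory Defs
  imports
    "HOL-Analysis.Analysis"
    "HOL-Algebra.Group_Action"
    "HOL-Algebra.Left_Coset"
begin

section \<open>Complex vector spaces and smooth, holomorphic and antiholomorphic maps\<close>

class complex_vector = real_vector +
  fixes scaleC :: "complex \<Rightarrow> 'a \<Rightarrow> 'a"  (infixr \<open>*\<^sub>C\<close> 75)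
  assumes scaleC_add_right: "c *\<^sub>C (x + y) = c *\<^sub>C x + c *\<^sub>C y"
    and scaleC_add_left: "(c + d) *\<^sub>C x = c *\<^sub>C x + d *\<^sub>C x"
    and scaleC_scaleC: "c *\<^sub>C d *\<^sub>C x = (c * d) *\<^sub>C x"
    and scaleC_of_real: "of_real r *\<^sub>C x = r *\<^sub>R x"

instantiation complex :: complex_vector
begin

definition scaleC_complex :: "complex \<Rightarrow> complex \<Rightarrow> complex"
  where "c *\<^sub>C x = c * x"

instance
  by standard (simp_all add: scaleC_complex_def algebra_simps scaleR_conv_of_real)

end

instantiation vec :: (complex_vector, finite) complex_vector
begin

definition scaleC_vec :: "complex \<Rightarrow> 'a ^ 'b \<Rightarrow> 'a ^ 'b"
  where "c *\<^sub>C x = (\<chi> i. c *\<^sub>C (x $ i))"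

instance
  by standard
    (simp_all add: scaleC_vec_def vec_eq_iff scaleC_add_right scaleC_add_left
      scaleC_scaleC scaleC_of_real)

end

text \<open>In the next two definitions the derivative is the real one; holomorphy is the
  complex linearity of the derivative.\<close>

definition holomorphic_map_on ::
    "'a::{euclidean_space, complex_vector} set \<Rightarrow> ('a \<Rightarrow> 'b::{euclidean_space, complex_vector}) \<Rightarrow> bool"
  where "holomorphic_map_on W f \<longleftrightarrow> open W \<and>
    (\<forall>z\<in>W. \<exists>f'. (f has_derivative f') (at z) \<and> (\<forall>c v. f' (c *\<^sub>C v) = c *\<^sub>C f' v))"

definition antiholomorphic_map_on ::
    "'a::{euclidean_space, complex_vector} set \<Rightarrow> ('a \<Rightarrow> 'b::{euclidean_space, complex_vector}) \<Rightarrow> bool"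
  where "antiholomorphic_map_on W f \<longleftrightarrow> open W \<and>
    (\<forall>z\<in>W. \<exists>f'. (f has_derivative f') (at z) \<and> (\<forall>c v. f' (c *\<^sub>C v) = cnj c *\<^sub>C f' v))"

text \<open>\<open>Ck_on k W f\<close> is meant for open \<open>W\<close>: all iterated directional derivatives of order at
  most \<open>k\<close> exist and are continuous.\<close>

primrec Ck_on ::
    "nat \<Rightarrow> 'a::euclidean_space set \<Rightarrow> ('a \<Rightarrow> 'b::euclidean_space) \<Rightarrow> bool"
  where
    "Ck_on 0 W f \<longleftrightarrow> continuous_on W f"
  | "Ck_on (Suc k) W f \<longleftrightarrow> (\<forall>x\<in>W. f differentiable (at x)) \<and>
      (\<forall>v. Ck_on k W (\<lambda>x. frechet_derivative f (at x) v))"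

text \<open>On a subset that need not be open, smooth and holomorphic functions are the local
  restrictions of smooth and holomorphic functions on open sets. On an embedded submanifold these
  are the intrinsically smooth or holomorphic functions.\<close>

definition smooth_map_on ::
    "'a::euclidean_space set \<Rightarrow> ('a \<Rightarrow> 'b::euclidean_space) \<Rightarrow> bool"
  where "smooth_map_on M f \<longleftrightarrow>
    (\<forall>a\<in>M. \<exists>W F. open W \<and> a \<in> W \<and> (\<forall>k. Ck_on k W F) \<and> (\<forall>x\<in>M \<inter> W. F x = f x))"

definition locally_holomorphic_map_on ::
    "'a::{euclidean_space, complex_vector} set \<Rightarrow> ('a \<Rightarrow> 'b::{euclidean_space, complex_vector}) \<Rightarrow> bool"
  where "locally_holomorphic_map_on M f \<longleftrightarrow>
    (\<forall>a\<in>M. \<exists>W F. a \<in> W \<and> holomorphic_map_on W F \<and> (\<forall>x\<in>M \<inter> W. F x = f x))"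


section \<open>Complex manifolds\<close>

text \<open>A complex manifold of dimension \<open>CARD('n)\<close> is a topological space with a holomorphic atlas
  of charts \<open>(U, \<phi>)\<close> with values in \<open>complex ^ 'n\<close>. The atlas need not be maximal. The inverse
  of a chart is \<open>inv_into U \<phi>\<close>.\<close>

type_synonym ('x, 'n) chart = "'x set \<times> ('x \<Rightarrow> complex ^ 'n)"

definition topological_chart :: "'x topology \<Rightarrow> ('x, 'n::finite) chart \<Rightarrow> bool"
  where "topological_chart X = (\<lambda>(U, \<phi>). openin X U \<and> open (\<phi> ` U) \<and>
    homeomorphic_map (subtopology X U) (top_of_set (\<phi> ` U)) \<phi>)"

definition complex_manifold :: "'x topology \<Rightarrow> ('x, 'n::finite) chart set \<Rightarrow> bool"
  where "complex_manifold X \<A> \<longleftrightarrow>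
    Hausdorff_space X \<and> second_countable X \<and>
    (\<forall>c\<in>\<A>. topological_chart X c) \<and>
    topspace X = (\<Union>(U, \<phi>)\<in>\<A>. U) \<and>
    (\<forall>(U, \<phi>)\<in>\<A>. \<forall>(V, \<psi>)\<in>\<A>. holomorphic_map_on (\<phi> ` (U \<inter> V)) (\<psi> \<circ> inv_into U \<phi>))"

definition holomorphic_self_map ::
    "'x topology \<Rightarrow> ('x, 'n::finite) chart set \<Rightarrow> ('x \<Rightarrow> 'x) \<Rightarrow> bool"
  where "holomorphic_self_map X \<A> f \<longleftrightarrow> continuous_map X X f \<and>
    (\<forall>(U, \<phi>)\<in>\<A>. \<forall>(V, \<psi>)\<in>\<A>.
      holomorphic_map_on (\<phi> ` {x\<in>U. f x \<in> V}) (\<psi> \<circ> f \<circ> inv_into U \<phi>))"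

definition antiholomorphic_self_map ::
    "'x topology \<Rightarrow> ('x, 'n::finite) chart set \<Rightarrow> ('x \<Rightarrow> 'x) \<Rightarrow> bool"
  where "antiholomorphic_self_map X \<A> f \<longleftrightarrow> continuous_map X X f \<and>
    (\<forall>(U, \<phi>)\<in>\<A>. \<forall>(V, \<psi>)\<in>\<A>.
      antiholomorphic_map_on (\<phi> ` {x\<in>U. f x \<in> V}) (\<psi> \<circ> f \<circ> inv_into U \<phi>))"

definition antiholomorphic_diffeo ::
    "'x topology \<Rightarrow> ('x, 'n::finite) chart set \<Rightarrow> ('x \<Rightarrow> 'x) \<Rightarrow> bool"
  where "antiholomorphic_diffeo X \<A> \<sigma> \<longleftrightarrow> bij_betw \<sigma> (topspace X) (topspace X) \<and>
    antiholomorphic_self_map X \<A> \<sigma> \<and>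
    antiholomorphic_self_map X \<A> (inv_into (topspace X) \<sigma>)"

text \<open>The charts of the maximal real smooth atlas of the underlying real manifold.\<close>

definition smooth_chart ::
    "'x topology \<Rightarrow> ('x, 'n::finite) chart set \<Rightarrow> ('x, 'n) chart \<Rightarrow> bool"
  where "smooth_chart X \<A> = (\<lambda>(U, \<phi>). topological_chart X (U, \<phi>) \<and>
    (\<forall>(V, \<psi>)\<in>\<A>.
      smooth_map_on (\<phi> ` (U \<inter> V)) (\<psi> \<circ> inv_into U \<phi>) \<and>
      smooth_map_on (\<psi> ` (U \<inter> V)) (\<phi> \<circ> inv_into V \<psi>)))"

text \<open>Embedded real submanifolds of real dimension \<open>d\<close>, described by slice charts. The notions
  \<open>subspace\<close> and \<open>dim\<close> are those of real linear algebra.\<close>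

definition real_submanifold ::
    "nat \<Rightarrow> 'x topology \<Rightarrow> ('x, 'n::finite) chart set \<Rightarrow> 'x set \<Rightarrow> bool"
  where "real_submanifold d X \<A> S \<longleftrightarrow> S \<subseteq> topspace X \<and>
    (\<forall>p\<in>S. \<exists>U \<phi> V. smooth_chart X \<A> (U, \<phi>) \<and> p \<in> U \<and>
      subspace V \<and> dim V = d \<and> \<phi> ` (U \<inter> S) = \<phi> ` U \<inter> V)"


section \<open>Linear Lie groups and strongly visible actions\<close>

definition matrix_group :: "(complex ^ 'm ^ 'm) set \<Rightarrow> (complex ^ 'm::finite ^ 'm) monoid"
  where "matrix_group G = \<lparr>carrier = G, mult = (**), one = mat 1\<rparr>"

abbreviation general_linear :: "(complex ^ 'm::finite ^ 'm) set"
  where "general_linear \<equiv> {A. invertible A}"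

definition linear_Lie_group :: "(complex ^ 'm::finite ^ 'm) set \<Rightarrow> bool"
  where "linear_Lie_group K \<longleftrightarrow> subgroup K (matrix_group general_linear) \<and>
    closedin (top_of_set general_linear) K"

definition holomorphic_action ::
    "(complex ^ 'm::finite ^ 'm) set \<Rightarrow> (complex ^ 'm ^ 'm \<Rightarrow> 'x \<Rightarrow> 'x) \<Rightarrow>
      'x topology \<Rightarrow> ('x, 'n::finite) chart set \<Rightarrow> bool"
  where "holomorphic_action K act X \<A> \<longleftrightarrow>
    group_action (matrix_group K) (topspace X) (\<lambda>g. restrict (act g) (topspace X)) \<and>
    continuous_map (prod_topology (top_of_set K) X) X (\<lambda>(g, x). act g x) \<and>
    (\<forall>(U, \<phi>)\<in>\<A>. \<forall>(V, \<psi>)\<in>\<A>.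
      smooth_map_on {(g, z). g \<in> K \<and> z \<in> \<phi> ` U \<and> act g (inv_into U \<phi> z) \<in> V}
        (\<lambda>(g, z). \<psi> (act g (inv_into U \<phi> z)))) \<and>
    (\<forall>g\<in>K. holomorphic_self_map X \<A> (act g))"

definition visible_slice ::
    "(complex ^ 'm::finite ^ 'm) set \<Rightarrow> (complex ^ 'm ^ 'm \<Rightarrow> 'x \<Rightarrow> 'x) \<Rightarrow>
      'x topology \<Rightarrow> ('x, 'n::finite) chart set \<Rightarrow> 'x set \<Rightarrow> ('x \<Rightarrow> 'x) \<Rightarrow> bool"
  where "visible_slice K act X \<A> S \<sigma> \<longleftrightarrow>
    antiholomorphic_diffeo X \<A> \<sigma> \<and>
    topspace X = (\<Union>g\<in>K. act g ` S) \<and>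
    (\<forall>x\<in>S. \<sigma> x = x) \<and>
    (\<forall>x\<in>topspace X. \<sigma> x \<in> (\<lambda>g. act g x) ` K)"

definition strongly_visible ::
    "(complex ^ 'm::finite ^ 'm) set \<Rightarrow> (complex ^ 'm ^ 'm \<Rightarrow> 'x \<Rightarrow> 'x) \<Rightarrow>
      'x topology \<Rightarrow> ('x, 'n::finite) chart set \<Rightarrow> bool"
  where "strongly_visible K act X \<A> \<longleftrightarrow>
    linear_Lie_group K \<and> complex_manifold X \<A> \<and> connected_space X \<and>
    holomorphic_action K act X \<A> \<and>
    (\<exists>d S \<sigma>. real_submanifold d X \<A> S \<and> visible_slice K act X \<A> S \<sigma>)"


section \<open>Complex homogeneous spaces of linear groups\<close>

definition coset :: "(complex ^ 'm ^ 'm) set \<Rightarrow> (complex ^ 'm::finite ^ 'm) set \<Rightarrow>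
    complex ^ 'm ^ 'm \<Rightarrow> (complex ^ 'm ^ 'm) set"
  where "coset G H g = g <#\<^bsub>matrix_group G\<^esub> H"

definition coset_topology :: "(complex ^ 'm ^ 'm) set \<Rightarrow> (complex ^ 'm::finite ^ 'm) set \<Rightarrow>
    (complex ^ 'm ^ 'm) set topology"
  where "coset_topology G H = topology (\<lambda>U. U \<subseteq> lcosets\<^bsub>matrix_group G\<^esub> H \<and>
    openin (top_of_set G) {g\<in>G. coset G H g \<in> U})"

lemma openin_coset_topology:
  "openin (coset_topology G H) U \<longleftrightarrow> U \<subseteq> lcosets\<^bsub>matrix_group G\<^esub> H \<and>
    openin (top_of_set G) {g\<in>G. coset G H g \<in> U}"
proof -
  have "istopology (\<lambda>U. U \<subseteq> lcosets\<^bsub>matrix_group G\<^esub> H \<and>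
      openin (top_of_set G) {g\<in>G. coset G H g \<in> U})"
    unfolding istopology_def
  proof (intro conjI allI impI)
    fix S T
    assume S: "S \<subseteq> lcosets\<^bsub>matrix_group G\<^esub> H \<and> openin (top_of_set G) {g\<in>G. coset G H g \<in> S}"
      and T: "T \<subseteq> lcosets\<^bsub>matrix_group G\<^esub> H \<and> openin (top_of_set G) {g\<in>G. coset G H g \<in> T}"
    show "S \<inter> T \<subseteq> lcosets\<^bsub>matrix_group G\<^esub> H"
      using S by blast
    have "{g\<in>G. coset G H g \<in> S \<inter> T} = {g\<in>G. coset G H g \<in> S} \<inter> {g\<in>G. coset G H g \<in> T}"
      by blast
    then show "openin (top_of_set G) {g\<in>G. coset G H g \<in> S \<inter> T}"
      using S T by (simp only: openin_Int)
  next
    fix \<K>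
    assume K: "\<forall>S\<in>\<K>. S \<subseteq> lcosets\<^bsub>matrix_group G\<^esub> H \<and> openin (top_of_set G) {g\<in>G. coset G H g \<in> S}"
    show "\<Union>\<K> \<subseteq> lcosets\<^bsub>matrix_group G\<^esub> H"
      using K by blast
    have "{g\<in>G. coset G H g \<in> \<Union>\<K>} = (\<Union>S\<in>\<K>. {g\<in>G. coset G H g \<in> S})"
      by blast
    then show "openin (top_of_set G) {g\<in>G. coset G H g \<in> \<Union>\<K>}"
      using K by (metis (no_types, lifting) openin_Union imageE)
  qed
  then show ?thesis
    by (simp add: coset_topology_def)
qed

text \<open>All charts of the complex structure on \<open>G/H\<close> for which \<open>\<pi> = coset G H\<close> is a holomorphic
  submersion: \<open>\<phi> \<circ> \<pi>\<close> is holomorphic, and the inverse of \<open>\<phi>\<close> lifts locally to a holomorphic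
  map \<open>s\<close> into \<open>G\<close>.\<close>

definition coset_atlas :: "(complex ^ 'm ^ 'm) set \<Rightarrow> (complex ^ 'm::finite ^ 'm) set \<Rightarrow>
    ((complex ^ 'm ^ 'm) set, 'n::finite) chart set"
  where "coset_atlas G H = {(U, \<phi>). openin (coset_topology G H) U \<and> inj_on \<phi> U \<and> open (\<phi> ` U) \<and>
    locally_holomorphic_map_on {g\<in>G. coset G H g \<in> U} (\<lambda>g. \<phi> (coset G H g)) \<and>
    (\<forall>p\<in>\<phi> ` U. \<exists>W s. p \<in> W \<and> W \<subseteq> \<phi> ` U \<and> holomorphic_map_on W s \<and>
      (\<forall>w\<in>W. s w \<in> G \<and> coset G H (s w) = inv_into U \<phi> w))}"

definition left_translation :: "complex ^ 'm ^ 'm \<Rightarrow> (complex ^ 'm::finite ^ 'm) set \<Rightarrow>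
    (complex ^ 'm ^ 'm) set"
  where "left_translation g x = g <#\<^bsub>matrix_group general_linear\<^esub> x"


section \<open>Cartan involutions\<close>

definition maximal_compact_subgroup ::
    "(complex ^ 'm::finite ^ 'm) set \<Rightarrow> (complex ^ 'm ^ 'm) set \<Rightarrow> bool"
  where "maximal_compact_subgroup K G \<longleftrightarrow> subgroup K (matrix_group G) \<and> compact K \<and>
    (\<forall>L. subgroup L (matrix_group G) \<and> compact L \<and> K \<subseteq> L \<longrightarrow> L = K)"

definition fixed_points :: "(complex ^ 'm ^ 'm \<Rightarrow> complex ^ 'm ^ 'm) \<Rightarrow>
    (complex ^ 'm::finite ^ 'm) set \<Rightarrow> (complex ^ 'm ^ 'm) set"
  where "fixed_points \<theta> G = {g\<in>G. \<theta> g = g}"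

text \<open>\<open>\<theta>\<close> is an automorphism of \<open>G\<close> as a real Lie group: smooth, not necessarily holomorphic.\<close>

definition Cartan_involution ::
    "(complex ^ 'm::finite ^ 'm) set \<Rightarrow> (complex ^ 'm ^ 'm \<Rightarrow> complex ^ 'm ^ 'm) \<Rightarrow> bool"
  where "Cartan_involution G \<theta> \<longleftrightarrow>
    \<theta> \<in> iso (matrix_group G) (matrix_group G) \<and> smooth_map_on G \<theta> \<and>
    (\<forall>g\<in>G. \<theta> (\<theta> g) = g) \<and>
    maximal_compact_subgroup (fixed_points \<theta> G) G"


section \<open>The complexified Cayley algebra and the groups\<close>

text \<open>The basis \<open>e\<^sub>0, \<dots>, e\<^sub>7\<close> is indexed by the eight elements \<open>0, \<dots>, 7\<close> of the type \<open>8\<close>.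
  A triple \<open>(i, j, k)\<close> below stands for \<open>e\<^sub>i e\<^sub>j = e\<^sub>k\<close>.\<close>

definition cayley_triples :: "(8 \<times> 8 \<times> 8) set"
  where "cayley_triples =
    {(1, 2, 3), (1, 4, 5), (1, 6, 7), (2, 5, 7), (2, 6, 4), (3, 5, 6), (3, 4, 7)}"

definition cayley_cyclic :: "8 \<Rightarrow> 8 \<Rightarrow> 8 \<Rightarrow> bool"
  where "cayley_cyclic i j k \<longleftrightarrow>
    (i, j, k) \<in> cayley_triples \<or> (j, k, i) \<in> cayley_triples \<or> (k, i, j) \<in> cayley_triples"

text \<open>The coefficient of \<open>e\<^sub>k\<close> in \<open>e\<^sub>i e\<^sub>j\<close>.\<close>

definition cayley_coeff :: "8 \<Rightarrow> 8 \<Rightarrow> 8 \<Rightarrow> int"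
  where "cayley_coeff i j k =
    (if i = 0 then of_bool (k = j)
     else if j = 0 then of_bool (k = i)
     else if i = j then - of_bool (k = 0)
     else of_bool (cayley_cyclic i j k) - of_bool (cayley_cyclic j i k))"

text \<open>The complexification of the Cayley algebra has the same structure constants over the
  complex numbers.\<close>

definition cayley_mult :: "complex ^ 8 \<Rightarrow> complex ^ 8 \<Rightarrow> complex ^ 8"  (infixl \<open>\<odot>\<close> 70)
  where "x \<odot> y = (\<chi> k. \<Sum>i\<in>UNIV. \<Sum>j\<in>UNIV. of_int (cayley_coeff i j k) * x $ i * y $ j)"

definition cayley_basis :: "8 \<Rightarrow> complex ^ 8"
  where "cayley_basis i = axis i 1"

definition SO8C :: "(complex ^ 8 ^ 8) set"
  where "SO8C = {g. det g = 1 \<and> transpose g ** g = mat 1}"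

definition SO7C :: "(complex ^ 8 ^ 8) set"
  where "SO7C = {g\<in>SO8C. g *v cayley_basis 0 = cayley_basis 0}"

definition G2C :: "(complex ^ 8 ^ 8) set"
  where "G2C = {g\<in>SO8C. \<forall>x y. (g *v x) \<odot> (g *v y) = g *v (x \<odot> y)}"

definition Spin7C :: "(complex ^ 8 ^ 8) set"
  where "Spin7C = {g\<in>SO8C. \<exists>g0\<in>SO7C. \<forall>x y. (g0 *v x) \<odot> (g *v y) = g *v (x \<odot> y)}"

definition SL3C :: "(complex ^ 8 ^ 8) set"
  where "SL3C = {g\<in>G2C. g *v cayley_basis 1 = cayley_basis 1}"

text \<open>The pairs \<open>(G, H)\<close> together with the complex dimension \<open>n\<close> of \<open>G/H\<close>, which only serves to
  select the coordinate space \<open>complex ^ 'n\<close> of the charts.\<close>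

definition rank_one_pair :: "(complex ^ 8 ^ 8) set \<Rightarrow> (complex ^ 8 ^ 8) set \<Rightarrow> nat \<Rightarrow> bool"
  where "rank_one_pair G H n \<longleftrightarrow>
    G = SO7C \<and> H = G2C \<and> n = 7 \<or>
    G = Spin7C \<and> H = G2C \<and> n = 7 \<or>
    G = G2C \<and> H = SL3C \<and> n = 6"

end

theory Submission
  imports Defs "HOL-Complex_Analysis.Cauchy_Integral_Formula"
begin

text \<open>All maximal compact subgroups of \<open>G\<close> are conjugate to the group of real points of \<open>G\<close>, by Cartan's
  fixed point argument, and conjugation carries slices to slices; so only the real points matter.

  The groups \<open>Spin7C\<close> and \<open>G2C\<close> act transitively on the complex unit quadrics of the Cayley algebra and
  of its imaginary part, with stabilizers \<open>G2C\<close> and \<open>SL3C\<close>, and the quotient of \<open>SO7C\<close> by \<open>G2C\<close> is the first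
  quadric modulo sign. The real points act transitively on orthonormal pairs of real vectors, so they
  move every point \<open>x + iy\<close> of the quadric to some \<open>c e\<^sub>p + i s e\<^sub>q\<close> with \<open>c > 0\<close> and \<open>c\<^sup>2 - s\<^sup>2 = 1\<close>. In the projective
  coordinates \<open>v\<^sub>k / v\<^sub>p\<close> these points form an interval on a real line, which is the slice. The map \<open>\<sigma>\<close> is
  complex conjugation followed by a real automorphism of the Cayley algebra that fixes \<open>e\<^sub>p\<close> and maps
  \<open>e\<^sub>q\<close> to \<open>- e\<^sub>q\<close>.\<close>

text \<open>The quotient of \<open>SO7C\<close> sees the quadric only up to sign, so its coordinates
  must be even in \<open>v\<close>; the ratios \<open>v_k / v_p\<close> are, and they serve all
  three pairs. They must also be holomorphic in \<open>g\<close>, although \<open>v\<close> comes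
  from a two-valued spin lift of \<open>g\<close>: the products \<open>v_i v_j\<close> turn out to
  be polynomials in \<open>g\<close>. The transporting matrices are products of left multiplications
  by imaginary elements. Over the complex numbers these degenerate at isotropic vectors, so they are
  built near a good point, or after a real motion, and then translated. If \<open>x = u k H\<close>
  with \<open>u\<close> real and \<open>k H\<close> on the slice, then \<open>\<sigma>\<close>,
  which fixes \<open>k H\<close>, sends \<open>x\<close> to \<open>\<tau> u \<tau>^-1 k H\<close>;
  this is why it preserves the orbits. Cartan's argument needs midpoints of geodesics, that is,
  positive square roots inside the group; membership is checked on products of eigenvectors.
  Finally, holomorphy is defined by one complex linear derivative, while an action must be smooth to
  all orders; Cauchy's formula bridges this gap.\<close>

section \<open>Holomorphic maps between complex vector spaces\<close>

text \<open>Smoothness of an action is joint smoothness in the group element and the point, so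
  holomorphy is needed on products.\<close>

instantiation prod :: (complex_vector, complex_vector) complex_vector
begin

definition scaleC_prod :: "complex \<Rightarrow> 'a \<times> 'b \<Rightarrow> 'a \<times> 'b"
  where "c *\<^sub>C x = (c *\<^sub>C fst x, c *\<^sub>C snd x)"

instance
  by standard
    (simp_all add: scaleC_prod_def prod_eq_iff scaleC_add_right scaleC_add_left
      scaleC_scaleC scaleC_of_real)

end

lemma scaleC_one [simp]: "1 *\<^sub>C (x::'a::complex_vector) = x"
  using scaleC_of_real[of 1 x] by simp

lemma scaleC_zero_left [simp]: "0 *\<^sub>C (x::'a::complex_vector) = 0"
  using scaleC_of_real[of 0 x] by simp

lemma scaleC_zero_right [simp]: "c *\<^sub>C (0::'a::complex_vector) = 0"
  using scaleC_add_right[of c 0 0] by simp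

lemma scaleC_minus_right: "c *\<^sub>C (- x::'a::complex_vector) = - (c *\<^sub>C x)"
  using scaleC_add_right[of c x "- x"] by (simp add: eq_neg_iff_add_eq_0 add.commute)

lemma scaleC_minus_left: "(- c) *\<^sub>C (x::'a::complex_vector) = - (c *\<^sub>C x)"
  using scaleC_add_left[of c "- c" x] by (simp add: eq_neg_iff_add_eq_0 add.commute)

lemma scaleC_scaleR: "c *\<^sub>C r *\<^sub>R (x::'a::complex_vector) = r *\<^sub>R c *\<^sub>C x"
  by (metis mult.commute scaleC_of_real scaleC_scaleC)

lemma scaleC_linear: "linear (\<lambda>x::'a::complex_vector. c *\<^sub>C x)"
  by (rule linearI) (auto simp: scaleC_add_right scaleC_scaleR)

lemma scaleC_bilinear: "bounded_bilinear (\<lambda>c (x::'a::{euclidean_space, complex_vector}). c *\<^sub>C x)"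
proof -
  have "bilinear (\<lambda>c (x::'a). c *\<^sub>C x)"
    unfolding bilinear_def
  proof (intro conjI allI scaleC_linear)
    show "linear (\<lambda>c. c *\<^sub>C (y::'a))" for y
      by (rule linearI) (auto simp: scaleC_add_left scaleC_scaleC[symmetric] scaleC_of_real scaleR_conv_of_real)
  qed
  then show ?thesis
    by (simp add: bilinear_conv_bounded_bilinear)
qed

lemmas bounded_linear_scaleC_right = bounded_bilinear.bounded_linear_right[OF scaleC_bilinear]
lemmas bounded_linear_scaleC_left = bounded_bilinear.bounded_linear_left[OF scaleC_bilinear]
lemmas continuous_on_scaleC [continuous_intros] = bounded_bilinear.continuous_on[OF scaleC_bilinear]

text \<open>The parameter \<open>\<kappa>\<close> is the identity or complex conjugation, so that holomorphic and
  antiholomorphic maps are treated together.\<close>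

definition semidiff :: "(complex \<Rightarrow> complex) \<Rightarrow>
    ('a::{euclidean_space, complex_vector} \<Rightarrow> 'b::{euclidean_space, complex_vector}) \<Rightarrow> 'a \<Rightarrow> bool"
  where "semidiff \<kappa> f z \<longleftrightarrow> (\<exists>f'. (f has_derivative f') (at z) \<and> (\<forall>c v. f' (c *\<^sub>C v) = \<kappa> c *\<^sub>C f' v))"

abbreviation "cdiff \<equiv> semidiff (\<lambda>c. c)"

lemma holomorphic_map_on_iff: "holomorphic_map_on W f \<longleftrightarrow> open W \<and> (\<forall>z\<in>W. cdiff f z)"
  by (simp add: holomorphic_map_on_def semidiff_def)

lemma antiholomorphic_map_on_iff:
  "antiholomorphic_map_on W f \<longleftrightarrow> open W \<and> (\<forall>z\<in>W. semidiff cnj f z)"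
  by (simp add: antiholomorphic_map_on_def semidiff_def)

lemma semidiff_compose:
  assumes "semidiff \<kappa> g (f z)" "semidiff \<kappa>' f z"
  shows "semidiff (\<lambda>c. \<kappa> (\<kappa>' c)) (\<lambda>x. g (f x)) z"
proof -
  obtain f' g' where "(f has_derivative f') (at z)" "\<forall>c v. f' (c *\<^sub>C v) = \<kappa>' c *\<^sub>C f' v"
    "(g has_derivative g') (at (f z))" "\<forall>c v. g' (c *\<^sub>C v) = \<kappa> c *\<^sub>C g' v"
    using assms unfolding semidiff_def by blast
  then show ?thesis
    unfolding semidiff_def using has_derivative_compose[of f f' z UNIV g g'] by auto
qed

lemma semidiff_transform:
  assumes "semidiff \<kappa> f z" "open W" "z \<in> W" "\<And>x. x \<in> W \<Longrightarrow> f x = g x"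
  shows "semidiff \<kappa> g z"
  using assms has_derivative_transform_within_open[of f _ z UNIV W g] unfolding semidiff_def by blast

lemma semidiff_linear:
  assumes "linear f" "\<And>c v. f (c *\<^sub>C v) = \<kappa> c *\<^sub>C f v"
  shows "semidiff \<kappa> f z"
  unfolding semidiff_def using assms linear_imp_has_derivative by blast

lemma semidiff_continuous: "semidiff \<kappa> f z \<Longrightarrow> isCont f z"
  unfolding semidiff_def using has_derivative_continuous by blast

lemma holomorphic_map_on_continuous: "holomorphic_map_on W f \<Longrightarrow> continuous_on W f"
  by (auto simp: holomorphic_map_on_iff intro!: continuous_at_imp_continuous_on semidiff_continuous)

named_theorems cdiff_intros

lemma cdiff_const [cdiff_intros]: "cdiff (\<lambda>x. a) z"
  unfolding semidiff_def by (rule exI[of _ "\<lambda>x. 0"]) auto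

lemma cdiff_id [cdiff_intros]: "cdiff (\<lambda>x. x) z"
  by (rule semidiff_linear) (auto simp: linear_iff)

lemma cdiff_add [cdiff_intros]: "cdiff f z \<Longrightarrow> cdiff g z \<Longrightarrow> cdiff (\<lambda>x. f x + g x) z"
  unfolding semidiff_def
proof (elim exE conjE)
  fix f' g'
  assume "(f has_derivative f') (at z)" "\<forall>c v. f' (c *\<^sub>C v) = c *\<^sub>C f' v"
    "(g has_derivative g') (at z)" "\<forall>c v. g' (c *\<^sub>C v) = c *\<^sub>C g' v"
  then show "\<exists>h. ((\<lambda>x. f x + g x) has_derivative h) (at z) \<and> (\<forall>c v. h (c *\<^sub>C v) = c *\<^sub>C h v)"
    by (intro exI[of _ "\<lambda>x. f' x + g' x"]) (auto intro: derivative_intros simp: scaleC_add_right)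
qed

lemma cdiff_minus [cdiff_intros]: "cdiff f z \<Longrightarrow> cdiff (\<lambda>x. - f x) z"
  using semidiff_compose[OF semidiff_linear, of "\<lambda>x. - x" "\<lambda>c. c" "\<lambda>c. c" f z]
  by (simp add: scaleC_minus_right linear_iff)

lemma cdiff_diff [cdiff_intros]: "cdiff f z \<Longrightarrow> cdiff g z \<Longrightarrow> cdiff (\<lambda>x. f x - g x) z"
  using cdiff_add[OF _ cdiff_minus, of f z g] by simp

lemma cdiff_sum [cdiff_intros]: "(\<And>i. i \<in> A \<Longrightarrow> cdiff (f i) z) \<Longrightarrow> cdiff (\<lambda>x. \<Sum>i\<in>A. f i x) z"
  by (induction A rule: infinite_finite_induct) (auto intro: cdiff_intros)

lemma cdiff_scaleC [cdiff_intros]: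
  assumes "cdiff f z" "cdiff g z"
  shows "cdiff (\<lambda>x. f x *\<^sub>C g x) z"
proof -
  obtain f' g' where "(f has_derivative f') (at z)" "\<forall>c v. f' (c *\<^sub>C v) = c *\<^sub>C f' v"
    "(g has_derivative g') (at z)" "\<forall>c v. g' (c *\<^sub>C v) = c *\<^sub>C g' v"
    using assms unfolding semidiff_def by blast
  then show ?thesis
    unfolding semidiff_def
    by (intro exI[of _ "\<lambda>x. f z *\<^sub>C g' x + f' x *\<^sub>C g z"])
      (auto intro: bounded_bilinear.FDERIV[OF scaleC_bilinear]
        simp: scaleC_complex_def scaleC_add_right scaleC_scaleC mult.commute)
qed

lemma cdiff_mult [cdiff_intros]: "cdiff f z \<Longrightarrow> cdiff g z \<Longrightarrow> cdiff (\<lambda>x. f x * g x) z"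
  for f g :: "'a::{euclidean_space, complex_vector} \<Rightarrow> complex"
  using cdiff_scaleC[of f z g] by (simp add: scaleC_complex_def)

lemma cdiff_field_compose:
  fixes h :: "complex \<Rightarrow> complex"
  assumes "(h has_field_derivative h') (at (f z))" "cdiff f z"
  shows "cdiff (\<lambda>x. h (f x)) z"
proof (rule semidiff_compose[OF _ assms(2)])
  show "cdiff h (f z)"
    unfolding semidiff_def using assms(1)
    by (intro exI[of _ "(*) h'"]) (auto simp: has_field_derivative_def scaleC_complex_def)
qed

lemma cdiff_inverse [cdiff_intros]: "cdiff f z \<Longrightarrow> f z \<noteq> 0 \<Longrightarrow> cdiff (\<lambda>x. inverse (f x)) z"
  for f :: "_ \<Rightarrow> complex"
  by (rule cdiff_field_compose[OF DERIV_inverse])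

lemma cdiff_divide [cdiff_intros]:
  "cdiff f z \<Longrightarrow> cdiff g z \<Longrightarrow> g z \<noteq> 0 \<Longrightarrow> cdiff (\<lambda>x. f x / g x) z"
  for f g :: "'a::{euclidean_space, complex_vector} \<Rightarrow> complex"
  unfolding divide_inverse by (intro cdiff_intros)

lemma cdiff_csqrt [cdiff_intros]: "cdiff f z \<Longrightarrow> f z \<notin> \<real>\<^sub>\<le>\<^sub>0 \<Longrightarrow> cdiff (\<lambda>x. csqrt (f x)) z"
  by (rule cdiff_field_compose[OF has_field_derivative_csqrt])

lemma cdiff_vec_nth [cdiff_intros]: "cdiff f z \<Longrightarrow> cdiff (\<lambda>x. f x $ i) z"
  for f :: "_ \<Rightarrow> 'b::{euclidean_space, complex_vector} ^ 'n::finite"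
  using semidiff_compose[OF semidiff_linear, of "\<lambda>x. x $ i" "\<lambda>c. c" "\<lambda>c. c" f z]
  by (simp add: scaleC_vec_def linear_iff)

lemma cdiff_vec_lambda [cdiff_intros]:
  fixes f :: "'n::finite \<Rightarrow> 'a::{euclidean_space, complex_vector} \<Rightarrow> 'b::{euclidean_space, complex_vector}"
  assumes "\<And>i. cdiff (f i) z"
  shows "cdiff (\<lambda>x. \<chi> i. f i x) z"
proof -
  obtain f' where f': "\<And>i. (f i has_derivative f' i) (at z)" "\<And>i c v. f' i (c *\<^sub>C v) = c *\<^sub>C f' i v"
    using assms unfolding semidiff_def by metis
  have *: "(\<lambda>x. \<chi> i. h i x) = (\<lambda>x. \<Sum>i\<in>UNIV. axis i (h i x))" for h :: "'n \<Rightarrow> 'a \<Rightarrow> 'b"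
    by (auto simp: fun_eq_iff vec_eq_iff axis_def if_distrib cong: if_cong)
  have "((\<lambda>x. axis i (f i x)) has_derivative (\<lambda>x. axis i (f' i x))) (at z)" for i
    using bounded_linear.has_derivative[OF _ f'(1)[of i], of "axis i"]
    by (auto simp: linear_conv_bounded_linear[symmetric] linear_iff vec_eq_iff axis_def)
  then have "((\<lambda>x. \<Sum>i\<in>UNIV. axis i (f i x)) has_derivative (\<lambda>x. \<Sum>i\<in>UNIV. axis i (f' i x))) (at z)"
    by (intro has_derivative_sum)
  then show ?thesis
    unfolding semidiff_def using f'(2) by (intro exI[of _ "\<lambda>x. \<chi> i. f' i x"]) (auto simp: * [symmetric] scaleC_vec_def)
qed

lemma cdiff_fst [cdiff_intros]: "cdiff f z \<Longrightarrow> cdiff (\<lambda>x. fst (f x)) z"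
  using semidiff_compose[OF semidiff_linear, of "fst" "\<lambda>c. c" "\<lambda>c. c" f z]
  by (simp add: scaleC_prod_def linear_iff)

lemma cdiff_snd [cdiff_intros]: "cdiff f z \<Longrightarrow> cdiff (\<lambda>x. snd (f x)) z"
  using semidiff_compose[OF semidiff_linear, of "snd" "\<lambda>c. c" "\<lambda>c. c" f z]
  by (simp add: scaleC_prod_def linear_iff)

lemma cdiff_matrix_mult [cdiff_intros]:
  "cdiff f z \<Longrightarrow> cdiff g z \<Longrightarrow> cdiff (\<lambda>x. f x ** g x) z"
  for f :: "_ \<Rightarrow> complex ^ 'm ^ 'n" and g :: "_ \<Rightarrow> complex ^ 'k ^ 'm"
  unfolding matrix_matrix_mult_def by (intro cdiff_intros)

lemma cdiff_matrix_vector_mult [cdiff_intros]: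
  "cdiff f z \<Longrightarrow> cdiff g z \<Longrightarrow> cdiff (\<lambda>x. f x *v g x) z"
  for f :: "_ \<Rightarrow> complex ^ 'm ^ 'n"
  unfolding matrix_vector_mult_def by (intro cdiff_intros)

lemma cdiff_transpose [cdiff_intros]: "cdiff f z \<Longrightarrow> cdiff (\<lambda>x. transpose (f x)) z"
  for f :: "_ \<Rightarrow> complex ^ 'm ^ 'n"
  unfolding transpose_def by (intro cdiff_intros)

text \<open>A coefficient \<open>y \<bullet> b\<close> is only real linear. It is the real part of a
  complex linear functional, whose imaginary part is forced to be minus the coefficient of
  \<open>\<i> *\<^sub>C y\<close>. Such functionals reduce vector-valued functions to the scalar
  Cauchy formula.\<close>

lemma linear_coefficient_complex:
  fixes b :: "'b::{euclidean_space, complex_vector}"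
  defines "l \<equiv> \<lambda>y. Complex (y \<bullet> b) (- ((\<i> *\<^sub>C y) \<bullet> b))"
  shows "linear l" "l (c *\<^sub>C y) = c * l y"
proof -
  show lin: "linear l"
    by (rule linearI) (auto simp: l_def scaleC_add_right scaleC_scaleR inner_add_left complex_eq_iff)
  have "c *\<^sub>C y = Re c *\<^sub>R y + Im c *\<^sub>R \<i> *\<^sub>C y"
    using scaleC_add_left[of "of_real (Re c)" "of_real (Im c) * \<i>" y]
    by (simp add: complex_eq[of c, symmetric] mult.commute[of _ \<i>] scaleC_scaleC[symmetric]
        scaleC_of_real scaleC_scaleR)
  moreover have "\<i> *\<^sub>C \<i> *\<^sub>C y = - y"
    by (simp add: scaleC_scaleC scaleC_minus_left)
  ultimately show "l (c *\<^sub>C y) = c * l y"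
    by (auto simp: l_def complex_eq_iff scaleC_add_right scaleC_scaleR inner_add_left
        inner_diff_left)
qed

text \<open>In Cauchy's formula the derivative \<open>2\<pi>i \<zeta>\<close> of the parametrized circle cancels the factor
  \<open>1/(2\<pi>i)\<close> and one of the two factors \<open>1/\<zeta>\<close>.\<close>

lemma directional_derivative_integral:
  fixes f :: "'a::{euclidean_space, complex_vector} \<Rightarrow> 'b::{euclidean_space, complex_vector}"
  assumes f: "holomorphic_map_on W f" and "\<rho> > 0"
    and W: "\<And>\<zeta>. norm \<zeta> \<le> \<rho> \<Longrightarrow> z + \<zeta> *\<^sub>C v \<in> W"
  shows "frechet_derivative f (at z) v =
    integral {0..1} (\<lambda>t. inverse (circlepath 0 \<rho> t) *\<^sub>C f (z + circlepath 0 \<rho> t *\<^sub>C v))"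
proof (rule euclidean_eqI)
  fix b :: 'b assume "b \<in> Basis"
  define l where "l = (\<lambda>y::'b. Complex (y \<bullet> b) (- ((\<i> *\<^sub>C y) \<bullet> b)))"
  have l: "bounded_linear l" "\<And>c y. l (c *\<^sub>C y) = c * l y"
    using linear_coefficient_complex[where b = b] unfolding l_def linear_conv_bounded_linear by auto
  define h where "h = (\<lambda>\<zeta>. l (f (z + \<zeta> *\<^sub>C v)))"
  have der: "(h has_field_derivative l (frechet_derivative f (at (z + \<zeta> *\<^sub>C v)) v)) (at \<zeta>)"
    if "norm \<zeta> \<le> \<rho>" for \<zeta>
  proof -
    from f W[OF that] obtain f' where f': "(f has_derivative f') (at (z + \<zeta> *\<^sub>C v))"
      "\<And>c v. f' (c *\<^sub>C v) = c *\<^sub>C f' v"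
      unfolding holomorphic_map_on_def by blast
    then have eq: "frechet_derivative f (at (z + \<zeta> *\<^sub>C v)) = f'"
      using frechet_derivative_at by metis
    have "((\<lambda>\<zeta>. z + \<zeta> *\<^sub>C v) has_derivative (\<lambda>\<zeta>. \<zeta> *\<^sub>C v)) (at \<zeta>)"
      by (auto intro!: derivative_eq_intros bounded_linear.has_derivative[OF bounded_linear_scaleC_left])
    then have "((\<lambda>\<zeta>. f (z + \<zeta> *\<^sub>C v)) has_derivative (\<lambda>\<zeta>. f' (\<zeta> *\<^sub>C v))) (at \<zeta>)"
      using f'(1) has_derivative_compose by blast
    then have "(h has_derivative (\<lambda>\<zeta>. l (f' (\<zeta> *\<^sub>C v)))) (at \<zeta>)"
      unfolding h_def by (rule bounded_linear.has_derivative[OF l(1)])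
    moreover have "(\<lambda>\<zeta>. l (f' (\<zeta> *\<^sub>C v))) = (*) (l (f' v))"
      by (auto simp: f'(2) l(2))
    ultimately show ?thesis
      by (simp add: has_field_derivative_def eq)
  qed
  then have "h field_differentiable at \<zeta>" if "norm \<zeta> \<le> \<rho>" for \<zeta>
    using that field_differentiable_def by blast
  then have "h holomorphic_on cball 0 \<rho>"
    by (auto simp: holomorphic_on_def field_differentiable_at_within)
  then have "continuous_on (cball 0 \<rho>) h" "h holomorphic_on ball 0 \<rho>"
    using holomorphic_on_imp_continuous_on holomorphic_on_subset ball_subset_cball by blast+
  from Cauchy_derivative_integral_circlepath(2)[OF this, of 0] \<open>\<rho> > 0\<close>
  have "(h has_field_derivative 1 / (2 * of_real pi * \<i>) * contour_integral (circlepath 0 \<rho>) (\<lambda>u. h u / u\<^sup>2)) (at 0)"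
    by simp
  with der[of 0] \<open>\<rho> > 0\<close> have "l (frechet_derivative f (at z) v) =
      1 / (2 * of_real pi * \<i>) * contour_integral (circlepath 0 \<rho>) (\<lambda>u. h u / u\<^sup>2)"
    using DERIV_unique by fastforce
  also have "\<dots> = 1 / (2 * of_real pi * \<i>) *
      integral {0..1} (\<lambda>t. h (circlepath 0 \<rho> t) / (circlepath 0 \<rho> t)\<^sup>2 * (2 * of_real pi * \<i> * circlepath 0 \<rho> t))"
    unfolding contour_integral_integral vector_derivative_circlepath by (simp add: circlepath mult_ac)
  also have "\<dots> = integral {0..1} (\<lambda>t. 1 / (2 * of_real pi * \<i>) *
      (h (circlepath 0 \<rho> t) / (circlepath 0 \<rho> t)\<^sup>2 * (2 * of_real pi * \<i> * circlepath 0 \<rho> t)))"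
    by (simp only: integral_mult_right)
  also have "\<dots> = integral {0..1} (\<lambda>t. l (inverse (circlepath 0 \<rho> t) *\<^sub>C f (z + circlepath 0 \<rho> t *\<^sub>C v)))"
    by (rule integral_cong)
      (use \<open>\<rho> > 0\<close> in \<open>auto simp: h_def l(2) circlepath field_simps power2_eq_square\<close>)
  also have "\<dots> = l (integral {0..1} (\<lambda>t. inverse (circlepath 0 \<rho> t) *\<^sub>C f (z + circlepath 0 \<rho> t *\<^sub>C v)))"
  proof -
    have "continuous_on {0..1} (\<lambda>t. circlepath 0 \<rho> t)"
      unfolding circlepath by (intro continuous_intros)
    moreover from this have "continuous_on {0..1} (\<lambda>t. f (z + circlepath 0 \<rho> t *\<^sub>C v))"
      by (intro continuous_on_compose2[OF holomorphic_map_on_continuous[OF f]] continuous_intros)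
        (use W \<open>\<rho> > 0\<close> in \<open>auto simp: circlepath norm_mult\<close>)
    moreover have "circlepath 0 \<rho> t \<noteq> 0" for t
      using \<open>\<rho> > 0\<close> by (simp add: circlepath)
    ultimately have "(\<lambda>t. inverse (circlepath 0 \<rho> t) *\<^sub>C f (z + circlepath 0 \<rho> t *\<^sub>C v)) integrable_on {0..1}"
      by (intro integrable_continuous_interval continuous_intros) auto
    from integral_linear[OF this l(1)] show ?thesis
      by (simp add: o_def)
  qed
  finally show "frechet_derivative f (at z) v \<bullet> b =
    integral {0..1} (\<lambda>t. inverse (circlepath 0 \<rho> t) *\<^sub>C f (z + circlepath 0 \<rho> t *\<^sub>C v)) \<bullet> b"
    by (simp add: l_def)
qed

text \<open>One radius has to serve all base points near \<open>z\<close>, because the circle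
  integral is later differentiated with respect to the base point.\<close>

lemma directional_derivative_neighbourhood:
  fixes z v :: "'a::{euclidean_space, complex_vector}"
  assumes "open W" "z \<in> W"
  obtains \<rho> e where "\<rho> > 0" "e > 0" "\<And>y \<zeta>. y \<in> ball z e \<Longrightarrow> norm \<zeta> \<le> \<rho> \<Longrightarrow> y + \<zeta> *\<^sub>C v \<in> W"
proof -
  have "open ((\<lambda>(y, \<zeta>). y + \<zeta> *\<^sub>C v) -` W)"
    by (intro open_vimage assms) (auto simp: case_prod_unfold intro!: continuous_intros)
  moreover have "(z, 0) \<in> (\<lambda>(y, \<zeta>). y + \<zeta> *\<^sub>C v) -` W"
    using assms by simp
  ultimately obtain A B where AB: "open A" "open B" "(z, 0) \<in> A \<times> B" "A \<times> B \<subseteq> (\<lambda>(y, \<zeta>). y + \<zeta> *\<^sub>C v) -` W"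
    by (rule open_prod_elim)
  then obtain e \<rho> where "e > 0" "ball z e \<subseteq> A" "\<rho> > 0" "cball 0 \<rho> \<subseteq> B"
    by (metis mem_Sigma_iff open_contains_ball open_contains_cball)
  then have "y + \<zeta> *\<^sub>C v \<in> W" if "y \<in> ball z e" "norm \<zeta> \<le> \<rho>" for y \<zeta>
    using AB(4) that by (force simp: subset_iff)
  then show ?thesis
    using that \<open>e > 0\<close> \<open>\<rho> > 0\<close> by blast
qed

lemma continuous_circlepath_scaleC:
  fixes v :: "'a::{euclidean_space, complex_vector}"
  assumes "\<rho> > 0" and "\<And>y \<zeta>. y \<in> U \<Longrightarrow> norm \<zeta> \<le> \<rho> \<Longrightarrow> y + \<zeta> *\<^sub>C v \<in> W"
    and "continuous_on W f"
  shows "continuous_on (U \<times> cbox 0 1)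
    (\<lambda>(y, t). inverse (circlepath 0 \<rho> t) *\<^sub>C (f (y + circlepath 0 \<rho> t *\<^sub>C v) :: 'b::{euclidean_space, complex_vector}))"
proof -
  have c: "continuous_on A (circlepath 0 \<rho>)" for A
    unfolding circlepath by (intro continuous_intros)
  have c2: "continuous_on (U \<times> cbox 0 1) (\<lambda>x::'a \<times> real. circlepath 0 \<rho> (snd x))"
    by (intro continuous_on_compose2[OF c] continuous_intros) auto
  have "continuous_on (U \<times> cbox 0 1) (\<lambda>x. f (fst x + circlepath 0 \<rho> (snd x) *\<^sub>C v))"
    by (intro continuous_on_compose2[OF assms(3)] continuous_intros c2)
      (use assms in \<open>auto simp: circlepath norm_mult\<close>)
  then show ?thesis
    unfolding case_prod_unfold
    by (intro continuous_intros c2) (use assms in \<open>auto simp: circlepath\<close>)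
qed

text \<open>\<open>holomorphic_map_on\<close> asks for a derivative at each point and says nothing
  about its continuity. The integral formula supplies the continuity that differentiation under the
  integral sign depends on.\<close>

lemma continuous_directional_derivative:
  fixes f :: "'a::{euclidean_space, complex_vector} \<Rightarrow> 'b::{euclidean_space, complex_vector}"
  assumes f: "holomorphic_map_on W f"
  shows "continuous_on W (\<lambda>z. frechet_derivative f (at z) v)"
proof (rule continuous_at_imp_continuous_on, rule ballI)
  fix z assume "z \<in> W"
  have "open W"
    using f by (simp add: holomorphic_map_on_def)
  with \<open>z \<in> W\<close> obtain \<rho> e where e: "\<rho> > 0" "e > 0"
    "\<And>y \<zeta>. y \<in> ball z e \<Longrightarrow> norm \<zeta> \<le> \<rho> \<Longrightarrow> y + \<zeta> *\<^sub>C v \<in> W"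
    by (metis directional_derivative_neighbourhood)
  have "continuous_on (ball z e)
      (\<lambda>y. integral (cbox 0 1) (\<lambda>t. inverse (circlepath 0 \<rho> t) *\<^sub>C f (y + circlepath 0 \<rho> t *\<^sub>C v)))"
    by (intro integral_continuous_on_param continuous_circlepath_scaleC[OF e(1) e(3) holomorphic_map_on_continuous[OF f]])
  then have "continuous_on (ball z e) (\<lambda>y. frechet_derivative f (at y) v)"
    by (rule continuous_on_eq) (use directional_derivative_integral[OF f e(1)] e(3) in \<open>auto simp: cbox_interval\<close>)
  then show "isCont (\<lambda>z. frechet_derivative f (at z) v) z"
    using \<open>e > 0\<close> by (simp add: continuous_on_eq_continuous_at)
qed

text \<open>Differentiates the circle integral under the integral sign. Each integrand is
  holomorphic in the base point, and complex linearity of its derivative survives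
  integration.\<close>

lemma holomorphic_directional_derivative:
  fixes f :: "'a::{euclidean_space, complex_vector} \<Rightarrow> 'b::{euclidean_space, complex_vector}"
  assumes f: "holomorphic_map_on W f"
  shows "holomorphic_map_on W (\<lambda>z. frechet_derivative f (at z) v)"
  unfolding holomorphic_map_on_iff
proof
  show "open W"
    using f by (simp add: holomorphic_map_on_def)
  show "\<forall>z\<in>W. cdiff (\<lambda>z. frechet_derivative f (at z) v) z"
  proof
    fix z assume "z \<in> W"
    with \<open>open W\<close> obtain \<rho> e where e: "\<rho> > 0" "e > 0"
      "\<And>y \<zeta>. y \<in> ball z e \<Longrightarrow> norm \<zeta> \<le> \<rho> \<Longrightarrow> y + \<zeta> *\<^sub>C v \<in> W"
      by (metis directional_derivative_neighbourhood)
    \<comment> \<open>The Leibniz rule wants the derivative as a continuous family of bounded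
      operators; in finite dimension this follows from continuity of every directional
      derivative.\<close>
    define D where "D = (\<lambda>y. Blinfun (frechet_derivative f (at y)))"
    have der: "(f has_derivative frechet_derivative f (at y)) (at y)"
      and lin: "frechet_derivative f (at y) (c *\<^sub>C w) = c *\<^sub>C frechet_derivative f (at y) w"
      if "y \<in> W" for y c w
    proof -
      obtain f' where "(f has_derivative f') (at y)" "\<And>c v. f' (c *\<^sub>C v) = c *\<^sub>C f' v"
        using f \<open>y \<in> W\<close> unfolding holomorphic_map_on_def by blast
      then show "(f has_derivative frechet_derivative f (at y)) (at y)"
        "frechet_derivative f (at y) (c *\<^sub>C w) = c *\<^sub>C frechet_derivative f (at y) w"
        using frechet_derivative_at by metis+
    qed
    have D: "blinfun_apply (D y) = frechet_derivative f (at y)" if "y \<in> W" for y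
      unfolding D_def by (rule bounded_linear_Blinfun_apply) (use der[OF that] in \<open>simp add: has_derivative_def\<close>)
    have contD: "continuous_on W D"
      by (rule continuous_on_blinfun_componentwise)
        (use D continuous_directional_derivative[OF f] in \<open>simp cong: continuous_on_cong\<close>)
    define M where "M = (\<lambda>c. Blinfun (\<lambda>x::'b. c *\<^sub>C x))"
    have M: "blinfun_apply (M c) = (\<lambda>x. c *\<^sub>C x)" for c
      unfolding M_def by (rule bounded_linear_Blinfun_apply) (rule bounded_linear_scaleC_right)
    define F where "F = (\<lambda>y t. inverse (circlepath 0 \<rho> t) *\<^sub>C f (y + circlepath 0 \<rho> t *\<^sub>C v))"
    define F' where "F' = (\<lambda>y t. M (inverse (circlepath 0 \<rho> t)) o\<^sub>L D (y + circlepath 0 \<rho> t *\<^sub>C v))"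
    have mem: "y + circlepath 0 \<rho> t *\<^sub>C v \<in> W" if "y \<in> ball z e" for y t
      using that e by (auto simp: circlepath norm_mult)
    have c: "continuous_on A (circlepath 0 \<rho>)" for A
      unfolding circlepath by (intro continuous_intros)
    have c2: "continuous_on (ball z e \<times> cbox 0 1) (\<lambda>x::'a \<times> real. circlepath 0 \<rho> (snd x))"
      by (intro continuous_on_compose2[OF c] continuous_intros) auto
    have contF': "continuous_on (ball z e \<times> cbox 0 1) (\<lambda>(y, t). F' y t)"
    proof -
      have "continuous_on (ball z e \<times> cbox 0 1) (\<lambda>x. D (fst x + circlepath 0 \<rho> (snd x) *\<^sub>C v))"
        by (intro continuous_on_compose2[OF contD] continuous_intros c2) (use mem in auto)
      moreover have "continuous_on UNIV M"
        by (rule continuous_on_blinfun_componentwise) (auto simp: M intro!: continuous_intros)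
      then have "continuous_on (ball z e \<times> cbox 0 1) (\<lambda>x::'a \<times> real. M (inverse (circlepath 0 \<rho> (snd x))))"
        by (rule continuous_on_compose2) (intro continuous_intros c2, use e in \<open>auto simp: circlepath\<close>)
      ultimately show ?thesis
        unfolding F'_def case_prod_unfold by (intro continuous_intros)
    qed
    have derF: "((\<lambda>y. F y t) has_derivative blinfun_apply (F' y t)) (at y within ball z e)"
      if "y \<in> ball z e" for y t
    proof -
      have "((\<lambda>y. f (y + circlepath 0 \<rho> t *\<^sub>C v)) has_derivative
          (\<lambda>w. frechet_derivative f (at (y + circlepath 0 \<rho> t *\<^sub>C v)) w)) (at y within ball z e)"
        by (rule has_derivative_compose[where g = f, OF _ der])
          (use mem[OF that] in \<open>auto intro!: derivative_eq_intros\<close>)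
      then show ?thesis
        unfolding F_def F'_def
        by (simp add: D[OF mem[OF that]] M o_def blinfun_compose.rep_eq
            bounded_linear.has_derivative[OF bounded_linear_scaleC_right])
    qed
    have contF0: "continuous_on (ball z e \<times> cbox 0 1) (\<lambda>(y, t). F y t)"
      unfolding F_def by (rule continuous_circlepath_scaleC[OF e(1) e(3) holomorphic_map_on_continuous[OF f]])
    have contF: "continuous_on (cbox 0 1) (F y)" if "y \<in> ball z e" for y
    proof -
      have "continuous_on (cbox 0 1) (\<lambda>t. case (y, t) of (y, t) \<Rightarrow> F y t)"
        by (rule continuous_on_compose2[OF contF0 continuous_on_Pair[OF continuous_on_const continuous_on_id]])
          (use that in auto)
      then show ?thesis
        by simp
    qed
    have "((\<lambda>y. integral (cbox 0 1) (F y)) has_derivative integral (cbox 0 1) (F' z)) (at z within ball z e)"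
      by (rule leibniz_rule[OF derF integrable_continuous[OF contF] contF']) (use e in auto)
    then have "((\<lambda>y. integral (cbox 0 1) (F y)) has_derivative integral (cbox 0 1) (F' z)) (at z)"
      using \<open>e > 0\<close> by (simp add: at_within_open[of z "ball z e"])
    moreover have "\<And>y. y \<in> ball z e \<Longrightarrow> integral (cbox 0 1) (F y) = frechet_derivative f (at y) v"
      using directional_derivative_integral[OF f e(1)] e(3) by (simp add: F_def cbox_interval)
    ultimately have der': "((\<lambda>y. frechet_derivative f (at y) v) has_derivative integral (cbox 0 1) (F' z)) (at z)"
      using has_derivative_transform_within_open[of _ _ z UNIV "ball z e"] \<open>e > 0\<close>
      by (metis (no_types, lifting) centre_in_ball open_ball)
    have intF': "F' z integrable_on cbox 0 1"
      by (rule integrable_continuous, rule continuous_on_compose2[OF contF', of _ "\<lambda>t. (z, t)", simplified])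
        (use e in \<open>auto intro!: continuous_intros\<close>)
    have app: "integral (cbox 0 1) (F' z) w = integral (cbox 0 1) (\<lambda>t. F' z t w)" for w
      by (rule blinfun_apply_integral[OF intF'])
    have "integral (cbox 0 1) (F' z) (c *\<^sub>C w) = c *\<^sub>C integral (cbox 0 1) (F' z) w" for c w
    proof -
      have "F' z t (c *\<^sub>C w) = c *\<^sub>C F' z t w" for t
        using mem[of z t] e by (simp add: F'_def M D lin scaleC_scaleC mult.commute)
      moreover have "(\<lambda>t. F' z t w) integrable_on cbox 0 1"
        using integrable_linear[OF intF' blinfun.bounded_linear_left[of w]] by (simp add: o_def)
      from integral_linear[OF this bounded_linear_scaleC_right, of c]
      have "integral (cbox 0 1) (\<lambda>t. c *\<^sub>C F' z t w) = c *\<^sub>C integral (cbox 0 1) (\<lambda>t. F' z t w)"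
        by (simp add: o_def)
      ultimately show ?thesis
        by (simp only: app)
    qed
    with der' show "cdiff (\<lambda>z. frechet_derivative f (at z) v) z"
      unfolding semidiff_def by blast
  qed
qed

lemma holomorphic_imp_Ck_on: "holomorphic_map_on W f \<Longrightarrow> Ck_on k W f"
proof (induction k arbitrary: f)
  case 0
  then show ?case
    by (simp add: holomorphic_map_on_continuous)
next
  case (Suc k)
  have "Ck_on k W (\<lambda>x. frechet_derivative f (at x) v)" for v
    by (intro Suc.IH holomorphic_directional_derivative Suc.prems)
  with Suc.prems show ?case
    by (auto simp: holomorphic_map_on_def differentiable_def)
qed

lemma holomorphic_imp_smooth_map_on: "holomorphic_map_on W f \<Longrightarrow> smooth_map_on W f"
  unfolding smooth_map_on_def
  by (metis holomorphic_imp_Ck_on holomorphic_map_on_def)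

section \<open>The complexified Cayley algebra\<close>

lemma distinct_8 [simp]:
  "(0::8) \<noteq> 1" "(0::8) \<noteq> 2" "(0::8) \<noteq> 3" "(0::8) \<noteq> 4" "(0::8) \<noteq> 5" "(0::8) \<noteq> 6" "(0::8) \<noteq> 7"
  "(1::8) \<noteq> 0" "(1::8) \<noteq> 2" "(1::8) \<noteq> 3" "(1::8) \<noteq> 4" "(1::8) \<noteq> 5" "(1::8) \<noteq> 6" "(1::8) \<noteq> 7"
  "(2::8) \<noteq> 0" "(2::8) \<noteq> 1" "(2::8) \<noteq> 3" "(2::8) \<noteq> 4" "(2::8) \<noteq> 5" "(2::8) \<noteq> 6" "(2::8) \<noteq> 7"
  "(3::8) \<noteq> 0" "(3::8) \<noteq> 1" "(3::8) \<noteq> 2" "(3::8) \<noteq> 4" "(3::8) \<noteq> 5" "(3::8) \<noteq> 6" "(3::8) \<noteq> 7"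
  "(4::8) \<noteq> 0" "(4::8) \<noteq> 1" "(4::8) \<noteq> 2" "(4::8) \<noteq> 3" "(4::8) \<noteq> 5" "(4::8) \<noteq> 6" "(4::8) \<noteq> 7"
  "(5::8) \<noteq> 0" "(5::8) \<noteq> 1" "(5::8) \<noteq> 2" "(5::8) \<noteq> 3" "(5::8) \<noteq> 4" "(5::8) \<noteq> 6" "(5::8) \<noteq> 7"
  "(6::8) \<noteq> 0" "(6::8) \<noteq> 1" "(6::8) \<noteq> 2" "(6::8) \<noteq> 3" "(6::8) \<noteq> 4" "(6::8) \<noteq> 5" "(6::8) \<noteq> 7"
  "(7::8) \<noteq> 0" "(7::8) \<noteq> 1" "(7::8) \<noteq> 2" "(7::8) \<noteq> 3" "(7::8) \<noteq> 4" "(7::8) \<noteq> 5" "(7::8) \<noteq> 6"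
  by simp_all

lemma UNIV_8: "(UNIV::8 set) = {0, 1, 2, 3, 4, 5, 6, 7}"
proof -
  have "distinct [0, 1, 2, 3, 4, 5, 6, 7::8]"
    by (simp only: distinct.simps list.set insert_iff empty_iff distinct_8 simp_thms)
  from distinct_card[OF this] have "card {0, 1, 2, 3, 4, 5, 6, 7::8} = CARD(8)"
    by (simp only: list.set list.size) simp
  then show ?thesis
    by (metis card_subset_eq finite subset_UNIV)
qed

lemma sum_8: "(\<Sum>i\<in>UNIV. f (i::8)) = f 0 + f 1 + f 2 + f 3 + f 4 + f 5 + f 6 + f 7"
  unfolding UNIV_8 by (simp add: add.assoc)

lemma forall_8: "(\<forall>i::8. P i) \<longleftrightarrow> P 0 \<and> P 1 \<and> P 2 \<and> P 3 \<and> P 4 \<and> P 5 \<and> P 6 \<and> P 7"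
proof -
  have "(\<forall>i::8. P i) \<longleftrightarrow> (\<forall>i\<in>UNIV. P i)"
    by simp
  then show ?thesis
    unfolding UNIV_8 by simp
qed

text \<open>The structure constants are evaluated once. The basic laws of the algebra below then
  become polynomial identities in the coordinates.\<close>

lemma cayley_mult_nth:
  "(x \<odot> y) $ 0 = x$0 * y$0 - x$1 * y$1 - x$2 * y$2 - x$3 * y$3 - x$4 * y$4 - x$5 * y$5 - x$6 * y$6 - x$7 * y$7"
  "(x \<odot> y) $ 1 = x$0 * y$1 + x$1 * y$0 + x$2 * y$3 - x$3 * y$2 + x$4 * y$5 - x$5 * y$4 + x$6 * y$7 - x$7 * y$6"
  "(x \<odot> y) $ 2 = x$0 * y$2 + x$2 * y$0 - x$1 * y$3 + x$3 * y$1 - x$4 * y$6 + x$6 * y$4 + x$5 * y$7 - x$7 * y$5"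
  "(x \<odot> y) $ 3 = x$0 * y$3 + x$3 * y$0 + x$1 * y$2 - x$2 * y$1 + x$4 * y$7 - x$7 * y$4 + x$5 * y$6 - x$6 * y$5"
  "(x \<odot> y) $ 4 = x$0 * y$4 + x$4 * y$0 - x$1 * y$5 + x$5 * y$1 + x$2 * y$6 - x$6 * y$2 - x$3 * y$7 + x$7 * y$3"
  "(x \<odot> y) $ 5 = x$0 * y$5 + x$5 * y$0 + x$1 * y$4 - x$4 * y$1 - x$2 * y$7 + x$7 * y$2 - x$3 * y$6 + x$6 * y$3"
  "(x \<odot> y) $ 6 = x$0 * y$6 + x$6 * y$0 - x$1 * y$7 + x$7 * y$1 - x$2 * y$4 + x$4 * y$2 + x$3 * y$5 - x$5 * y$3"
  "(x \<odot> y) $ 7 = x$0 * y$7 + x$7 * y$0 + x$1 * y$6 - x$6 * y$1 + x$2 * y$5 - x$5 * y$2 + x$3 * y$4 - x$4 * y$3"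
  unfolding cayley_mult_def vec_lambda_beta sum_8
  by (simp_all only: cayley_coeff_def cayley_cyclic_def cayley_triples_def insert_iff empty_iff
      prod.inject distinct_8 refl simp_thms if_True if_False of_bool_def, simp_all)

definition cdot :: "complex ^ 'n::finite \<Rightarrow> complex ^ 'n \<Rightarrow> complex"
  where "cdot x y = (\<Sum>i\<in>UNIV. x $ i * y $ i)"

text \<open>Left alternativity, \<open>a (a y) = (a a) y\<close>. It makes left multiplications by
  imaginary elements generate a Clifford algebra, which is how the spin group enters.\<close>

lemma cayley_left_square:
  assumes "a $ 0 = 0"
  shows "a \<odot> (a \<odot> y) = - cdot a a *s y"
  using assms unfolding vec_eq_iff forall_8 cdot_def sum_8
  by (simp add: cayley_mult_nth algebra_simps)

lemma cayley_left_skew: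
  assumes "a $ 0 = 0"
  shows "cdot (a \<odot> x) y = - cdot x (a \<odot> y)"
  using assms unfolding cdot_def sum_8
  by (simp add: cayley_mult_nth algebra_simps)

declare transpose_matrix_vector [simp del]

lemma cdot_sym: "cdot x y = cdot y x"
  by (simp add: cdot_def mult.commute)

lemma cdot_simps [simp]:
  "cdot (x + y) z = cdot x z + cdot y z" "cdot z (x + y) = cdot z x + cdot z y"
  "cdot (x - y) z = cdot x z - cdot y z" "cdot z (x - y) = cdot z x - cdot z y"
  "cdot (- x) z = - cdot x z" "cdot z (- x) = - cdot z x"
  "cdot (c *s x) z = c * cdot x z" "cdot z (c *s x) = c * cdot z x"
  "cdot 0 x = 0" "cdot x 0 = 0"
  "cdot (axis i a) x = a * x $ i" "cdot x (axis i a) = a * x $ i"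
  by (simp_all add: cdot_def algebra_simps sum.distrib sum_subtractf sum_negf sum_distrib_left axis_def
      if_distrib[where f = "\<lambda>u. u * _"] if_distrib[where f = "\<lambda>u. _ * u"] cong: if_cong)

lemma matrix_eqI: "(\<And>x. M *v x = N *v x) \<Longrightarrow> M = (N::complex ^ 'n::finite ^ 'm::finite)"
  by (simp add: matrix_eq)

lemma cdot_matrix: "cdot (M *v x) y = cdot x (transpose M *v y)"
proof -
  have "cdot (M *v x) y = (\<Sum>i\<in>UNIV. \<Sum>j\<in>UNIV. M $ i $ j * x $ j * y $ i)"
    by (simp add: cdot_def matrix_vector_mult_def sum_distrib_right)
  also have "\<dots> = (\<Sum>j\<in>UNIV. \<Sum>i\<in>UNIV. M $ i $ j * x $ j * y $ i)"
    by (rule sum.swap)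
  also have "\<dots> = cdot x (transpose M *v y)"
    by (simp add: cdot_def matrix_vector_mult_def transpose_def sum_distrib_left mult_ac)
  finally show ?thesis .
qed

lemma cdot_orthogonal: "transpose M ** M = mat c \<Longrightarrow> cdot (M *v x) (M *v y) = c * cdot x y"
proof -
  assume "transpose M ** M = mat c"
  then have "transpose M *v (M *v y) = mat c *v y"
    by (simp add: matrix_vector_mul_assoc)
  also have "mat c *v y = c *s y"
    by (simp add: vec_eq_iff matrix_vector_mult_def mat_def if_distrib[where f = "\<lambda>u. u * _"] cong: if_cong)
  finally show ?thesis
    by (simp add: cdot_matrix)
qed

lemma mat_vector_mult [simp]: "mat c *v (x::complex ^ 'n::finite) = c *s x"
  by (simp add: vec_eq_iff matrix_vector_mult_def mat_def if_distrib[where f = "\<lambda>u. u * _"] cong: if_cong)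

lemma scaleC_matrix_nth [simp]: "(c *\<^sub>C (M::complex ^ 'n::finite ^ 'm::finite)) $ i $ j = c * M $ i $ j"
  by (simp add: scaleC_vec_def scaleC_complex_def)

lemma scaleC_matrix:
  fixes M :: "complex ^ 'n::finite ^ 'm::finite"
  shows "(c *\<^sub>C M) *v x = c *s (M *v x)"
    and "transpose (c *\<^sub>C M) = c *\<^sub>C transpose M"
    and "(c *\<^sub>C M) ** N = c *\<^sub>C (M ** N)"
    and "M ** (c *\<^sub>C N) = c *\<^sub>C (M ** N)"
  by (simp_all add: vec_eq_iff matrix_vector_mult_def matrix_matrix_mult_def transpose_def
      sum_distrib_left mult_ac)

lemma matrix_mult_mat: "M ** mat c = c *\<^sub>C (M::complex ^ 'n::finite ^ 'm::finite)"
  by (rule matrix_eqI) (simp add: matrix_vector_mul_assoc[symmetric] scaleC_matrix vector_scalar_commute)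

lemma det_scaleC: "det (c *\<^sub>C (M::complex ^ 'n::finite ^ 'n)) = c ^ CARD('n) * det M"
proof -
  have "c *\<^sub>C M = mat c ** M"
    by (simp add: vec_eq_iff mat_def matrix_matrix_mult_def if_distrib[where f = "\<lambda>u. u * _"] cong: if_cong)
  then have "det (c *\<^sub>C M) = det (mat c :: complex ^ 'n ^ 'n) * det M"
    by (simp add: det_mul)
  also have "det (mat c :: complex ^ 'n ^ 'n) = (\<Prod>i\<in>(UNIV::'n set). c)"
    by (subst det_diagonal) (auto simp: mat_def)
  finally show ?thesis
    by simp
qed

definition outer :: "complex ^ 'n::finite \<Rightarrow> complex ^ 'n \<Rightarrow> complex ^ 'n ^ 'n"
  where "outer u v = (\<chi> i j. u $ i * v $ j)"

lemma outer_mult [simp]: "outer u v *v x = cdot v x *s u"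
  by (simp add: outer_def vec_eq_iff matrix_vector_mult_def cdot_def sum_distrib_left mult_ac)

definition vcnj :: "complex ^ 'n::finite \<Rightarrow> complex ^ 'n"
  where "vcnj x = (\<chi> i. cnj (x $ i))"

definition mcnj :: "complex ^ 'n::finite ^ 'm::finite \<Rightarrow> complex ^ 'n ^ 'm"
  where "mcnj M = (\<chi> i j. cnj (M $ i $ j))"

lemma vcnj_simps [simp]:
  "vcnj x $ i = cnj (x $ i)" "vcnj (x + y) = vcnj x + vcnj y" "vcnj (x - y) = vcnj x - vcnj y"
  "vcnj (- x) = - vcnj x" "vcnj (c *s x) = cnj c *s vcnj x" "vcnj (vcnj x) = x" "vcnj 0 = 0"
  "vcnj (axis i a) = axis i (cnj a)"
  by (simp_all add: vcnj_def vec_eq_iff axis_def)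

lemma mcnj_simps [simp]:
  "mcnj M $ i $ j = cnj (M $ i $ j)" "mcnj (mcnj M) = M" "mcnj (M ** N) = mcnj M ** mcnj N"
  "mcnj (transpose M) = transpose (mcnj M)" "mcnj (mat c) = mat (cnj c)"
  "mcnj (c *\<^sub>C M) = cnj c *\<^sub>C mcnj M" "vcnj (M *v x) = mcnj M *v vcnj x"
  by (simp_all add: mcnj_def vcnj_def vec_eq_iff matrix_matrix_mult_def matrix_vector_mult_def
      transpose_def mat_def)

lemma cdot_vcnj: "cdot (vcnj x) (vcnj y) = cnj (cdot x y)"
  by (simp add: cdot_def)

lemma det_mcnj: "det (mcnj M) = cnj (det M)"
  by (simp add: det_def mcnj_def)

lemma cdot_real: "vcnj a = a \<Longrightarrow> cdot a a = of_real ((norm a)\<^sup>2)"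
proof -
  assume a: "vcnj a = a"
  then have "cnj (a $ i) = a $ i" for i
    by (metis vcnj_simps(1))
  then have "a $ i * a $ i = of_real ((norm (a $ i))\<^sup>2)" for i
    by (metis complex_norm_square power2_eq_square)
  then show ?thesis
    by (simp add: cdot_def norm_vec_def L2_set_def sum_nonneg)
qed

lemma cayley_linear:
  "(x + x') \<odot> y = x \<odot> y + x' \<odot> y" "(x - x') \<odot> y = x \<odot> y - x' \<odot> y" "(- x) \<odot> y = - (x \<odot> y)"
  "(c *s x) \<odot> y = c *s (x \<odot> y)" "0 \<odot> y = 0"
  "x \<odot> (y + y') = x \<odot> y + x \<odot> y'" "x \<odot> (y - y') = x \<odot> y - x \<odot> y'" "x \<odot> (- y) = - (x \<odot> y)"
  "x \<odot> (c *s y) = c *s (x \<odot> y)" "x \<odot> 0 = 0"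
  by (simp_all add: cayley_mult_def vec_eq_iff algebra_simps sum.distrib sum_subtractf sum_negf sum_distrib_left)

lemma vcnj_cayley [simp]: "vcnj (x \<odot> y) = vcnj x \<odot> vcnj y"
  by (simp add: cayley_mult_def vec_eq_iff)

lemma axis_nth_8: "axis i a $ (j::8) = (if i = j then a else 0)"
  by (simp add: axis_def)

lemma cayley_unit [simp]: "axis 0 1 \<odot> x = x" "x \<odot> axis 0 1 = x"
  unfolding vec_eq_iff forall_8 by (simp_all add: cayley_mult_nth axis_nth_8)

text \<open>Polarization of \<open>cayley_left_square\<close>; the first term on the right accounts
  for the unit component of \<open>x\<close>.\<close>

lemma cayley_clifford:
  assumes "a $ 0 = 0"
  shows "a \<odot> (x \<odot> y) + x \<odot> (a \<odot> y) = (2 * x $ 0) *s (a \<odot> y) - (2 * cdot a x) *s y"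
  using assms unfolding vec_eq_iff forall_8 cdot_def sum_8
  by (simp add: cayley_mult_nth algebra_simps)

lemma cayley_right_square:
  assumes "b $ 0 = 0"
  shows "(v \<odot> b) \<odot> b = - cdot b b *s v"
  using assms unfolding vec_eq_iff forall_8 cdot_def sum_8
  by (simp add: cayley_mult_nth algebra_simps)

lemma cayley_nth_0: "a $ 0 = 0 \<Longrightarrow> (a \<odot> x) $ 0 = - cdot a x" "a $ 0 = 0 \<Longrightarrow> (x \<odot> a) $ 0 = - cdot a x"
  unfolding cdot_def sum_8 by (simp_all add: cayley_mult_nth algebra_simps)

text \<open>The composition property, polarized in the second factor. After the unit part of
  \<open>x\<close> is split off, the mixed terms cancel by skewness and the imaginary ones reduce to
  alternativity.\<close>

lemma cayley_norm: "cdot (x \<odot> y) (x \<odot> z) = cdot x x * cdot y z"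
proof -
  define a where "a = x - x $ 0 *s axis 0 1"
  have a: "a $ 0 = 0" and x: "x = x $ 0 *s axis 0 1 + a"
    by (simp_all add: a_def axis_nth_8)
  have "x \<odot> w = x $ 0 *s w + a \<odot> w" for w
    by (subst x) (simp add: cayley_linear)
  moreover have "cdot x x = (x $ 0)\<^sup>2 + cdot a a"
    by (simp add: a_def axis_nth_8 power2_eq_square)
  ultimately show ?thesis
    using cayley_left_skew[OF a, of y "a \<odot> z"] cayley_left_skew[OF a, of y z] cayley_left_square[OF a, of z]
    by (simp add: algebra_simps power2_eq_square)
qed

lemma cayley_anticommute:
  assumes "a $ 0 = 0" "b $ 0 = 0"
  shows "a \<odot> b = - (b \<odot> a) - (2 * cdot a b) *s axis 0 1"
  using assms unfolding vec_eq_iff forall_8 cdot_def sum_8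
  by (simp add: cayley_mult_nth algebra_simps axis_nth_8)

section \<open>Left multiplications, half turns and spin lifts\<close>

definition cayley_left :: "complex ^ 8 \<Rightarrow> complex ^ 8 ^ 8"
  where "cayley_left a = (\<chi> k j. \<Sum>i\<in>UNIV. of_int (cayley_coeff i j k) * a $ i)"

lemma cayley_left_mult [simp]: "cayley_left a *v y = a \<odot> y"
proof -
  have "(\<Sum>j\<in>UNIV. (\<Sum>i\<in>UNIV. of_int (cayley_coeff i j k) * a $ i) * y $ j) =
    (\<Sum>i\<in>UNIV. \<Sum>j\<in>UNIV. of_int (cayley_coeff i j k) * a $ i * y $ j)" for k
    unfolding sum_distrib_right by (rule sum.swap)
  then show ?thesis
    by (simp add: cayley_left_def cayley_mult_def matrix_vector_mult_def)
qed

lemma mcnj_cayley_left [simp]: "mcnj (cayley_left a) = cayley_left (vcnj a)"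
  by (simp add: cayley_left_def mcnj_def vec_eq_iff)

lemma cayley_left_scale: "cayley_left (c *s a) = c *\<^sub>C cayley_left a"
  by (rule matrix_eqI) (simp add: scaleC_matrix cayley_linear)

lemma cdot_eqI: "(\<And>y. cdot x y = cdot x' y) \<Longrightarrow> x = x'"
  by (simp add: vec_eq_iff) (metis cdot_simps(12) mult_1)

lemma transpose_eqI: "(\<And>x y. cdot (M *v x) y = cdot x (N *v y)) \<Longrightarrow> transpose M = (N::complex ^ 'n::finite ^ 'n)"
  by (rule matrix_eqI, rule cdot_eqI) (metis cdot_matrix cdot_sym)

lemma matrix_minus_eq_scaleC: "(- 1) *\<^sub>C M = - (M::complex ^ 'n::finite ^ 'm::finite)"
  by (simp add: vec_eq_iff)

lemma transpose_cayley_left: "a $ 0 = 0 \<Longrightarrow> transpose (cayley_left a) = - cayley_left a"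
  by (rule transpose_eqI)
    (simp add: cayley_left_skew scaleC_matrix flip: matrix_minus_eq_scaleC)

lemma det_square_orthogonal: "transpose (B::complex ^ 'n::finite ^ 'n) ** B = mat 1 \<Longrightarrow> (det B)\<^sup>2 = 1"
  by (metis det_I det_mul det_transpose power2_eq_square)

text \<open>A unit imaginary element acts on the Cayley algebra as the square of an orthogonal matrix,
  which forces determinant one.\<close>

lemma det_cayley_left:
  assumes a: "a $ 0 = 0" and "cdot a a \<noteq> 0"
  shows "det (cayley_left a) = (cdot a a) ^ 4"
proof -
  define c where "c = csqrt (cdot a a)"
  have c: "c\<^sup>2 = cdot a a" "c \<noteq> 0"
    using assms by (auto simp: c_def)
  define u where "u = (1 / c) *s a"
  have u: "u $ 0 = 0" "cdot u u = 1" "a = c *s u"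
    using a c by (auto simp: u_def power2_eq_square field_simps)
  define r where "r = complex_of_real (sqrt (1/2))"
  have r: "r * r = 1 / 2"
    by (simp add: r_def of_real_mult[symmetric] del: of_real_mult)
  \<comment> \<open>\<open>cayley_left u\<close> squares to minus one, so this is the eighth root of
    unity \<open>(1 + i) / sqrt 2\<close> with \<open>cayley_left u\<close> in the place of
    \<open>i\<close>; its square is \<open>cayley_left u\<close>.\<close>
  define B where "B = r *\<^sub>C (mat 1 + cayley_left u)"
  have B: "B *v x = r *s (x + u \<odot> x)" for x
    by (simp add: B_def scaleC_matrix matrix_vector_mult_add_rdistrib)
  have "transpose B = r *\<^sub>C (mat 1 - cayley_left u)"
    by (rule transpose_eqI)
      (simp add: B scaleC_matrix matrix_vector_mult_diff_rdistrib cayley_left_skew[OF u(1)] algebra_simps)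
  then have "transpose B ** B = mat 1"
    by (intro matrix_eqI)
      (simp add: matrix_vector_mul_assoc[symmetric] B scaleC_matrix matrix_vector_mult_diff_rdistrib
        cayley_linear cayley_left_square[OF u(1)] u(2), simp add: vec_eq_iff r[symmetric] algebra_simps,
        simp add: r mult.assoc[symmetric])
  moreover have "B ** B = cayley_left u"
    by (intro matrix_eqI)
      (simp add: matrix_vector_mul_assoc[symmetric] B
        cayley_linear cayley_left_square[OF u(1)] u(2), simp add: vec_eq_iff algebra_simps,
        simp add: r mult.assoc[symmetric])
  ultimately have "det (cayley_left u) = 1"
    by (metis det_mul det_square_orthogonal power2_eq_square)
  then have "det (cayley_left a) = c ^ 8"
    by (simp add: u(3) cayley_left_scale det_scaleC)
  then show ?thesis
    by (simp add: c(1)[symmetric] power_mult[symmetric])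
qed

text \<open>For a unit imaginary \<open>a\<close> this is the map \<open>x \<mapsto> - a x a\<close>: it fixes \<open>1\<close> and \<open>a\<close> and is \<open>- 1\<close> on their
  orthogonal complement.\<close>

definition half_turn :: "complex ^ 8 \<Rightarrow> complex ^ 8 ^ 8"
  where "half_turn a = 2 *\<^sub>C outer (axis 0 1) (axis 0 1) + (2 / cdot a a) *\<^sub>C outer a a - mat 1"

lemma half_turn_mult: "half_turn a *v x = (2 * x $ 0) *s axis 0 1 + (2 / cdot a a * cdot a x) *s a - x"
  by (simp add: half_turn_def matrix_vector_mult_diff_rdistrib matrix_vector_mult_add_rdistrib scaleC_matrix)

lemma half_turn_SO7C:
  assumes a: "a $ 0 = 0" and "cdot a a \<noteq> 0"
  shows "half_turn a \<in> SO7C"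
proof -
  define c where "c = csqrt (cdot a a)"
  have c: "c\<^sup>2 = cdot a a" "c \<noteq> 0"
    using assms by (auto simp: c_def)
  define u where "u = (1 / c) *s a"
  have u: "u $ 0 = 0" "cdot u u = 1" "a = c *s u"
    using a c by (auto simp: u_def power2_eq_square field_simps)
  define e :: "complex ^ 8" where "e = axis 0 1"
  have e: "cdot e e = 1" "cdot e u = 0" "cdot u e = 0"
    by (auto simp: e_def u)
  \<comment> \<open>\<open>X\<close> is the quarter turn in the plane of \<open>e\<close> and
    \<open>u\<close> and the identity on its complement, \<open>Y\<close> is its inverse. Hence
    \<open>half_turn a\<close> is minus the square of an orthogonal matrix, and in even dimension
    its determinant is one.\<close>
  define X where "X = mat 1 - outer e e - outer u u + outer u e - outer e u"
  have X: "X *v x = x - cdot e x *s e - cdot u x *s u + cdot e x *s u - cdot u x *s e" for x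
    by (simp add: X_def matrix_vector_mult_diff_rdistrib matrix_vector_mult_add_rdistrib)
  define Y where "Y = mat 1 - outer e e - outer u u + outer e u - outer u e"
  have Y: "Y *v x = x - cdot e x *s e - cdot u x *s u + cdot u x *s e - cdot e x *s u" for x
    by (simp add: Y_def matrix_vector_mult_diff_rdistrib matrix_vector_mult_add_rdistrib)
  have XY: "transpose X = Y"
    by (rule transpose_eqI) (simp add: X Y cdot_sym mult.commute)
  have YX: "Y ** X = mat 1"
    by (rule matrix_eqI) (simp add: matrix_vector_mul_assoc[symmetric] X Y e u(2) algebra_simps)
  then have orth: "transpose X ** X = mat 1"
    by (simp add: XY)
  have XX: "half_turn a = (-1) *\<^sub>C (X ** X)"
    by (rule matrix_eqI)
      (simp add: matrix_vector_mul_assoc[symmetric] X e u(2) scaleC_matrix half_turn_mult u(3) c(2)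
        e_def[symmetric], simp add: vec_eq_iff e_def algebra_simps)
  have "transpose (half_turn a) ** half_turn a = transpose X ** (transpose X ** X) ** X"
    by (simp add: XX scaleC_matrix scaleC_scaleC matrix_transpose_mul matrix_mul_assoc vec_eq_iff)
  also have "\<dots> = mat 1"
    by (simp add: orth)
  finally have "transpose (half_turn a) ** half_turn a = mat 1" .
  moreover have "det (half_turn a) = 1"
    using det_square_orthogonal[OF orth] by (simp add: XX det_scaleC det_mul power2_eq_square)
  moreover have "half_turn a *v axis 0 1 = axis 0 1"
    by (simp add: half_turn_mult axis_nth_8 a vec_eq_iff)
  ultimately show ?thesis
    by (simp add: SO7C_def SO8C_def cayley_basis_def)
qed


text \<open>Makes the half turn the partner of left multiplication by \<open>a\<close> in the spin
  relation. By alternativity \<open>a \<odot> (a \<odot> y)\<close> cancels the denominator of the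
  half turn, and what remains is the Clifford relation.\<close>

lemma half_turn_cayley:
  assumes a: "a $ 0 = 0" and "cdot a a \<noteq> 0"
  shows "(half_turn a *v x) \<odot> (a \<odot> y) = a \<odot> (x \<odot> y)"
proof -
  have "(half_turn a *v x) \<odot> (a \<odot> y) =
      (2 * x $ 0) *s (a \<odot> y) - (2 * cdot a x) *s y - x \<odot> (a \<odot> y)"
    using assms(2) by (simp add: half_turn_mult cayley_linear cayley_left_square[OF a] vec_eq_iff)
  then show ?thesis
    by (simp add: cayley_clifford[OF a, symmetric])
qed

text \<open>Similitudes with factor \<open>\<nu>\<close> are allowed, so that left multiplications by imaginary elements need
  not be normalized by square roots.\<close>

definition spin_lift :: "complex ^ 8 ^ 8 \<Rightarrow> complex ^ 8 ^ 8 \<Rightarrow> complex \<Rightarrow> bool"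
  where "spin_lift g g0 \<nu> \<longleftrightarrow> g0 \<in> SO7C \<and> (\<forall>x y. (g0 *v x) \<odot> (g *v y) = g *v (x \<odot> y)) \<and>
    transpose g ** g = mat \<nu> \<and> det g = \<nu> ^ 4"

lemma SO8C_mult: "g \<in> SO8C \<Longrightarrow> h \<in> SO8C \<Longrightarrow> g ** h \<in> SO8C"
proof -
  assume g: "g \<in> SO8C" and h: "h \<in> SO8C"
  have "transpose (g ** h) ** (g ** h) = transpose h ** (transpose g ** g) ** h"
    by (simp add: matrix_transpose_mul matrix_mul_assoc)
  with g h show ?thesis
    by (simp add: SO8C_def det_mul)
qed

lemma SO7C_mult: "g \<in> SO7C \<Longrightarrow> h \<in> SO7C \<Longrightarrow> g ** h \<in> SO7C"
  by (simp add: SO7C_def SO8C_mult matrix_vector_mul_assoc[symmetric])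

lemma SO8C_inverse:
  assumes "g \<in> SO8C"
  shows "transpose g ** g = mat 1" "g ** transpose g = mat 1"
    "transpose g *v (g *v x) = x" "g *v (transpose g *v x) = x" "transpose g \<in> SO8C"
proof -
  show *: "transpose g ** g = mat 1"
    using assms by (simp add: SO8C_def)
  then show **: "g ** transpose g = mat 1"
    by (simp add: matrix_left_right_inverse)
  show "transpose g *v (g *v x) = x" "g *v (transpose g *v x) = x"
    using * ** by (simp_all only: matrix_vector_mul_assoc matrix_vector_mul_lid)
  show "transpose g \<in> SO8C"
    using assms ** by (simp add: SO8C_def)
qed

lemma spin_lift_mult:
  assumes "spin_lift g g0 \<nu>" "spin_lift h h0 \<mu>"
  shows "spin_lift (g ** h) (g0 ** h0) (\<nu> * \<mu>)"
proof -
  have "transpose (g ** h) ** (g ** h) = transpose h ** (transpose g ** g) ** h"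
    by (simp add: matrix_transpose_mul matrix_mul_assoc)
  also have "\<dots> = \<nu> *\<^sub>C (transpose h ** h)"
    using assms by (simp add: spin_lift_def matrix_mult_mat scaleC_matrix)
  also have "\<dots> = mat (\<nu> * \<mu>)"
    using assms by (intro matrix_eqI) (simp add: spin_lift_def scaleC_matrix)
  finally show ?thesis
    using assms by (simp add: spin_lift_def SO7C_mult det_mul power_mult_distrib matrix_vector_mul_assoc[symmetric])
qed

lemma spin_lift_scale:
  assumes "spin_lift g g0 \<nu>"
  shows "spin_lift (c *\<^sub>C g) g0 (c\<^sup>2 * \<nu>)"
proof -
  have "transpose (c *\<^sub>C g) ** (c *\<^sub>C g) = mat (c\<^sup>2 * \<nu>)"
    using assms by (intro matrix_eqI) (simp add: spin_lift_def scaleC_matrix power2_eq_square)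
  then show ?thesis
    using assms by (simp add: spin_lift_def scaleC_matrix cayley_linear det_scaleC power_mult_distrib flip: power_mult)
qed

lemma spin_lift_cayley_left:
  assumes "a $ 0 = 0" "cdot a a \<noteq> 0"
  shows "spin_lift (cayley_left a) (half_turn a) (cdot a a)"
proof -
  have "transpose (cayley_left a) ** cayley_left a = mat (cdot a a)"
    using assms(1)
    by (intro matrix_eqI)
      (simp add: transpose_cayley_left scaleC_matrix cayley_left_square matrix_vector_mul_assoc[symmetric]
        flip: matrix_minus_eq_scaleC)
  then show ?thesis
    using assms by (simp add: spin_lift_def half_turn_SO7C half_turn_cayley det_cayley_left)
qed

text \<open>The relation \<open>(g\<^sub>0 x)(g y) = g (x y)\<close> at \<open>y = g\<^sup>-\<^sup>1 e\<^sub>0\<close> determines \<open>g\<^sub>0\<close>.\<close>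

definition vector_rep :: "complex ^ 8 ^ 8 \<Rightarrow> complex ^ 8 ^ 8"
  where "vector_rep g = (\<chi> i j. (g *v (axis j 1 \<odot> (transpose g *v axis 0 1))) $ i)"

lemma vector_rep_mult: "vector_rep g *v x = g *v (x \<odot> (transpose g *v axis 0 1))"
proof -
  have "x \<odot> w = (\<Sum>j\<in>UNIV. x $ j *s (axis j 1 \<odot> w))" for w
    unfolding vec_eq_iff forall_8 sum_8 by (simp add: cayley_mult_nth axis_nth_8)
  then have "g *v (x \<odot> w) = (\<Sum>j\<in>UNIV. x $ j *s (g *v (axis j 1 \<odot> w)))" for w
    unfolding sum_8 by (simp add: matrix_vector_right_distrib vector_scalar_commute)
  then show ?thesis
    by (simp add: vec_eq_iff vector_rep_def matrix_vector_mult_def[of "vec_lambda _"] mult.commute)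
qed

lemma spin_lift_unique:
  assumes "spin_lift g g0 1"
  shows "g0 = vector_rep g"
proof (rule matrix_eqI)
  fix x
  have "g \<in> SO8C"
    using assms by (simp add: spin_lift_def SO8C_def)
  then have "g0 *v x = (g0 *v x) \<odot> (g *v (transpose g *v axis 0 1))"
    by (simp add: SO8C_inverse)
  then show "g0 *v x = vector_rep g *v x"
    using assms by (simp add: spin_lift_def vector_rep_mult)
qed

text \<open>Uniqueness of the partner replaces the existential quantifier in \<open>Spin7C\<close>
  by an explicit polynomial expression in \<open>g\<close>.\<close>

lemma Spin7C_iff: "g \<in> Spin7C \<longleftrightarrow> spin_lift g (vector_rep g) 1"
proof
  assume "g \<in> Spin7C"
  then obtain g0 where "spin_lift g g0 1"
    by (auto simp: Spin7C_def spin_lift_def SO8C_def)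
  then show "spin_lift g (vector_rep g) 1"
    using spin_lift_unique by blast
qed (auto simp: Spin7C_def spin_lift_def SO8C_def)

lemma spin_lift_Spin7C: "spin_lift g g0 1 \<Longrightarrow> g \<in> Spin7C"
  using Spin7C_iff spin_lift_unique by blast

lemma G2C_spin_lift: "g \<in> G2C \<Longrightarrow> g *v axis 0 1 = axis 0 1" "g \<in> G2C \<Longrightarrow> spin_lift g g 1"
proof -
  assume g: "g \<in> G2C"
  then have g8: "g \<in> SO8C" and hom: "(g *v x) \<odot> (g *v y) = g *v (x \<odot> y)" for x y
    by (simp_all add: G2C_def)
  show e: "g *v axis 0 1 = axis 0 1"
    using hom[of "axis 0 1" "transpose g *v axis 0 1"] by (simp add: SO8C_inverse[OF g8])
  show "spin_lift g g 1"
    using g8 hom e by (simp add: spin_lift_def SO7C_def SO8C_def cayley_basis_def)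
qed

text \<open>If \<open>g\<close> fixes the unit, setting \<open>y\<close> to the unit in the spin
  relation gives \<open>g0 x = g x\<close>, so the relation becomes multiplicativity of
  \<open>g\<close>.\<close>

lemma G2C_iff: "g \<in> G2C \<longleftrightarrow> g \<in> Spin7C \<and> g *v axis 0 1 = axis 0 1"
proof
  assume "g \<in> G2C"
  then show "g \<in> Spin7C \<and> g *v axis 0 1 = axis 0 1"
    using G2C_spin_lift spin_lift_Spin7C by blast
next
  assume g: "g \<in> Spin7C \<and> g *v axis 0 1 = axis 0 1"
  then obtain g0 where g0: "spin_lift g g0 1"
    using Spin7C_iff by blast
  have "g0 *v x = g *v x" for x
    using g0 g by (metis cayley_unit(2) spin_lift_def)
  with g0 show "g \<in> G2C"
    by (simp add: G2C_def spin_lift_def SO8C_def)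
qed

section \<open>Transitivity on unit quadrics\<close>

text \<open>Right alternativity writes \<open>v\<close> as \<open>- (v b) b / (b, b)\<close>, and
  orthogonality of \<open>b\<close> and \<open>v\<close> makes \<open>v b\<close> imaginary. The two
  left multiplications therefore carry the unit to \<open>v\<close>, and their similitude factors
  cancel against the square of the scalar.\<close>

lemma Spin7C_section:
  assumes v: "cdot v v = 1" and b: "b $ 0 = 0" "cdot b b \<noteq> 0" "cdot b v = 0"
  defines "g \<equiv> (- 1 / cdot b b) *\<^sub>C (cayley_left (v \<odot> b) ** cayley_left b)"
  shows "g \<in> Spin7C" "g *v axis 0 1 = v"
proof -
  have v0: "(v \<odot> b) $ 0 = 0"
    using b by (simp add: cayley_nth_0)
  have n: "cdot (v \<odot> b) (v \<odot> b) = cdot b b"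
    by (simp add: cayley_norm v)
  have "spin_lift g (half_turn (v \<odot> b) ** half_turn b) ((- 1 / cdot b b)\<^sup>2 * (cdot b b * cdot b b))"
    unfolding g_def using spin_lift_cayley_left[OF v0] spin_lift_cayley_left[OF b(1)] b(2) n
    by (intro spin_lift_scale spin_lift_mult) auto
  moreover have "(- 1 / cdot b b)\<^sup>2 * (cdot b b * cdot b b) = 1"
    using b(2) by (simp add: power2_eq_square)
  ultimately show "g \<in> Spin7C"
    using spin_lift_Spin7C by metis
  show "g *v axis 0 1 = v"
    using b(2) by (simp add: g_def scaleC_matrix matrix_vector_mul_assoc[symmetric] cayley_right_square[OF b(1)])
qed

text \<open>The chosen matrix is a product of four imaginary multiplications; the two on the right
  send \<open>v\<close> to \<open>w\<close>, and the two on the left correct the action on the unit.\<close>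

lemma G2C_transport:
  assumes v: "v $ 0 = 0" "cdot v v = 1" and w: "w $ 0 = 0" "cdot w w = 1"
    and c: "c = 2 + 2 * cdot v w" "c \<noteq> 0"
    and a: "a $ 0 = 0" "cdot a a \<noteq> 0" "cdot a v = 0" "cdot a w = 0" "cdot a (v \<odot> w) = 0"
  defines "b \<equiv> a \<odot> ((v + w) \<odot> v)"
  defines "g \<equiv> (- 1 / (c * cdot a a)) *\<^sub>C
    (cayley_left b ** (cayley_left a ** (cayley_left (v + w) ** cayley_left v)))"
  shows "g \<in> G2C" "g *v v = w"
    and "z $ 0 = 0 \<Longrightarrow> cdot z v = 0 \<Longrightarrow> cdot z w = 0 \<Longrightarrow> cdot a z = 0 \<Longrightarrow> cdot a (z \<odot> (w \<odot> v)) = 0 \<Longrightarrow> g *v z = z"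
proof -
  have wv: "w \<odot> v = - (v \<odot> w) - (2 * cdot v w) *s axis 0 1"
    using cayley_anticommute[OF w(1) v(1)] by (simp add: cdot_sym)
  define u where "u = (v + w) \<odot> v"
  have u: "u = w \<odot> v - axis 0 1"
    using cayley_left_square[OF v(1), of "axis 0 1"] v(2) by (simp add: u_def cayley_linear)
  have n: "cdot (v + w) (v + w) = c"
    using v w by (simp add: c cdot_sym[of w v])
  have nu: "cdot u u = c"
    by (simp only: u_def cayley_norm n v mult_1_right)
  have nb: "cdot b b = c * cdot a a"
    unfolding b_def u_def[symmetric] cayley_norm nu by (rule mult.commute)
  \<comment> \<open>The unit component of \<open>a \<odot> u\<close> is \<open>- cdot a u\<close>.
    It vanishes because \<open>u\<close> is a combination of \<open>v \<odot> w\<close> and the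
    unit, both orthogonal to \<open>a\<close>.\<close>
  have b0: "b $ 0 = 0"
    using a unfolding b_def u_def[symmetric] cayley_nth_0(1)[OF a(1)] u wv by (simp add: a)
  have b': "b = a \<odot> u"
    by (simp add: b_def u_def)
  have nz: "cdot b b \<noteq> 0" "cdot (v + w) (v + w) \<noteq> 0" "(v + w) $ 0 = 0" "cdot v v \<noteq> 0"
    unfolding nb n using a c(2) v w by simp_all
  have sl: "spin_lift g (half_turn b ** (half_turn a ** (half_turn (v + w) ** half_turn v)))
      ((- 1 / (c * cdot a a))\<^sup>2 * (cdot b b * (cdot a a * (cdot (v + w) (v + w) * cdot v v))))"
    unfolding g_def by (intro spin_lift_scale spin_lift_mult spin_lift_cayley_left b0 nz a v)
  moreover have "(- 1 / (c * cdot a a))\<^sup>2 * (cdot b b * (cdot a a * (cdot (v + w) (v + w) * cdot v v))) = 1"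
    unfolding n nb v using c(2) a(2) by (simp add: power2_eq_square)
  ultimately have sl: "spin_lift g (half_turn b ** (half_turn a ** (half_turn (v + w) ** half_turn v))) 1"
    by metis
  have "g *v axis 0 1 = (- 1 / (c * cdot a a)) *s (b \<odot> (a \<odot> u))"
    by (simp add: g_def scaleC_matrix matrix_vector_mul_assoc[symmetric] u_def)
  also have "\<dots> = axis 0 1"
    using cayley_left_square[OF b0, of "axis 0 1"] c(2) a(2) by (simp add: b'[symmetric] nb)
  finally have e0: "g *v axis 0 1 = axis 0 1" .
  then show g: "g \<in> G2C"
    using sl G2C_iff spin_lift_Spin7C by blast
  \<comment> \<open>An element fixing the unit is its own vector representation, so \<open>g\<close>
    can be evaluated as a product of four half turns instead of four multiplications.\<close>
  have gx: "g *v x = half_turn b *v (half_turn a *v (half_turn (v + w) *v (half_turn v *v x)))" for x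
    using spin_lift_unique[OF sl] spin_lift_unique[OF G2C_spin_lift(2)[OF g]]
    by (simp add: matrix_vector_mul_assoc)
  have neg: "half_turn p *v x = - x" if "cdot p x = 0" "x $ 0 = 0" for p x
    using that by (simp add: half_turn_mult vec_eq_iff)
  have neg2: "half_turn p *v (- x) = x" if "cdot p x = 0" "x $ 0 = 0" for p x
    using that by (simp add: half_turn_mult vec_eq_iff)
  have "half_turn v *v v = v"
    using v by (simp add: half_turn_mult vec_eq_iff)
  \<comment> \<open>\<open>v\<close> and \<open>w\<close> have the same square, so the half turn
    about \<open>v + w\<close> exchanges them. The half turns about \<open>a\<close> and
    \<open>b\<close>, both orthogonal to \<open>w\<close>, then change its sign twice.\<close>
  moreover have "half_turn (v + w) *v v = w"
  proof -
    have "half_turn (v + w) *v v = (2 / c * (1 + cdot v w)) *s (v + w) - v"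
      unfolding half_turn_mult n using v by (simp add: cdot_sym[of w v])
    also have "2 / c * (1 + cdot v w) = 1"
      using c by (simp add: field_simps)
    finally show ?thesis by simp
  qed
  moreover have bw: "cdot b w = 0"
  proof -
    have "a \<odot> w = - (w \<odot> a)"
      using cayley_anticommute[OF a(1) w(1)] a by simp
    then have "cdot u (a \<odot> w) = - cdot (w \<odot> v) (w \<odot> a) - (a \<odot> w) $ 0"
      by (simp add: u)
    also have "\<dots> = 0"
      using a by (simp add: cayley_norm cayley_nth_0 cdot_sym[of v a])
    finally show ?thesis
      by (simp add: b' cayley_left_skew[OF a(1)])
  qed
  ultimately show "g *v v = w"
    unfolding gx by (simp add: neg neg2 a w)
  assume z: "z $ 0 = 0" "cdot z v = 0" "cdot z w = 0" "cdot a z = 0" "cdot a (z \<odot> (w \<odot> v)) = 0"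
  have "cdot b z = 0"
  proof -
    have "a \<odot> z = - (z \<odot> a)"
      using cayley_anticommute[OF a(1) z(1)] z by simp
    then have "cdot u (a \<odot> z) = - cdot (w \<odot> v) (z \<odot> a) - (a \<odot> z) $ 0"
      by (simp add: u)
    also have "cdot (w \<odot> v) (z \<odot> a) = - cdot (z \<odot> (w \<odot> v)) a"
      using cayley_left_skew[OF z(1)] by simp
    finally have "cdot u (a \<odot> z) = 0"
      using z(4,5) cayley_nth_0(1)[OF a(1), of z] by (simp add: cdot_sym[of "z \<odot> (w \<odot> v)" a])
    then show ?thesis
      by (simp add: b' cayley_left_skew[OF a(1)])
  qed
  \<comment> \<open>\<open>z\<close> is orthogonal to all four axes, so it is negated four
    times.\<close>
  then show "g *v z = z"
    unfolding gx using z a by (simp add: neg neg2 cdot_sym[of v z] cdot_sym[of w z])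
qed

section \<open>Real elements moving real vectors\<close>

lemma real_norm_ne_0: "vcnj a = a \<Longrightarrow> a \<noteq> 0 \<Longrightarrow> cdot a a \<noteq> 0"
  by (simp add: cdot_real)

text \<open>Fewer than eight vectors span a proper subspace of the real coordinate space, and a real
  vector orthogonal to them can be normalized because it is not isotropic.\<close>

lemma real_vector_orthogonal:
  fixes A :: "(complex ^ 8) set"
  assumes "finite A" "card A < 8" and real: "\<And>u. u \<in> A \<Longrightarrow> vcnj u = u"
  obtains a where "vcnj a = a" "cdot a a = 1" "\<And>u. u \<in> A \<Longrightarrow> cdot a u = 0"
proof -
  define re where "re = (\<lambda>u::complex ^ 8. (\<chi> i. Re (u $ i)) :: real ^ 8)"
  have "dim (span (re ` A)) < DIM(real ^ 8)"
    using dim_le_card'[of "re ` A"] card_image_le[of A re] assms by (simp add: dim_span)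
  then have "span (re ` A) \<noteq> UNIV"
    by (metis dim_UNIV less_irrefl)
  then obtain x where x: "x \<noteq> 0" "\<And>y. y \<in> span (re ` A) \<Longrightarrow> orthogonal x y"
    using orthogonal_to_subspace_exists[of "re ` A"] assms dim_le_card'[of "re ` A"] card_image_le[of A re]
    by auto
  define b where "b = (\<chi> i. complex_of_real (x $ i))"
  have b: "vcnj b = b"
    by (simp add: b_def vec_eq_iff)
  have "b \<noteq> 0"
    using x(1) by (auto simp: b_def vec_eq_iff)
  have ortho: "cdot b u = 0" if "u \<in> A" for u
  proof -
    have "u $ i = of_real (Re (u $ i))" for i
      using real[OF that] by (metis Reals_cnj_iff of_real_Re vcnj_simps(1))
    then have "cdot b u = (\<Sum>i\<in>UNIV. of_real (x $ i) * of_real (Re (u $ i)))"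
      unfolding cdot_def by (intro sum.cong) (auto simp: b_def)
    also have "\<dots> = of_real (x \<bullet> re u)"
      by (simp add: inner_vec_def re_def)
    also have "x \<bullet> re u = 0"
      using x(2)[of "re u"] that by (simp add: orthogonal_def span_base)
    finally show ?thesis by simp
  qed
  define a where "a = of_real (1 / norm b) *s b"
  show ?thesis
  proof
    show "vcnj a = a"
      by (simp add: a_def b)
    show "cdot a a = 1"
      using \<open>b \<noteq> 0\<close> by (simp add: a_def cdot_real[OF b] power2_eq_square)
    show "\<And>u. u \<in> A \<Longrightarrow> cdot a u = 0"
      by (simp add: a_def ortho)
  qed
qed

text \<open>All conditions on the auxiliary vector of \<open>G2C_transport\<close>, including the
  one that keeps \<open>z\<close> fixed, are orthogonality to six real vectors, so dimension eight
  leaves a real choice. For \<open>v = - w\<close> the axis \<open>v + w\<close> would be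
  zero.\<close>

lemma real_G2_transport_aux:
  assumes v: "v $ 0 = 0" "cdot v v = 1" "vcnj v = v" and w: "w $ 0 = 0" "cdot w w = 1" "vcnj w = w"
    and z: "z $ 0 = 0" "vcnj z = z" "cdot z v = 0" "cdot z w = 0" and "v \<noteq> - w"
  obtains g where "g \<in> G2C" "mcnj g = g" "g *v v = w" "g *v z = z"
proof -
  define c where "c = 2 + 2 * cdot v w"
  have "cdot (v + w) (v + w) = c"
    using v w by (simp add: c_def cdot_sym[of w v])
  moreover have "v + w \<noteq> 0"
    using \<open>v \<noteq> - w\<close> by (simp add: eq_neg_iff_add_eq_0)
  ultimately have "c \<noteq> 0"
    using real_norm_ne_0[of "v + w"] v w by simp
  let ?A = "{axis 0 1, v, w, v \<odot> w, z, z \<odot> (w \<odot> v)}"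
  have "card ?A < 8"
    using card_length[of "[axis 0 1, v, w, v \<odot> w, z, z \<odot> (w \<odot> v)]"] by simp
  then obtain a where a: "vcnj a = a" "cdot a a = 1" "\<And>u. u \<in> ?A \<Longrightarrow> cdot a u = 0"
    by (rule real_vector_orthogonal[rotated]) (use v w z in auto)
  define g where "g = (- 1 / (c * cdot a a)) *\<^sub>C
    (cayley_left (a \<odot> ((v + w) \<odot> v)) ** (cayley_left a ** (cayley_left (v + w) ** cayley_left v)))"
  have a': "a $ 0 = 0" "cdot a a \<noteq> 0" "cdot a v = 0" "cdot a w = 0" "cdot a (v \<odot> w) = 0"
    using a(3)[of "axis 0 1"] a(2,3) by auto
  note G2C_transport[OF v(1,2) w(1,2) c_def \<open>c \<noteq> 0\<close> a', folded g_def]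
  moreover have "cnj c = c"
    using v w by (simp add: c_def cdot_vcnj[symmetric])
  then have "mcnj g = g"
    using v w a by (simp add: g_def)
  ultimately show ?thesis
    using that z a(3) by auto
qed

text \<open>Antipodal vectors are joined through a third unit vector \<open>m\<close>, orthogonal to
  the unit, to \<open>v\<close> and to \<open>z\<close>, so that neither of the two moves is
  antipodal.\<close>

lemma real_G2_transport:
  assumes v: "v $ 0 = 0" "cdot v v = 1" "vcnj v = v" and w: "w $ 0 = 0" "cdot w w = 1" "vcnj w = w"
    and z: "z $ 0 = 0" "vcnj z = z" "cdot z v = 0" "cdot z w = 0"
  obtains g where "g \<in> G2C" "mcnj g = g" "g *v v = w" "g *v z = z"
proof (cases "v = - w")
  case False
  then show ?thesis
    using real_G2_transport_aux[OF v w z] that by blast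
next
  case True
  obtain m where m: "vcnj m = m" "cdot m m = 1" "\<And>u. u \<in> {axis 0 1, v, z} \<Longrightarrow> cdot m u = 0"
    by (rule real_vector_orthogonal[of "{axis 0 1, v, z}"]) (use v z in \<open>auto simp: card_insert_if\<close>)
  have m': "m $ 0 = 0" "cdot m v = 0" "cdot m w = 0" "cdot z m = 0"
    using m(3)[of "axis 0 1"] m(3)[of v] m(3)[of z] True by (auto simp: cdot_sym)
  have "v \<noteq> - m" "m \<noteq> - w"
    using m' m(2) by auto
  then obtain g h where "g \<in> G2C" "mcnj g = g" "g *v v = m" "g *v z = z"
    "h \<in> G2C" "mcnj h = h" "h *v m = w" "h *v z = z"
    using real_G2_transport_aux[OF v m'(1) m(2,1) z(1-3) m'(4)] 
      real_G2_transport_aux[OF m'(1) m(2,1) w z(1,2) m'(4) z(4)] by metis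
  then show ?thesis
    by (intro that[of "h ** g"]) (auto simp: G2C_def SO8C_mult matrix_vector_mul_assoc[symmetric])
qed

lemma G2C_mult: "g \<in> G2C \<Longrightarrow> h \<in> G2C \<Longrightarrow> g ** h \<in> G2C"
  by (simp add: G2C_def SO8C_mult matrix_vector_mul_assoc[symmetric])

lemma G2C_transpose: assumes g: "g \<in> G2C" shows "transpose g \<in> G2C"
proof -
  have g8: "g \<in> SO8C"
    using g by (simp add: G2C_def)
  have "(transpose g *v x) \<odot> (transpose g *v y) = transpose g *v (x \<odot> y)" for x y
  proof -
    have "(g *v (transpose g *v x)) \<odot> (g *v (transpose g *v y)) = g *v ((transpose g *v x) \<odot> (transpose g *v y))"
      using g by (simp add: G2C_def)
    then show ?thesis
      by (metis SO8C_inverse(3,4) g8)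
  qed
  then show ?thesis
    by (simp add: G2C_def SO8C_inverse(5)[OF g8])
qed

lemma spin_lift_Spin7C_mult:
  assumes "g \<in> Spin7C" "h \<in> Spin7C"
  shows "spin_lift (g ** h) (vector_rep g ** vector_rep h) 1"
  using spin_lift_mult[of g "vector_rep g" 1 h "vector_rep h" 1] assms by (simp add: Spin7C_iff)

lemma Spin7C_mult: "g \<in> Spin7C \<Longrightarrow> h \<in> Spin7C \<Longrightarrow> g ** h \<in> Spin7C"
  by (rule spin_lift_Spin7C[OF spin_lift_Spin7C_mult])

lemma vector_rep_hom:
  "g \<in> Spin7C \<Longrightarrow> h \<in> Spin7C \<Longrightarrow> vector_rep (g ** h) = vector_rep g ** vector_rep h"
  by (rule spin_lift_unique[OF spin_lift_Spin7C_mult, symmetric])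

lemma vector_rep_G2C: "g \<in> G2C \<Longrightarrow> vector_rep g = g"
  using G2C_spin_lift(2) spin_lift_unique by metis

lemma SO7C_transpose: "g \<in> SO7C \<Longrightarrow> transpose g \<in> SO7C"
  by (metis (mono_tags, lifting) SO7C_def SO8C_inverse(3,5) mem_Collect_eq)

lemma Spin7C_transpose: "g \<in> Spin7C \<Longrightarrow> transpose g \<in> Spin7C"
proof -
  assume g: "g \<in> Spin7C"
  define g0 where "g0 = vector_rep g"
  have sl: "spin_lift g g0 1"
    using g Spin7C_iff by (simp add: g0_def)
  then have g8: "g \<in> SO8C" "g0 \<in> SO8C" and g0: "g0 \<in> SO7C"
    by (simp_all add: spin_lift_def SO8C_def SO7C_def)
  have "(transpose g0 *v x) \<odot> (transpose g *v y) = transpose g *v (x \<odot> y)" for x y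
  proof -
    have "(g0 *v (transpose g0 *v x)) \<odot> (g *v (transpose g *v y)) = g *v ((transpose g0 *v x) \<odot> (transpose g *v y))"
      using sl by (simp add: spin_lift_def)
    then show ?thesis
      by (metis SO8C_inverse(3,4) g8)
  qed
  then have "spin_lift (transpose g) (transpose g0) 1"
    using SO8C_inverse(2,5)[OF g8(1)] SO7C_transpose[OF g0] by (simp add: spin_lift_def SO8C_def)
  then show "transpose g \<in> Spin7C"
    by (rule spin_lift_Spin7C)
qed

lemma SO8C_mcnj: "g \<in> SO8C \<Longrightarrow> mcnj g \<in> SO8C"
  unfolding SO8C_def by (simp add: det_mcnj) (metis complex_cnj_one mcnj_simps(3,4,5))

lemma SO7C_mcnj: "g \<in> SO7C \<Longrightarrow> mcnj g \<in> SO7C"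
  unfolding SO7C_def cayley_basis_def
  by (simp add: SO8C_mcnj) (metis complex_cnj_one mcnj_simps(7) vcnj_simps(8))

lemma mcnj_cayley_hom:
  assumes "\<And>x y. (g0 *v x) \<odot> (g *v y) = g *v (x \<odot> y)"
  shows "(mcnj g0 *v x) \<odot> (mcnj g *v y) = mcnj g *v (x \<odot> y)"
proof -
  have "vcnj ((g0 *v vcnj x) \<odot> (g *v vcnj y)) = vcnj (g *v (vcnj x \<odot> vcnj y))"
    by (simp only: assms)
  then show ?thesis
    by simp
qed

lemma spin_lift_mcnj: "spin_lift g g0 1 \<Longrightarrow> spin_lift (mcnj g) (mcnj g0) 1"
  using SO8C_mcnj[of g] SO7C_mcnj[of g0] mcnj_cayley_hom[of g0 g]
  by (simp add: spin_lift_def SO8C_def)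

lemma Spin7C_mcnj: "g \<in> Spin7C \<Longrightarrow> mcnj g \<in> Spin7C"
  using spin_lift_mcnj Spin7C_iff spin_lift_Spin7C by blast

lemma vector_rep_mcnj: "g \<in> Spin7C \<Longrightarrow> vector_rep (mcnj g) = mcnj (vector_rep g)"
  using spin_lift_mcnj Spin7C_iff spin_lift_unique by metis

lemma G2C_mcnj: "g \<in> G2C \<Longrightarrow> mcnj g \<in> G2C"
  using mcnj_cayley_hom[of g g] by (simp add: G2C_def SO8C_mcnj)

lemma cdot_SO8C: "g \<in> SO8C \<Longrightarrow> cdot (g *v x) (g *v y) = cdot x y"
  using cdot_orthogonal[of g 1] by (simp add: SO8C_def)

lemma G2C_nth_0: "g \<in> G2C \<Longrightarrow> (g *v x) $ 0 = x $ 0"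
proof -
  assume g: "g \<in> G2C"
  then have "cdot (g *v x) (g *v axis 0 1) = cdot x (axis 0 1)"
    by (intro cdot_SO8C) (simp add: G2C_def)
  then show ?thesis
    by (simp add: G2C_spin_lift(1)[OF g])
qed

text \<open>The fixed vector \<open>z\<close> in the transport lemma lets the second move adjust the
  image of \<open>q\<close> without disturbing that of \<open>p\<close>.\<close>

lemma real_G2_pair:
  assumes p: "p $ 0 = 0" "cdot p p = 1" "vcnj p = p" and q: "q $ 0 = 0" "cdot q q = 1" "vcnj q = q"
    and "cdot p q = 0"
  obtains g where "g \<in> G2C" "mcnj g = g" "g *v p = axis 1 1" "g *v q = axis 2 1"
proof -
  obtain g where g: "g \<in> G2C" "mcnj g = g" "g *v p = axis 1 1"
    by (rule real_G2_transport[OF p, of "axis 1 1" 0]) (auto simp: axis_nth_8)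
  define q' where "q' = g *v q"
  have q': "q' $ 0 = 0" "cdot q' q' = 1" "vcnj q' = q'" "cdot (axis 1 1) q' = 0"
    using q \<open>cdot p q = 0\<close> cdot_SO8C[of g] g(1) G2C_nth_0[OF g(1)] g(2)
    by (simp_all add: q'_def G2C_def del: cdot_simps flip: g(3))
  obtain h where h: "h \<in> G2C" "mcnj h = h" "h *v q' = axis 2 1" "h *v axis 1 1 = axis 1 1"
    by (rule real_G2_transport[OF q'(1-3), of "axis 2 1" "axis 1 1"]) (use q'(4) in \<open>auto simp: axis_nth_8\<close>)
  show ?thesis
    using that[of "h ** g"] g h by (simp add: G2C_mult matrix_vector_mul_assoc[symmetric] q'_def)
qed

text \<open>For \<open>v = x + \<i> *s y\<close> the equation \<open>cdot v v = 1\<close> says that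
  \<open>x\<close> and \<open>y\<close> are orthogonal and their squared lengths differ by one. So
  \<open>x\<close> never vanishes, but \<open>y\<close> may; then \<open>q\<close> is any real unit
  vector orthogonal to \<open>p\<close> and \<open>A\<close>, whence the bound on
  \<open>card A\<close>.\<close>

lemma complex_unit_vector_parts:
  fixes v :: "complex ^ 8"
  assumes v: "cdot v v = 1" and "finite A" "card A < 7" and A: "\<And>u. u \<in> A \<Longrightarrow> vcnj u = u \<and> cdot v u = 0"
  obtains c s :: real and p q where "vcnj p = p" "vcnj q = q" "cdot p p = 1" "cdot q q = 1" "cdot p q = 0"
    "\<And>u. u \<in> A \<Longrightarrow> cdot p u = 0 \<and> cdot q u = 0"
    "v = of_real c *s p + (\<i> * of_real s) *s q" "c > 0" "s \<ge> 0" "c\<^sup>2 = 1 + s\<^sup>2"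
proof -
  define x where "x = (1/2) *s (v + vcnj v)"
  define y where "y = (- \<i> / 2) *s (v - vcnj v)"
  have xy: "vcnj x = x" "vcnj y = y" "v = x + \<i> *s y"
    by (simp_all add: x_def y_def vec_eq_iff field_simps)
  have xA: "cdot x u = 0 \<and> cdot y u = 0" if "u \<in> A" for u
  proof -
    have "cdot (vcnj v) u = 0"
      using A[OF that] cdot_vcnj[of v u] by simp
    then show ?thesis
      using A[OF that] by (simp add: x_def y_def)
  qed
  define c where "c = norm x"
  define s where "s = norm y"
  have "cdot v v = of_real (c\<^sup>2) - of_real (s\<^sup>2) + \<i> * (2 * cdot x y)"
    using cdot_real[OF xy(1)] cdot_real[OF xy(2)]
    by (subst (1 2) xy(3)) (simp add: c_def s_def cdot_sym[of y x] algebra_simps)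
  moreover have "cdot x y \<in> \<real>"
    using cdot_vcnj[of x y] xy by (simp add: Reals_cnj_iff)
  then obtain r where r: "cdot x y = of_real r"
    by (auto elim: Reals_cases)
  ultimately have cs: "c\<^sup>2 - s\<^sup>2 = 1" "cdot x y = 0"
    using v by (auto simp: complex_eq_iff)
  have "c > 0"
    using cs(1) by (cases "c = 0") (auto simp: c_def, smt (verit) zero_le_power2)
  define p where "p = of_real (1 / c) *s x"
  have p: "vcnj p = p" "cdot p p = 1" "x = of_real c *s p"
    using \<open>c > 0\<close> by (simp_all add: p_def xy cdot_real[OF xy(1)] c_def[symmetric] power2_eq_square)
  obtain q where q: "vcnj q = q" "cdot q q = 1" "cdot p q = 0" "y = of_real s *s q" "\<And>u. u \<in> A \<Longrightarrow> cdot q u = 0"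
  proof (cases "s = 0")
    case True
    have "card (insert p A) < 8"
      using \<open>card A < 7\<close> \<open>finite A\<close> by (simp add: card_insert_if)
    then obtain q where q: "vcnj q = q" "cdot q q = 1" "\<And>u. u \<in> insert p A \<Longrightarrow> cdot q u = 0"
      by (rule real_vector_orthogonal[rotated]) (use A p \<open>finite A\<close> in auto)
    show ?thesis
      by (rule that[of q]) (use q True in \<open>auto simp: s_def cdot_sym[of p]\<close>)
  next
    case False
    show ?thesis
      by (rule that[of "of_real (1 / s) *s y"])
        (use False xA cs(2) in \<open>auto simp: xy p_def cdot_real[OF xy(2)] s_def[symmetric] power2_eq_square\<close>)
  qed
  show ?thesis
  proof (rule that[of p q c s])
    show "cdot p u = 0 \<and> cdot q u = 0" if "u \<in> A" for u
      using xA[OF that] q(5)[OF that] by (simp add: p_def)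
    show "v = of_real c *s p + (\<i> * of_real s) *s q"
      using xy(3) p(3) q(4) by simp
    show "c\<^sup>2 = 1 + s\<^sup>2"
      using cs(1) by simp
  qed (use p q \<open>c > 0\<close> in \<open>simp_all add: s_def\<close>)
qed

lemma Q6_polar:
  assumes "v $ 0 = 0" "cdot v v = 1"
  obtains g c s where "g \<in> G2C" "mcnj g = g" "g *v v = of_real c *s axis 1 1 + (\<i> * of_real s) *s axis 2 1"
    "c > 0" "s \<ge> 0" "c\<^sup>2 = 1 + s\<^sup>2"
proof -
  obtain c s p q where pq: "vcnj p = p" "vcnj q = q" "cdot p p = 1" "cdot q q = 1" "cdot p q = 0"
    "\<And>u. u \<in> {axis 0 1} \<Longrightarrow> cdot p u = 0 \<and> cdot q u = 0"
    "v = of_real c *s p + (\<i> * of_real s) *s q" "c > 0" "s \<ge> 0" "c\<^sup>2 = 1 + s\<^sup>2"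
    by (rule complex_unit_vector_parts[OF assms(2), of "{axis 0 1}"]) (use assms in auto)
  then have "p $ 0 = 0" "q $ 0 = 0"
    by auto
  then obtain g where g: "g \<in> G2C" "mcnj g = g" "g *v p = axis 1 1" "g *v q = axis 2 1"
    using pq by (metis real_G2_pair)
  show ?thesis
    by (rule that[OF g(1,2) _ pq(8-10)]) (simp add: pq(7) g matrix_vector_right_distrib vector_scalar_commute)
qed

text \<open>A real spin element takes \<open>p\<close> to the unit. The image of \<open>q\<close> is
  then imaginary, and the stabilizer \<open>G2C\<close> of the unit can still turn it to
  \<open>axis 1 1\<close>.\<close>

lemma Q7_polar:
  assumes "cdot v v = 1"
  obtains g c s where "g \<in> Spin7C" "mcnj g = g" "g *v v = of_real c *s axis 0 1 + (\<i> * of_real s) *s axis 1 1"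
    "c > 0" "s \<ge> 0" "c\<^sup>2 = 1 + s\<^sup>2"
proof -
  obtain c s p q where pq: "vcnj p = p" "vcnj q = q" "cdot p p = 1" "cdot q q = 1" "cdot p q = 0"
    "v = of_real c *s p + (\<i> * of_real s) *s q" "c > 0" "s \<ge> 0" "c\<^sup>2 = 1 + s\<^sup>2"
    by (rule complex_unit_vector_parts[OF assms, of "{}"]) auto
  obtain b where b: "vcnj b = b" "cdot b b = 1" "\<And>u. u \<in> {axis 0 1, p} \<Longrightarrow> cdot b u = 0"
    by (rule real_vector_orthogonal[of "{axis 0 1, p}"]) (use pq in \<open>auto simp: card_insert_if\<close>)
  define k where "k = (- 1 / cdot b b) *\<^sub>C (cayley_left (p \<odot> b) ** cayley_left b)"
  have "b $ 0 = 0" "cdot b b \<noteq> 0" "cdot b p = 0"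
    using b(2) b(3)[of "axis 0 1"] b(3)[of p] by auto
  then have k: "k \<in> Spin7C" "k *v axis 0 1 = p"
    unfolding k_def using Spin7C_section[OF pq(3)] by blast+
  have kr: "mcnj k = k"
    by (simp add: k_def b(1,2) pq)
  have k8: "k \<in> SO8C" "transpose k \<in> SO8C"
    using k(1) Spin7C_transpose by (auto simp: Spin7C_def)
  have kp: "transpose k *v p = axis 0 1"
    using SO8C_inverse(3)[OF k8(1)] k(2) by metis
  define q' where "q' = transpose k *v q"
  have "cdot (axis 0 1) q' = 0" "cdot q' q' = 1"
    using cdot_SO8C[OF k8(2)] pq by (simp_all add: q'_def del: cdot_simps flip: kp)
  moreover have "vcnj q' = q'"
    using pq kr by (simp add: q'_def)
  ultimately have q': "q' $ 0 = 0" "cdot q' q' = 1" "vcnj q' = q'"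
    by simp_all
  obtain g where g: "g \<in> G2C" "mcnj g = g" "g *v q' = axis 1 1"
    by (rule real_G2_transport[OF q', of "axis 1 1" 0]) (auto simp: axis_nth_8)
  have "(g ** transpose k) *v v = of_real c *s (g *v (transpose k *v p)) + (\<i> * of_real s) *s (g *v q')"
    by (simp add: pq(6) q'_def matrix_vector_mul_assoc matrix_vector_right_distrib vector_scalar_commute)
  also have "\<dots> = of_real c *s axis 0 1 + (\<i> * of_real s) *s axis 1 1"
    by (simp add: kp g G2C_spin_lift(1))
  finally show ?thesis
    using that[of "g ** transpose k" c s] pq g k kr
    by (simp add: Spin7C_mult Spin7C_transpose G2C_iff)
qed

text \<open>It suffices to find an imaginary non-isotropic vector orthogonal to \<open>v\<close>.
  The vector \<open>v_i e_j - v_j e_i\<close> is orthogonal to \<open>v\<close> and has square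
  \<open>v_i^2 + v_j^2\<close>.\<close>

lemma Spin7C_transitive:
  assumes "cdot v v = 1"
  obtains g where "g \<in> Spin7C" "g *v axis 0 1 = v"
proof -
  have *: "\<exists>b. b $ 0 = 0 \<and> cdot b b \<noteq> 0 \<and> cdot b v = 0"
    if "v $ i * v $ i + v $ j * v $ j \<noteq> 0" "i \<noteq> j" "i \<noteq> 0" "j \<noteq> 0" for i j
    by (rule exI[of _ "v $ i *s axis j 1 - v $ j *s axis i 1"])
      (use that in \<open>auto simp: axis_nth_8 algebra_simps\<close>)
  have "\<exists>b. b $ 0 = 0 \<and> cdot b b \<noteq> 0 \<and> cdot b v = 0"
  proof (cases "v $ 1 = 0")
    case True
    then show ?thesis
      by (intro exI[of _ "axis 1 1"]) (auto simp: axis_nth_8)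
  next
    case False
    \<comment> \<open>If the first two sums vanish, the squares of \<open>v $ 2\<close> and
      \<open>v $ 3\<close> both equal minus that of \<open>v $ 1\<close>, so the third sum is not
      zero.\<close>
    then have "v $ 1 * v $ 1 + v $ 2 * v $ 2 \<noteq> 0 \<or> v $ 1 * v $ 1 + v $ 3 * v $ 3 \<noteq> 0 \<or>
        v $ 2 * v $ 2 + v $ 3 * v $ 3 \<noteq> 0"
      by (auto simp: add_eq_0_iff2)
    then show ?thesis
      using *[of 1 2] *[of 1 3] *[of 2 3] by auto
  qed
  then show ?thesis
    using Spin7C_section[OF assms] that by blast
qed

text \<open>\<open>G2C_transport\<close> can degenerate for a complex target. After a real motion
  the target is in normal form, where its scalar is \<open>2 + 2 * c > 0\<close> and
  \<open>axis 4 1\<close> serves as the auxiliary vector.\<close>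

lemma G2C_transitive:
  assumes "v $ 0 = 0" "cdot v v = 1"
  obtains g where "g \<in> G2C" "g *v axis 1 1 = v"
proof -
  obtain k c s where k: "k \<in> G2C" "mcnj k = k" "k *v v = of_real c *s axis 1 1 + (\<i> * of_real s) *s axis 2 1"
    "c > 0" "s \<ge> 0" "c\<^sup>2 = 1 + s\<^sup>2"
    using Q6_polar[OF assms] by blast
  define w where "w = of_real c *s axis 1 1 + (\<i> * of_real s) *s (axis 2 1 :: complex ^ 8)"
  have w: "w $ 0 = 0" "cdot w w = 1"
    using arg_cong[OF k(6), of complex_of_real] by (auto simp: w_def axis_nth_8 power2_eq_square algebra_simps)
  have "2 + 2 * cdot (axis 1 1) w \<noteq> 0"
  proof -
    have "2 + 2 * cdot (axis 1 1) w = of_real (2 + 2 * c)"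
      by (simp add: w_def axis_nth_8)
    also have "\<dots> \<noteq> 0"
      using k(4) by (subst of_real_eq_0_iff) simp
    finally show ?thesis .
  qed
  moreover have "cdot (axis 4 1) (axis 1 1 \<odot> w) = 0"
    by (simp add: w_def cayley_mult_nth axis_nth_8)
  ultimately obtain g where g: "g \<in> G2C" "g *v axis 1 1 = w"
    using G2C_transport[of "axis 1 1" w _ "axis 4 1"] w by (auto simp: axis_nth_8 w_def)
  have "(transpose k ** g) *v axis 1 1 = v"
    using k(1) by (simp add: matrix_vector_mul_assoc[symmetric] g(2) w_def k(3)[symmetric] SO8C_inverse(3) G2C_def)
  then show ?thesis
    using that G2C_mult G2C_transpose k(1) g(1) by blast
qed

section \<open>Local sections and the spin covering\<close>

lemma cdiff_vec_smult [cdiff_intros]: "cdiff f z \<Longrightarrow> cdiff g z \<Longrightarrow> cdiff (\<lambda>x. f x *s (g x :: complex ^ 'n::finite)) z"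
  unfolding vector_scalar_mult_def by (intro cdiff_intros)

lemma cdiff_cdot [cdiff_intros]: "cdiff f z \<Longrightarrow> cdiff g z \<Longrightarrow> cdiff (\<lambda>x. cdot (f x) (g x)) z"
  unfolding cdot_def by (intro cdiff_intros)

lemma cdiff_cayley_mult [cdiff_intros]: "cdiff f z \<Longrightarrow> cdiff g z \<Longrightarrow> cdiff (\<lambda>x. f x \<odot> g x) z"
  unfolding cayley_mult_def by (intro cdiff_intros)

lemma cdiff_cayley_left [cdiff_intros]: "cdiff f z \<Longrightarrow> cdiff (\<lambda>x. cayley_left (f x)) z"
  unfolding cayley_left_def by (intro cdiff_intros)

lemma cdiff_vector_rep [cdiff_intros]: "cdiff f z \<Longrightarrow> cdiff (\<lambda>x. vector_rep (f x)) z"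
  unfolding vector_rep_def by (intro cdiff_intros)

lemma matrix_vector_mult_sum_right:
  "M *v (\<Sum>i\<in>A. f i) = (\<Sum>i\<in>A. M *v (f i :: complex ^ 'n::finite))"
  by (induction A rule: infinite_finite_induct) (simp_all add: matrix_vector_right_distrib)

text \<open>The section is holomorphic on an open set of the ambient space, while its lifting
  property is required only on \<open>Q\<close>; thus no complex structure on \<open>Q\<close> has
  to be introduced.\<close>

definition local_section ::
    "(complex ^ 8 ^ 8) set \<Rightarrow> (complex ^ 8) set \<Rightarrow> complex ^ 8 \<Rightarrow> complex ^ 8 \<Rightarrow> bool"
  where "local_section G Q p v \<longleftrightarrow> (\<exists>W s. v \<in> W \<and> holomorphic_map_on W s \<and>
    (\<forall>u\<in>W \<inter> Q. s u \<in> G \<and> s u *v p = u))"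

text \<open>By homogeneity a section near one convenient point of the quadric is enough.\<close>

lemma local_section_translate:
  assumes s: "local_section G Q p v" and G: "\<And>g h. g \<in> G \<Longrightarrow> h \<in> G \<Longrightarrow> g ** h \<in> G" "G \<subseteq> SO8C"
    and h: "h \<in> G" and Q: "\<And>u. u \<in> Q \<Longrightarrow> transpose h *v u \<in> Q"
  shows "local_section G Q p (h *v v)"
proof -
  obtain W s where s: "v \<in> W" "holomorphic_map_on W s" "\<And>u. u \<in> W \<inter> Q \<Longrightarrow> s u \<in> G \<and> s u *v p = u"
    using s unfolding local_section_def by blast
  have h8: "h \<in> SO8C"
    using h G by blast
  define W' where "W' = (\<lambda>u. transpose h *v u) -` W"
  have "continuous_on UNIV (\<lambda>u. transpose h *v u)"
    by (intro continuous_at_imp_continuous_on ballI semidiff_continuous[where \<kappa> = "\<lambda>c. c"] cdiff_intros)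
  then have "open W'"
    unfolding W'_def using s(2) open_vimage holomorphic_map_on_def by blast
  then have "holomorphic_map_on W' (\<lambda>u. h ** s (transpose h *v u))"
    unfolding holomorphic_map_on_iff
  proof (intro conjI ballI cdiff_intros)
    fix u assume "u \<in> W'"
    then have "cdiff s (transpose h *v u)"
      using s(2) by (simp add: W'_def holomorphic_map_on_iff)
    moreover have "cdiff (\<lambda>u. transpose h *v u) u"
      by (intro cdiff_intros)
    ultimately show "cdiff (\<lambda>u. s (transpose h *v u)) u"
      by (rule semidiff_compose)
  qed
  moreover have "h *v v \<in> W'"
    using s(1) by (simp add: W'_def SO8C_inverse(3)[OF h8])
  moreover have "h ** s (transpose h *v u) \<in> G \<and> (h ** s (transpose h *v u)) *v p = u" if "u \<in> W' \<inter> Q" for u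
    using s(3)[of "transpose h *v u"] that Q G(1) h
    by (simp add: W'_def matrix_vector_mul_assoc[symmetric] SO8C_inverse(4)[OF h8])
  ultimately show ?thesis
    unfolding local_section_def by blast
qed

lemma isCont_cdiff: "cdiff f z \<Longrightarrow> isCont f z"
  by (rule semidiff_continuous)

lemma open_cdiff_nonzero:
  fixes f :: "'a::{euclidean_space, complex_vector} \<Rightarrow> complex"
  assumes "\<And>z. cdiff f z"
  shows "open {z. f z \<noteq> 0}"
proof -
  have "continuous_on UNIV f"
    using assms by (simp add: continuous_at_imp_continuous_on isCont_cdiff)
  then show ?thesis
    by (intro open_Collect_neq) auto
qed

lemma Spin7C_local_section:
  assumes "cdot v v = 1"
  shows "local_section Spin7C {v. cdot v v = 1} (axis 0 1) v"
proof -
  \<comment> \<open>A holomorphic choice of an imaginary vector orthogonal to \<open>v\<close>. It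
    vanishes at the unit, so the base point is \<open>axis 1 1\<close>, where it equals
    \<open>axis 2 1\<close>.\<close>
  define b where "b = (\<lambda>v::complex ^ 8. v $ 1 *s (axis 2 1 :: complex ^ 8) - v $ 2 *s axis 1 1)"
  define s where "s = (\<lambda>v. (- 1 / cdot (b v) (b v)) *\<^sub>C (cayley_left (v \<odot> b v) ** cayley_left (b v)))"
  define W where "W = {v. cdot (b v) (b v) \<noteq> 0}"
  have cb: "cdiff b v" for v
    unfolding b_def by (intro cdiff_intros)
  have "open W"
    unfolding W_def by (intro open_cdiff_nonzero cdiff_intros cb)
  then have "holomorphic_map_on W s"
    unfolding holomorphic_map_on_iff s_def by (auto intro!: cdiff_intros cb simp: W_def)
  moreover have "s v \<in> Spin7C \<and> s v *v axis 0 1 = v" if "v \<in> W" "cdot v v = 1" for v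
  proof -
    have "b v $ 0 = 0" "cdot (b v) v = 0"
      by (simp_all add: b_def axis_nth_8 mult.commute)
    then show ?thesis
      using Spin7C_section[OF that(2), of "b v"] that(1) by (simp add: W_def s_def)
  qed
  moreover have "axis 1 1 \<in> W"
    by (simp add: W_def b_def axis_nth_8)
  ultimately have *: "local_section Spin7C {v. cdot v v = 1} (axis 0 1) (axis 1 1)"
    unfolding local_section_def by blast
  obtain g where g: "g \<in> Spin7C" "g *v axis 0 1 = v"
    using Spin7C_transitive[OF assms] by blast
  obtain h where h: "h \<in> Spin7C" "h *v axis 0 1 = axis 1 1"
    using Spin7C_transitive[of "axis 1 1"] by (auto simp: axis_nth_8)
  have h8: "g ** transpose h \<in> Spin7C" "Spin7C \<subseteq> SO8C"
    using g h Spin7C_mult Spin7C_transpose by (auto simp: Spin7C_def)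
  have "transpose h *v axis 1 1 = axis 0 1"
    using SO8C_inverse(3)[of h "axis 0 1"] h h8(2) by auto
  then have "(g ** transpose h) *v axis 1 1 = v"
    using g(2) by (simp add: matrix_vector_mul_assoc[symmetric])
  moreover have "transpose (g ** transpose h) \<in> SO8C"
    using h8 SO8C_inverse(5) by blast
  ultimately show ?thesis
    using local_section_translate[OF * Spin7C_mult h8(2) h8(1)] by (simp add: cdot_SO8C)
qed

text \<open>In the span of \<open>e\<^sub>2\<close>, \<open>e\<^sub>3\<close>, \<open>e\<^sub>4\<close>, the vector \<open>a v\<close> below solves the two linear equations of
  \<open>G2C_transport\<close>, orthogonality to \<open>v\<close> and to \<open>e\<^sub>1 v\<close>.\<close>

lemma G2C_local_section:
  assumes "v $ 0 = 0" "cdot v v = 1"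
  shows "local_section G2C {v. v $ 0 = 0 \<and> cdot v v = 1} (axis 1 1) v"
proof -
  define N where "N = (\<lambda>v::complex ^ 8. v $ 2 * v $ 2 + v $ 3 * v $ 3)"
  define a where "a = (\<lambda>v::complex ^ 8. N v *s (axis 4 1 :: complex ^ 8)
    - (v $ 2 * v $ 4 + v $ 3 * v $ 5) *s axis 2 1 + (v $ 2 * v $ 5 - v $ 3 * v $ 4) *s axis 3 1)"
  define c where "c = (\<lambda>v::complex ^ 8. 2 + 2 * v $ 1)"
  define s where "s = (\<lambda>v. (- 1 / (c v * cdot (a v) (a v))) *\<^sub>C
    (cayley_left (a v \<odot> ((axis 1 1 + v) \<odot> axis 1 1)) **
      (cayley_left (a v) ** (cayley_left (axis 1 1 + v) ** cayley_left (axis 1 1)))))"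
  define W where "W = {v. c v * cdot (a v) (a v) \<noteq> 0}"
  have cd: "cdiff a v" "cdiff c v" for v
    unfolding a_def N_def c_def by (intro cdiff_intros)+
  have "open W"
    unfolding W_def by (intro open_cdiff_nonzero cdiff_intros cd)
  then have "holomorphic_map_on W s"
    unfolding holomorphic_map_on_iff s_def by (auto intro!: cdiff_intros cd simp: W_def)
  moreover have "s v \<in> G2C \<and> s v *v axis 1 1 = v" if "v \<in> W" "v $ 0 = 0" "cdot v v = 1" for v
  proof -
    have "a v $ 0 = 0" "cdot (a v) (axis 1 1) = 0" "cdot (a v) v = 0" "cdot (a v) (axis 1 1 \<odot> v) = 0"
      by (simp_all add: a_def N_def axis_nth_8 cayley_mult_nth algebra_simps)
    then show ?thesis
      using G2C_transport[of "axis 1 1" v "c v" "a v"] that by (simp add: W_def s_def c_def axis_nth_8)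
  qed
  \<comment> \<open>At \<open>axis 1 1\<close> the vector \<open>a v\<close> vanishes; at
    \<open>axis 2 1\<close> it is \<open>axis 4 1\<close>, so this is the base point.\<close>
  moreover have "axis 2 1 \<in> W"
    by (simp add: W_def a_def c_def N_def axis_nth_8)
  ultimately have *: "local_section G2C {v. v $ 0 = 0 \<and> cdot v v = 1} (axis 1 1) (axis 2 1)"
    unfolding local_section_def by blast
  obtain g where g: "g \<in> G2C" "g *v axis 1 1 = v"
    using G2C_transitive[OF assms] by blast
  obtain h where h: "h \<in> G2C" "h *v axis 1 1 = axis 2 1"
    using G2C_transitive[of "axis 2 1"] by (auto simp: axis_nth_8)
  have h8: "g ** transpose h \<in> G2C" "G2C \<subseteq> SO8C"
    using g h G2C_mult G2C_transpose by (auto simp: G2C_def)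
  have "transpose h *v axis 2 1 = axis 1 1"
    using SO8C_inverse(3)[of h "axis 1 1"] h h8(2) by auto
  then have "(g ** transpose h) *v axis 2 1 = v"
    using g(2) by (simp add: matrix_vector_mul_assoc[symmetric])
  moreover have "transpose (g ** transpose h) \<in> G2C"
    using h8 G2C_transpose by blast
  moreover from this have "transpose (g ** transpose h) \<in> SO8C"
    using h8 by blast
  ultimately show ?thesis
    using local_section_translate[OF * G2C_mult h8(2) h8(1)] by (simp add: cdot_SO8C G2C_nth_0)
qed

section \<open>The vector representation maps the spin group onto \<open>SO7C\<close>\<close>

lemma orthogonal_mult:
  fixes A B :: "complex ^ 'n::finite ^ 'n"
  assumes "transpose A ** A = mat 1" "transpose B ** B = mat 1"
  shows "transpose (A ** B) ** (A ** B) = mat 1"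
proof -
  have "transpose (A ** B) ** (A ** B) = transpose B ** (transpose A ** A) ** B"
    by (simp add: matrix_transpose_mul matrix_mul_assoc)
  with assms show ?thesis
    by simp
qed

text \<open>Conjugation of the Cayley algebra. Since there are seven imaginary directions its
  determinant is minus one; below it records the parity of the number of reflections.\<close>

definition imaginary_reflection :: "complex ^ 8 ^ 8"
  where "imaginary_reflection = (\<chi> i j. if i = j then (if i = 0 then 1 else - 1) else 0)"

lemma imaginary_reflection_mult: "imaginary_reflection *v x = (2 * x $ 0) *s axis 0 1 - x"
  by (simp add: vec_eq_iff imaginary_reflection_def matrix_vector_mult_def axis_nth_8
      if_distrib[where f = "\<lambda>u. u * _"] cong: if_cong)

lemma det_imaginary_reflection: "det imaginary_reflection = - 1"
proof -
  have "det imaginary_reflection = (\<Prod>i\<in>UNIV. imaginary_reflection $ i $ i)"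
    by (rule det_diagonal) (simp add: imaginary_reflection_def)
  also have "\<dots> = - 1"
    unfolding UNIV_8 by (simp add: imaginary_reflection_def)
  finally show ?thesis .
qed

lemma half_turn_in_vector_rep: "a $ 0 = 0 \<Longrightarrow> cdot a a \<noteq> 0 \<Longrightarrow> half_turn a \<in> vector_rep ` Spin7C"
proof -
  assume a: "a $ 0 = 0" "cdot a a \<noteq> 0"
  have "spin_lift ((1 / csqrt (cdot a a)) *\<^sub>C cayley_left a) (half_turn a) 1"
    using spin_lift_scale[OF spin_lift_cayley_left[OF a], of "1 / csqrt (cdot a a)"] a(2)
    by (simp add: power_divide)
  then show ?thesis
    using spin_lift_Spin7C spin_lift_unique by blast
qed

text \<open>The induction multiplies by reflections that move the image of one more basis vector
  back to its place; up to \<open>imaginary_reflection\<close> each reflection is a half turn.\<close>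

lemma orthogonal_in_vector_rep:
  assumes "transpose g ** g = mat 1" "g *v axis 0 1 = axis 0 1"
  shows "g \<in> vector_rep ` Spin7C \<or> imaginary_reflection ** g \<in> vector_rep ` Spin7C"
  using assms
proof (induction "card {i. g *v axis i 1 \<noteq> axis i 1}" arbitrary: g rule: less_induct)
  case less
  let ?R = "vector_rep ` Spin7C"
  let ?ref = "\<lambda>a. mat 1 - (2 / cdot a a) *\<^sub>C outer a (a::complex ^ 8)"
  have ref: "?ref a *v x = x - (2 * cdot a x / cdot a a) *s a" for a x
    by (simp add: matrix_vector_mult_diff_rdistrib scaleC_matrix)
  have R_mult: "x ** y \<in> ?R" if "x \<in> ?R" "y \<in> ?R" for x y
    using that vector_rep_hom Spin7C_mult by (auto intro!: image_eqI simp flip: vector_rep_hom)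
  have ir_ref1: "imaginary_reflection ** ?ref a = half_turn a" if "a $ 0 = 0" for a
    by (rule matrix_eqI) (use that in \<open>simp add: matrix_vector_mul_assoc[symmetric] ref
        imaginary_reflection_mult half_turn_mult vec_eq_iff axis_nth_8\<close>)
  have ir_ref2: "half_turn a ** imaginary_reflection = ?ref a" if "a $ 0 = 0" for a
    by (rule matrix_eqI) (use that in \<open>simp add: matrix_vector_mul_assoc[symmetric] ref
        imaginary_reflection_mult half_turn_mult vec_eq_iff axis_nth_8\<close>)
  \<comment> \<open>Removing one reflection exchanges the two alternatives: \<open>?ref a\<close>
    equals a half turn times \<open>imaginary_reflection\<close>, and the half turn is absorbed by
    \<open>?R\<close>.\<close>
  have step: "x \<in> ?R \<or> imaginary_reflection ** x \<in> ?R"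
    if a: "a $ 0 = 0" "cdot a a \<noteq> 0"
      and x: "?ref a ** x \<in> ?R \<or> imaginary_reflection ** (?ref a ** x) \<in> ?R" for a x
  proof -
    have "?ref a ** (?ref a ** x) = x"
      using a(2) by (intro matrix_eqI) (simp add: matrix_vector_mul_assoc[symmetric] ref vec_eq_iff)
    then have 1: "imaginary_reflection ** x = half_turn a ** (?ref a ** x)"
      by (metis ir_ref1[OF a(1)] matrix_mul_assoc)
    have 2: "x = half_turn a ** (imaginary_reflection ** (?ref a ** x))"
      using \<open>?ref a ** (?ref a ** x) = x\<close> by (metis ir_ref2[OF a(1)] matrix_mul_assoc)
    show ?thesis
      using x R_mult[OF half_turn_in_vector_rep[OF a]] 1 2 by metis
  qed
  show ?case
  proof (cases "\<forall>i. g *v axis i 1 = axis i 1")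
    case True
    have "g = mat 1"
    proof (rule matrix_eqI)
      fix x :: "complex ^ 8"
      have "x = (\<Sum>i\<in>UNIV. x $ i *s axis i 1)"
        unfolding sum_8 vec_eq_iff forall_8 by (simp add: axis_nth_8)
      then show "g *v x = mat 1 *v x"
        using True by (metis (no_types, lifting) matrix_vector_mul_lid matrix_vector_mult_sum_right sum.cong vector_scalar_commute)
    qed
    moreover have "mat 1 \<in> G2C"
      by (simp add: G2C_def SO8C_def)
    then have "mat 1 \<in> Spin7C" "vector_rep (mat 1) = mat 1"
      using G2C_iff vector_rep_G2C by blast+
    ultimately show ?thesis
      by (metis image_eqI)
  next
    case False
    then obtain j where j: "g *v axis j 1 \<noteq> axis j 1"
      by blast
    have j0: "j \<noteq> 0"
      using j less.prems(2) by metis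
    define y where "y = axis j (1::complex)"
    define x where "x = g *v y"
    have orth: "cdot (g *v p) (g *v q) = cdot p q" for p q
      using cdot_orthogonal[OF less.prems(1)] by simp
    have x0: "x $ 0 = 0" and y0: "y $ 0 = 0"
      using orth[of y "axis 0 1"] less.prems(2) j0 by (simp_all add: x_def y_def axis_nth_8)
    have xx: "cdot x x = 1" "cdot y y = 1"
      using orth[of y y] by (simp_all add: x_def y_def)
    \<comment> \<open>Basis vectors that \<open>g\<close> fixes are orthogonal to \<open>y\<close>
      and to its image \<open>x\<close>, so reflections along combinations of \<open>x\<close> and
      \<open>y\<close> keep them fixed and the induction measure drops.\<close>
    have fix_i: "cdot x (axis i 1) = 0" "cdot y (axis i 1) = 0" if "g *v axis i 1 = axis i 1" for i
      using orth[of y "axis i 1"] that j by (auto simp: x_def y_def axis_nth_8)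
    have less_card: "card {i. h *v axis i 1 \<noteq> axis i 1} < card {i. g *v axis i 1 \<noteq> axis i 1}"
      if "h *v axis j 1 = axis j 1" "\<And>i. g *v axis i 1 = axis i 1 \<Longrightarrow> h *v axis i 1 = axis i 1" for h
      using that j by (intro psubset_card_mono) auto
    have ref_orth: "transpose (?ref a ** h) ** (?ref a ** h) = mat 1"
      if "cdot a a \<noteq> 0" "transpose h ** h = mat 1" for a and h :: "complex ^ 8 ^ 8"
    proof -
      have "transpose (?ref a) = ?ref a"
        by (rule transpose_eqI) (simp add: ref cdot_sym mult.commute)
      moreover have "?ref a ** ?ref a = mat 1"
        using that(1) by (intro matrix_eqI) (simp add: matrix_vector_mul_assoc[symmetric] ref vec_eq_iff)
      ultimately show ?thesis
        using that(2) by (intro orthogonal_mult) simp_all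
    qed
    show ?thesis
    proof (cases "cdot (x - y) (x - y) = 0")
      case nz: False
      let ?a = "x - y"
      have a0: "?a $ 0 = 0"
        using x0 y0 by simp
      have "2 * cdot ?a x = cdot ?a ?a"
        using xx by (simp add: cdot_sym)
      then have "(?ref ?a ** g) *v axis j 1 = axis j 1"
        using nz unfolding matrix_vector_mul_assoc[symmetric] ref y_def[symmetric] x_def[symmetric] by simp
      moreover have fixed: "(?ref ?a ** g) *v axis i 1 = axis i 1" if "g *v axis i 1 = axis i 1" for i
        using fix_i[OF that] that unfolding matrix_vector_mul_assoc[symmetric] ref by simp
      ultimately have "?ref ?a ** g \<in> ?R \<or> imaginary_reflection ** (?ref ?a ** g) \<in> ?R"
        using less.prems by (intro less.hyps less_card ref_orth nz) auto
      then show ?thesis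
        using step[OF a0 nz] by blast
    next
      \<comment> \<open>Over the complex numbers \<open>x - y\<close> may be isotropic without being
        zero. Then \<open>x + y\<close> has square 4; its reflection sends \<open>x\<close> to
        \<open>- y\<close>, and the reflection along \<open>y\<close> repairs the sign.\<close>
      case True
      let ?a = "x + y"
      have a0: "?a $ 0 = 0"
        using x0 y0 by simp
      have "cdot ?a ?a = 4"
        using True xx by (simp add: cdot_sym[of y x])
      then have nz: "cdot ?a ?a \<noteq> 0"
        by simp
      have nzy: "cdot y y \<noteq> 0"
        using xx by simp
      have "2 * cdot ?a x = cdot ?a ?a"
        using xx by (simp add: cdot_sym)
      then have "2 * cdot ?a x / cdot ?a ?a = 1"
        using divide_self[OF nz] by (simp only:)
      then have refx: "?ref ?a *v x = - y"
        unfolding ref by (simp only: vector_smult_lid) simp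
      have "(?ref y ** (?ref ?a ** g)) *v axis j 1 = ?ref y *v (?ref ?a *v x)"
        by (simp only: x_def y_def matrix_vector_mul_assoc[symmetric])
      also have "\<dots> = y"
        by (subst refx, subst ref) (use xx in \<open>simp add: vec_eq_iff\<close>)
      finally have "(?ref y ** (?ref ?a ** g)) *v axis j 1 = axis j 1"
        by (simp only: y_def)
      moreover have fixed: "(?ref y ** (?ref ?a ** g)) *v axis i 1 = axis i 1" if "g *v axis i 1 = axis i 1" for i
        using fix_i[OF that] that unfolding matrix_vector_mul_assoc[symmetric] ref by simp
      ultimately have "?ref y ** (?ref ?a ** g) \<in> ?R \<or> imaginary_reflection ** (?ref y ** (?ref ?a ** g)) \<in> ?R"
        using less.prems by (intro less.hyps less_card ref_orth nz nzy) auto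
      then show ?thesis
        using step[OF a0 nz] step[OF y0 nzy] by blast
    qed
  qed
qed

text \<open>The determinant excludes the second alternative of
  \<open>orthogonal_in_vector_rep\<close>.\<close>

lemma SO7C_eq_vector_rep: "SO7C = vector_rep ` Spin7C"
proof
  show sub: "vector_rep ` Spin7C \<subseteq> SO7C"
    by (auto simp: Spin7C_iff spin_lift_def)
  show "SO7C \<subseteq> vector_rep ` Spin7C"
  proof
    fix g assume g: "g \<in> SO7C"
    then have "imaginary_reflection ** g \<notin> SO7C"
      by (auto simp: SO7C_def SO8C_def det_mul det_imaginary_reflection)
    moreover have "transpose g ** g = mat 1" "g *v axis 0 1 = axis 0 1"
      using g by (auto simp: SO7C_def SO8C_def cayley_basis_def)
    ultimately show "g \<in> vector_rep ` Spin7C"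
      using orthogonal_in_vector_rep sub by blast
  qed
qed

text \<open>The negatives of the triple products over the seven lines form, with the identity, a group of
  commuting involutions that fix the unit, so their average projects onto the unit. Conjugating by
  a spin lift of \<open>g\<close> replaces each \<open>e\<^sub>i\<close> by \<open>g e\<^sub>i\<close> and gives a polynomial in \<open>g\<close>.\<close>

definition spinor_projection :: "complex ^ 8 ^ 8 \<Rightarrow> complex ^ 8 ^ 8"
  where "spinor_projection g = (1 / 8) *\<^sub>C (mat 1 - (\<Sum>(i, j, k)\<in>cayley_triples.
    cayley_left (g *v axis i 1) ** (cayley_left (g *v axis j 1) ** cayley_left (g *v axis k 1))))"

lemma spinor_projection_mult:
  "spinor_projection g *v x = (1 / 8) *s (x - (\<Sum>(i, j, k)\<in>cayley_triples.
    (g *v axis i 1) \<odot> ((g *v axis j 1) \<odot> ((g *v axis k 1) \<odot> x))))"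
proof -
  have "(\<Sum>t\<in>A. f t) *v x = (\<Sum>t\<in>A. f t *v x)" for A :: "(8 \<times> 8 \<times> 8) set" and f :: "_ \<Rightarrow> complex ^ 8 ^ 8"
    by (induction A rule: infinite_finite_induct) (simp_all add: matrix_vector_mult_add_rdistrib)
  then show ?thesis
    by (simp add: spinor_projection_def scaleC_matrix matrix_vector_mult_diff_rdistrib case_prod_unfold
        matrix_vector_mul_assoc[symmetric])
qed

lemma cayley_axis_nth:
  "(axis 1 1 \<odot> x) $ 0 = - x $ 1" "(axis 1 1 \<odot> x) $ 1 = x $ 0" "(axis 1 1 \<odot> x) $ 2 = - x $ 3" "(axis 1 1 \<odot> x) $ 3 = x $ 2"
    "(axis 1 1 \<odot> x) $ 4 = - x $ 5" "(axis 1 1 \<odot> x) $ 5 = x $ 4" "(axis 1 1 \<odot> x) $ 6 = - x $ 7" "(axis 1 1 \<odot> x) $ 7 = x $ 6"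
  "(axis 2 1 \<odot> x) $ 0 = - x $ 2" "(axis 2 1 \<odot> x) $ 1 = x $ 3" "(axis 2 1 \<odot> x) $ 2 = x $ 0" "(axis 2 1 \<odot> x) $ 3 = - x $ 1"
    "(axis 2 1 \<odot> x) $ 4 = x $ 6" "(axis 2 1 \<odot> x) $ 5 = - x $ 7" "(axis 2 1 \<odot> x) $ 6 = - x $ 4" "(axis 2 1 \<odot> x) $ 7 = x $ 5"
  "(axis 3 1 \<odot> x) $ 0 = - x $ 3" "(axis 3 1 \<odot> x) $ 1 = - x $ 2" "(axis 3 1 \<odot> x) $ 2 = x $ 1" "(axis 3 1 \<odot> x) $ 3 = x $ 0"
    "(axis 3 1 \<odot> x) $ 4 = - x $ 7" "(axis 3 1 \<odot> x) $ 5 = - x $ 6" "(axis 3 1 \<odot> x) $ 6 = x $ 5" "(axis 3 1 \<odot> x) $ 7 = x $ 4"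
  "(axis 4 1 \<odot> x) $ 0 = - x $ 4" "(axis 4 1 \<odot> x) $ 1 = x $ 5" "(axis 4 1 \<odot> x) $ 2 = - x $ 6" "(axis 4 1 \<odot> x) $ 3 = x $ 7"
    "(axis 4 1 \<odot> x) $ 4 = x $ 0" "(axis 4 1 \<odot> x) $ 5 = - x $ 1" "(axis 4 1 \<odot> x) $ 6 = x $ 2" "(axis 4 1 \<odot> x) $ 7 = - x $ 3"
  "(axis 5 1 \<odot> x) $ 0 = - x $ 5" "(axis 5 1 \<odot> x) $ 1 = - x $ 4" "(axis 5 1 \<odot> x) $ 2 = x $ 7" "(axis 5 1 \<odot> x) $ 3 = x $ 6"
    "(axis 5 1 \<odot> x) $ 4 = x $ 1" "(axis 5 1 \<odot> x) $ 5 = x $ 0" "(axis 5 1 \<odot> x) $ 6 = - x $ 3" "(axis 5 1 \<odot> x) $ 7 = - x $ 2"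
  "(axis 6 1 \<odot> x) $ 0 = - x $ 6" "(axis 6 1 \<odot> x) $ 1 = x $ 7" "(axis 6 1 \<odot> x) $ 2 = x $ 4" "(axis 6 1 \<odot> x) $ 3 = - x $ 5"
    "(axis 6 1 \<odot> x) $ 4 = - x $ 2" "(axis 6 1 \<odot> x) $ 5 = x $ 3" "(axis 6 1 \<odot> x) $ 6 = x $ 0" "(axis 6 1 \<odot> x) $ 7 = - x $ 1"
  "(axis 7 1 \<odot> x) $ 0 = - x $ 7" "(axis 7 1 \<odot> x) $ 1 = - x $ 6" "(axis 7 1 \<odot> x) $ 2 = - x $ 5" "(axis 7 1 \<odot> x) $ 3 = - x $ 4"
    "(axis 7 1 \<odot> x) $ 4 = x $ 3" "(axis 7 1 \<odot> x) $ 5 = x $ 2" "(axis 7 1 \<odot> x) $ 6 = x $ 1" "(axis 7 1 \<odot> x) $ 7 = x $ 0"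
  by (simp_all add: cayley_mult_nth axis_nth_8)

lemma sum_cayley_triples:
  "(\<Sum>t\<in>cayley_triples. f t) = f (1, 2, 3) + f (1, 4, 5) + f (1, 6, 7) + f (2, 5, 7) + f (2, 6, 4) +
    f (3, 5, 6) + f (3, 4, 7)"
  unfolding cayley_triples_def by (simp add: add.assoc)

lemma spinor_projection_one: "spinor_projection (mat 1) *v x = x $ 0 *s axis 0 1"
  unfolding spinor_projection_mult sum_cayley_triples vec_eq_iff forall_8
  by (simp add: cayley_axis_nth axis_nth_8)

text \<open>The spin relation moves \<open>g\<close> past each of the three factors, so the
  projection onto the unit is conjugated by \<open>g\<close>. The entries are the products of the
  coordinates of \<open>g e_0\<close>, which do not change when the spin lift changes sign.\<close>

lemma spinor_projection_vector_rep:
  assumes g: "g \<in> Spin7C"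
  shows "spinor_projection (vector_rep g) = outer (g *v axis 0 1) (g *v axis 0 1)"
proof (rule matrix_eqI)
  fix x
  have g8: "g \<in> SO8C"
    using g by (simp add: Spin7C_def)
  define y where "y = transpose g *v x"
  have x: "x = g *v y"
    by (simp add: y_def SO8C_inverse(4)[OF g8])
  have hom: "(vector_rep g *v u) \<odot> (g *v w) = g *v (u \<odot> w)" for u w
    using g by (simp add: Spin7C_iff spin_lift_def)
  have "spinor_projection (vector_rep g) *v x = g *v (spinor_projection (mat 1) *v y)"
    unfolding spinor_projection_mult x hom
    by (simp add: matrix_vector_mult_diff_distrib vector_scalar_commute matrix_vector_mult_sum_right case_prod_unfold)
  also have "\<dots> = y $ 0 *s (g *v axis 0 1)"
    by (simp add: spinor_projection_one vector_scalar_commute)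
  also have "y $ 0 = cdot (g *v axis 0 1) x"
    unfolding x cdot_SO8C[OF g8] by simp
  finally show "spinor_projection (vector_rep g) *v x = outer (g *v axis 0 1) (g *v axis 0 1) *v x"
    by simp
qed

lemma cdiff_spinor_projection [cdiff_intros]: "cdiff f z \<Longrightarrow> cdiff (\<lambda>x. spinor_projection (f x)) z"
  unfolding spinor_projection_def case_prod_unfold by (intro cdiff_intros)

section \<open>Coset spaces of complex orthogonal groups\<close>

text \<open>Stability under \<open>mcnj\<close> means that the group is defined over the real
  numbers, so complex conjugation acts on it and on its quotients. Orthogonality makes the inverse
  the transpose, a holomorphic operation on all matrices.\<close>

locale orthogonal_group =
  fixes G :: "(complex ^ 'm::finite ^ 'm) set"
  assumes orthogonal: "g \<in> G \<Longrightarrow> transpose g ** g = mat 1"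
    and one: "mat 1 \<in> G"
    and mult: "g \<in> G \<Longrightarrow> h \<in> G \<Longrightarrow> g ** h \<in> G"
    and transp: "g \<in> G \<Longrightarrow> transpose g \<in> G"
    and conj: "g \<in> G \<Longrightarrow> mcnj g \<in> G"
    and closed: "closed G"
begin

lemma orthogonal': "g \<in> G \<Longrightarrow> g ** transpose g = mat 1"
  using orthogonal matrix_left_right_inverse by blast

lemma cancel_left: "g \<in> G \<Longrightarrow> transpose g ** (g ** x) = x" "g \<in> G \<Longrightarrow> g ** (transpose g ** x) = x"
  by (simp_all add: matrix_mul_assoc orthogonal orthogonal')

lemma cancel_right: "g \<in> G \<Longrightarrow> x ** transpose g ** g = x" "g \<in> G \<Longrightarrow> x ** g ** transpose g = x"
  by (simp_all add: matrix_mul_assoc[symmetric] orthogonal orthogonal')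

end

lemma group_matrix_group:
  assumes "mat 1 \<in> K" "\<And>g h. g \<in> K \<Longrightarrow> h \<in> K \<Longrightarrow> g ** h \<in> K"
    "\<And>g. g \<in> K \<Longrightarrow> \<exists>h\<in>K. h ** g = mat 1"
  shows "group (matrix_group K)"
  by (rule groupI) (use assms in \<open>auto simp: matrix_group_def matrix_mul_assoc\<close>)

locale orthogonal_pair = G: orthogonal_group G + H: orthogonal_group H
  for G H :: "(complex ^ 'm::finite ^ 'm) set" +
  assumes H_subset: "H \<subseteq> G"
begin

abbreviation "\<pi> \<equiv> coset G H"
abbreviation "D \<equiv> coset_topology G H"

lemma coset_eq_image: "\<pi> g = (\<lambda>h. g ** h) ` H"
  by (auto simp: coset_def l_coset_def matrix_group_def)

lemma lcosets_eq: "lcosets\<^bsub>matrix_group G\<^esub> H = \<pi> ` G"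
  by (auto simp: LCOSETS_def coset_def matrix_group_def)

lemma openin_D: "openin D U \<longleftrightarrow> U \<subseteq> \<pi> ` G \<and> openin (top_of_set G) {g\<in>G. \<pi> g \<in> U}"
  by (simp add: openin_coset_topology lcosets_eq)

lemma topspace_D: "topspace D = \<pi> ` G"
proof -
  have "openin D (\<pi> ` G)"
  proof -
    have "{g\<in>G. \<pi> g \<in> \<pi> ` G} = G"
      by blast
    then show ?thesis
      by (simp add: openin_D)
  qed
  then show ?thesis
    by (metis openin_D openin_subset openin_topspace subset_antisym)
qed

lemma coset_eq_iff:
  assumes "g \<in> G" "g' \<in> G"
  shows "\<pi> g = \<pi> g' \<longleftrightarrow> transpose g ** g' \<in> H"
proof
  assume "\<pi> g = \<pi> g'"
  then obtain h where "h \<in> H" "g' ** mat 1 = g ** h"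
    using H.one unfolding coset_eq_image by (metis (no_types, lifting) imageE imageI)
  then show "transpose g ** g' \<in> H"
    by (simp add: G.cancel_left[OF assms(1)])
next
  assume h: "transpose g ** g' \<in> H"
  define k where "k = transpose g ** g'"
  have g': "g' = g ** k"
    by (simp add: k_def G.cancel_left[OF assms(1)])
  have k: "k \<in> H"
    using h by (simp add: k_def)
  have "(\<lambda>h. k ** h) ` H = H"
  proof (intro equalityI subsetI)
    fix x assume "x \<in> H"
    then show "x \<in> (\<lambda>h. k ** h) ` H"
      using H.mult H.transp k by (intro image_eqI[of _ _ "transpose k ** x"]) (auto simp: H.cancel_left)
  qed (use k H.mult in auto)
  then have "\<pi> g = (\<lambda>h. g ** h) ` ((\<lambda>h. k ** h) ` H)"
    by (simp add: coset_eq_image)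
  also have "\<dots> = \<pi> g'"
    by (simp only: g' coset_eq_image image_image matrix_mul_assoc)
  finally show "\<pi> g = \<pi> g'" .
qed

lemma coset_mult_H: "g \<in> G \<Longrightarrow> h \<in> H \<Longrightarrow> \<pi> (g ** h) = \<pi> g"
  using coset_eq_iff[of g "g ** h"] G.cancel_left(1)[of g h] G.mult H_subset by auto

lemma left_translation_coset: "left_translation a (\<pi> g) = \<pi> (a ** g)"
  unfolding coset_eq_image left_translation_def l_coset_def matrix_group_def
  by (auto simp: matrix_mul_assoc)

lemma continuous_map_coset: "continuous_map (top_of_set G) D \<pi>"
  unfolding continuous_map_def by (auto simp: topspace_D openin_D)

lemma continuous_map_from_D:
  assumes "\<And>x. x \<in> topspace D \<Longrightarrow> f x \<in> topspace Y"
    and "continuous_map (top_of_set G) Y (\<lambda>g. f (\<pi> g))"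
  shows "continuous_map D Y f"
  unfolding continuous_map_def
proof (intro conjI allI impI)
  fix U assume "openin Y U"
  with assms(2) have "openin (top_of_set G) {g \<in> G. f (\<pi> g) \<in> U}"
    by (simp add: continuous_map_def)
  moreover have "{g \<in> G. \<pi> g \<in> {x \<in> topspace D. f x \<in> U}} = {g \<in> G. f (\<pi> g) \<in> U}"
    by (auto simp: topspace_D)
  ultimately show "openin D {x \<in> topspace D. f x \<in> U}"
    by (auto simp: openin_D topspace_D)
qed (use assms in auto)

lemma continuous_on_matrix_mult [continuous_intros]:
  fixes f :: "'a::topological_space \<Rightarrow> complex ^ 'k::finite ^ 'l::finite"
    and g :: "'a \<Rightarrow> complex ^ 'p::finite ^ 'k"
  assumes "continuous_on A f" "continuous_on A g"
  shows "continuous_on A (\<lambda>x. f x ** g x)"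
  unfolding matrix_matrix_mult_def using assms
  by (intro continuous_intros)

text \<open>The saturation of an open set is the union of its right translates by elements of
  \<open>H\<close>.\<close>

lemma open_map_coset: "open_map (top_of_set G) D \<pi>"
  unfolding open_map_def
proof (intro allI impI)
  fix N assume N: "openin (top_of_set G) N"
  have NG: "N \<subseteq> G"
    using openin_imp_subset[OF N] .
  have *: "openin (top_of_set G) {g\<in>G. g ** h \<in> N}" if "h \<in> H" for h
  proof -
    have "continuous_on G (\<lambda>g. g ** h)" "(\<lambda>g. g ** h) \<in> G \<rightarrow> G"
      using that H_subset G.mult by (auto intro!: continuous_intros)
    from continuous_openin_preimage[OF this N] show ?thesis
      by (simp add: vimage_def Int_def)
  qed
  have "{g\<in>G. \<pi> g \<in> \<pi> ` N} = (\<Union>h\<in>H. {g\<in>G. g ** h \<in> N})"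
  proof (intro equalityI subsetI)
    fix g assume "g \<in> {g\<in>G. \<pi> g \<in> \<pi> ` N}"
    then obtain n where "g \<in> G" "n \<in> N" "\<pi> g = \<pi> n"
      by auto
    then have "transpose g ** n \<in> H" "g ** (transpose g ** n) \<in> N"
      using coset_eq_iff NG by (auto simp: G.cancel_left)
    with \<open>g \<in> G\<close> show "g \<in> (\<Union>h\<in>H. {g\<in>G. g ** h \<in> N})"
      by blast
  next
    fix g assume "g \<in> (\<Union>h\<in>H. {g\<in>G. g ** h \<in> N})"
    then obtain h where "h \<in> H" "g \<in> G" "g ** h \<in> N"
      by blast
    then show "g \<in> {g\<in>G. \<pi> g \<in> \<pi> ` N}"
      using coset_mult_H[of g h] by (metis (mono_tags, lifting) imageI mem_Collect_eq)
  qed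
  with * show "openin D (\<pi> ` N)"
    using NG by (auto simp: openin_D intro!: openin_Union)
qed

lemma second_countable_D: "second_countable D"
proof (rule second_countable_open_map_image[OF continuous_map_coset open_map_coset])
  show "\<pi> ` topspace (top_of_set G) = topspace D"
    by (simp add: topspace_D)
  obtain B :: "(complex ^ 'm ^ 'm) set set" where "countable B" "topological_basis B"
    using ex_countable_basis by blast
  then have "second_countable (euclidean :: (complex ^ 'm ^ 'm) topology)"
    unfolding second_countable_def open_openin[symmetric]
    by (metis topological_basis_open topological_basisE)
  then show "second_countable (top_of_set G)"
    by (rule second_countable_subtopology)
qed

text \<open>Two elements lie in the same coset exactly when \<open>transpose a ** b\<close> is in
  \<open>H\<close>. As \<open>H\<close> is closed, this relation is closed, and a product
  neighbourhood avoiding it projects to disjoint open sets.\<close>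

lemma Hausdorff_D: "Hausdorff_space D"
  unfolding Hausdorff_space_def
proof (intro allI impI)
  fix x y assume "x \<in> topspace D \<and> y \<in> topspace D \<and> x \<noteq> y"
  then obtain a b where ab: "a \<in> G" "b \<in> G" "x = \<pi> a" "y = \<pi> b" "transpose a ** b \<notin> H"
    unfolding topspace_D using coset_eq_iff by blast
  have "continuous_on UNIV (\<lambda>p::(complex ^ 'm ^ 'm) \<times> (complex ^ 'm ^ 'm). transpose (fst p) ** snd p)"
    by (intro continuous_at_imp_continuous_on ballI isCont_cdiff cdiff_intros)
  then have "open ((\<lambda>p::(complex ^ 'm ^ 'm) \<times> (complex ^ 'm ^ 'm). transpose (fst p) ** snd p) -` (- H))"
    using H.closed by (intro open_vimage) auto
  moreover have "(a, b) \<in> (\<lambda>p::(complex ^ 'm ^ 'm) \<times> (complex ^ 'm ^ 'm). transpose (fst p) ** snd p) -` (- H)"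
    using ab by simp
  ultimately obtain A B where AB: "open A" "open B" "(a, b) \<in> A \<times> B"
    "A \<times> B \<subseteq> (\<lambda>p::(complex ^ 'm ^ 'm) \<times> (complex ^ 'm ^ 'm). transpose (fst p) ** snd p) -` (- H)"
    by (rule open_prod_elim)
  have "openin D (\<pi> ` (G \<inter> A))" "openin D (\<pi> ` (G \<inter> B))"
    using AB open_map_coset unfolding open_map_def by (auto simp: openin_open_Int)
  moreover have "disjnt (\<pi> ` (G \<inter> A)) (\<pi> ` (G \<inter> B))"
    using AB(4) by (auto simp: disjnt_iff coset_eq_iff)
  moreover have "x \<in> \<pi> ` (G \<inter> A)" "y \<in> \<pi> ` (G \<inter> B)"
    using ab AB(3) by auto
  ultimately show "\<exists>U V. openin D U \<and> openin D V \<and> x \<in> U \<and> y \<in> V \<and> disjnt U V"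
    by blast
qed

section \<open>Charts of the coset atlas and maps between them\<close>

lemma atlas_projection:
  fixes \<phi> :: "(complex ^ 'm ^ 'm) set \<Rightarrow> complex ^ 'n::finite"
  assumes "(U, \<phi>) \<in> coset_atlas G H" "g \<in> G" "\<pi> g \<in> U"
  obtains W F where "g \<in> W" "holomorphic_map_on W F"
    "\<And>x. x \<in> G \<Longrightarrow> x \<in> W \<Longrightarrow> \<pi> x \<in> U \<Longrightarrow> F x = \<phi> (\<pi> x)"
proof -
  have "locally_holomorphic_map_on {g\<in>G. \<pi> g \<in> U} (\<lambda>g. \<phi> (\<pi> g))"
    using assms(1) by (simp add: coset_atlas_def)
  then obtain W F where "g \<in> W" "holomorphic_map_on W F"
    "\<forall>x\<in>{g\<in>G. \<pi> g \<in> U} \<inter> W. F x = \<phi> (\<pi> x)"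
    unfolding locally_holomorphic_map_on_def using assms(2,3) by blast
  then show ?thesis
    using that by blast
qed

lemma atlas_section:
  fixes \<phi> :: "(complex ^ 'm ^ 'm) set \<Rightarrow> complex ^ 'n::finite"
  assumes "(U, \<phi>) \<in> coset_atlas G H" "p \<in> \<phi> ` U"
  obtains W s where "p \<in> W" "open W" "W \<subseteq> \<phi> ` U" "holomorphic_map_on W s"
    "\<And>w. w \<in> W \<Longrightarrow> s w \<in> G \<and> \<pi> (s w) = inv_into U \<phi> w"
proof -
  have "\<exists>W s. p \<in> W \<and> W \<subseteq> \<phi> ` U \<and> holomorphic_map_on W s \<and>
      (\<forall>w\<in>W. s w \<in> G \<and> \<pi> (s w) = inv_into U \<phi> w)"
    using assms unfolding coset_atlas_def mem_Collect_eq split_conv by blast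
  then obtain W s where "p \<in> W" "W \<subseteq> \<phi> ` U" "holomorphic_map_on W s"
      "\<forall>w\<in>W. s w \<in> G \<and> \<pi> (s w) = inv_into U \<phi> w"
    by blast
  moreover from this have "open W"
    by (simp add: holomorphic_map_on_def)
  ultimately show ?thesis
    using that by blast
qed

lemma atlas_basic:
  fixes \<phi> :: "(complex ^ 'm ^ 'm) set \<Rightarrow> complex ^ 'n::finite"
  assumes "(U, \<phi>) \<in> coset_atlas G H"
  shows "openin D U" "inj_on \<phi> U" "open (\<phi> ` U)" "U \<subseteq> \<pi> ` G"
  using assms openin_D by (auto simp: coset_atlas_def)

lemma atlas_continuous:
  fixes \<phi> :: "(complex ^ 'm ^ 'm) set \<Rightarrow> complex ^ 'n::finite"
  assumes c: "(U, \<phi>) \<in> coset_atlas G H"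
  shows "continuous_on {g\<in>G. \<pi> g \<in> U} (\<lambda>g. \<phi> (\<pi> g))"
  unfolding continuous_on_eq_continuous_within
proof
  fix g assume g: "g \<in> {g\<in>G. \<pi> g \<in> U}"
  then obtain W F where W: "g \<in> W" "holomorphic_map_on W F"
    "\<And>x. x \<in> G \<Longrightarrow> x \<in> W \<Longrightarrow> \<pi> x \<in> U \<Longrightarrow> F x = \<phi> (\<pi> x)"
    using atlas_projection[OF c, of g] by blast
  then have "open W" "isCont F g"
    by (auto simp: holomorphic_map_on_iff semidiff_continuous)
  then have "(F \<longlongrightarrow> F g) (at g within {g\<in>G. \<pi> g \<in> U})"
    using continuous_at_imp_continuous_at_within continuous_within by blast
  moreover have "\<forall>\<^sub>F x in at g within {g\<in>G. \<pi> g \<in> U}. F x = \<phi> (\<pi> x)"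
    unfolding eventually_at_topological using \<open>open W\<close> W by (intro exI[of _ W]) auto
  ultimately have "((\<lambda>x. \<phi> (\<pi> x)) \<longlongrightarrow> F g) (at g within {g\<in>G. \<pi> g \<in> U})"
    by (rule Lim_transform_eventually)
  then show "continuous (at g within {g\<in>G. \<pi> g \<in> U}) (\<lambda>x. \<phi> (\<pi> x))"
    using W g by (simp add: continuous_within)
qed

lemma atlas_open_image:
  fixes \<phi> :: "(complex ^ 'm ^ 'm) set \<Rightarrow> complex ^ 'n::finite"
  assumes c: "(U, \<phi>) \<in> coset_atlas G H" and V: "openin D V" "V \<subseteq> U"
  shows "open (\<phi> ` V)"
proof (subst open_subopen, intro ballI)
  fix p assume "p \<in> \<phi> ` V"
  then obtain x where x: "x \<in> V" "p = \<phi> x"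
    by blast
  then have "p \<in> \<phi> ` U"
    using V by blast
  then obtain W s where W: "p \<in> W" "open W" "W \<subseteq> \<phi> ` U" "holomorphic_map_on W s"
    "\<And>w. w \<in> W \<Longrightarrow> s w \<in> G \<and> \<pi> (s w) = inv_into U \<phi> w"
    using atlas_section[OF c] by blast
  have "openin (top_of_set G) {g\<in>G. \<pi> g \<in> V}"
    using V(1) openin_D by blast
  then obtain O' where O': "open O'" "{g\<in>G. \<pi> g \<in> V} = G \<inter> O'"
    unfolding openin_open by blast
  have "open (W \<inter> s -` O')"
    using holomorphic_map_on_continuous[OF W(4)] W(2) O'(1) continuous_open_preimage by blast
  moreover have "p \<in> W \<inter> s -` O'"
  proof -
    have "\<pi> (s p) = x"
      using W(5)[OF W(1)] x V(2) atlas_basic(2)[OF c] by (simp add: subset_iff)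
    then show ?thesis
      using W(1,5) x O'(2) by blast
  qed
  moreover have "W \<inter> s -` O' \<subseteq> \<phi> ` V"
  proof
    fix w assume w: "w \<in> W \<inter> s -` O'"
    then have "inv_into U \<phi> w \<in> V"
      using W(5)[of w] O'(2) by (metis (mono_tags, lifting) IntD1 IntD2 IntI mem_Collect_eq vimageE)
    moreover have "\<phi> (inv_into U \<phi> w) = w"
      using w W(3) by (auto simp: f_inv_into_f)
    ultimately show "w \<in> \<phi> ` V"
      by (metis imageI)
  qed
  ultimately show "\<exists>T. open T \<and> p \<in> T \<and> T \<subseteq> \<phi> ` V"
    by blast
qed

lemma atlas_topological_chart:
  fixes \<phi> :: "(complex ^ 'm ^ 'm) set \<Rightarrow> complex ^ 'n::finite"
  assumes c: "(U, \<phi>) \<in> coset_atlas G H"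
  shows "topological_chart D (U, \<phi>)"
proof -
  note b = atlas_basic[OF c]
  have top: "topspace (subtopology D U) = U"
    using openin_subset[OF b(1)] by (simp add: Int_absorb1)
  have "continuous_map (subtopology D U) (top_of_set (\<phi> ` U)) \<phi>"
    unfolding continuous_map_def top
  proof (intro conjI allI impI)
    fix V assume "openin (top_of_set (\<phi> ` U)) V"
    then obtain O' where O': "open O'" "V = \<phi> ` U \<inter> O'"
      by (auto simp: openin_open)
    have "openin (top_of_set {g\<in>G. \<pi> g \<in> U}) ({g\<in>G. \<pi> g \<in> U} \<inter> (\<lambda>g. \<phi> (\<pi> g)) -` O')"
      using continuous_openin_preimage_gen[OF atlas_continuous[OF c] O'(1)] .
    moreover have "openin (top_of_set G) {g\<in>G. \<pi> g \<in> U}"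
      using b(1) openin_D by blast
    ultimately have "openin (top_of_set G) ({g\<in>G. \<pi> g \<in> U} \<inter> (\<lambda>g. \<phi> (\<pi> g)) -` O')"
      using openin_trans by blast
    moreover have "{g\<in>G. \<pi> g \<in> U} \<inter> (\<lambda>g. \<phi> (\<pi> g)) -` O' = {g\<in>G. \<pi> g \<in> {x\<in>U. \<phi> x \<in> V}}"
      using O'(2) by auto
    ultimately have "openin D {x\<in>U. \<phi> x \<in> V}"
      using b(4) by (auto simp: openin_D)
    then show "openin (subtopology D U) {x\<in>U. \<phi> x \<in> V}"
      using b(1) by (simp add: openin_open_subtopology)
  qed auto
  moreover have "open_map (subtopology D U) (top_of_set (\<phi> ` U)) \<phi>"
    unfolding open_map_def
  proof (intro allI impI)
    fix V assume "openin (subtopology D U) V"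
    then have "openin D V" "V \<subseteq> U"
      using b(1) openin_open_subtopology by blast+
    then show "openin (top_of_set (\<phi> ` U)) (\<phi> ` V)"
      using atlas_open_image[OF c] by (intro open_subset image_mono)
  qed
  ultimately have "homeomorphic_map (subtopology D U) (top_of_set (\<phi> ` U)) \<phi>"
    using b(2) by (intro bijective_open_imp_homeomorphic_map) (simp_all only: top topspace_subtopology_subset subset_UNIV topspace_euclidean)
  then show ?thesis
    using b by (simp add: topological_chart_def)
qed

lemma coset_map_continuous:
  assumes T: "continuous_on G T" "\<And>g. g \<in> G \<Longrightarrow> T g \<in> G" and f: "\<And>g. g \<in> G \<Longrightarrow> f (\<pi> g) = \<pi> (T g)"
  shows "continuous_map D D f"
proof (rule continuous_map_from_D)
  have "continuous_map (top_of_set G) (top_of_set G) T"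
    using T by (auto simp: continuous_map_in_subtopology)
  from continuous_map_compose[OF this continuous_map_coset]
  have "continuous_map (top_of_set G) D (\<lambda>g. \<pi> (T g))"
    by (simp add: o_def)
  then show "continuous_map (top_of_set G) D (\<lambda>g. f (\<pi> g))"
    by (rule continuous_map_eq) (use f in auto)
qed (use T f in \<open>auto simp: topspace_D\<close>)

text \<open>Near each point the coordinate expression factors as \<open>F\<close>, \<open>T\<close>
  and \<open>s\<close> in turn, with \<open>F\<close> and \<open>s\<close> holomorphic. So it has
  the type \<open>\<kappa>\<close> of \<open>T\<close>; this covers left translations and the
  antiholomorphic maps at once.\<close>

lemma coset_map_in_charts:
  fixes \<phi> \<psi> :: "(complex ^ 'm ^ 'm) set \<Rightarrow> complex ^ 'n::finite"
  assumes T: "\<And>g. g \<in> G \<Longrightarrow> semidiff \<kappa> T g" "\<And>g. g \<in> G \<Longrightarrow> T g \<in> G"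
    and f: "\<And>g. g \<in> G \<Longrightarrow> f (\<pi> g) = \<pi> (T g)"
    and U: "(U, \<phi>) \<in> coset_atlas G H" and V: "(V, \<psi>) \<in> coset_atlas G H"
  shows "open (\<phi> ` {x\<in>U. f x \<in> V})"
    and "z \<in> \<phi> ` {x\<in>U. f x \<in> V} \<Longrightarrow> semidiff \<kappa> (\<psi> \<circ> f \<circ> inv_into U \<phi>) z"
proof -
  have cT: "continuous_on G T"
    using T(1) by (auto intro!: continuous_at_imp_continuous_on semidiff_continuous)
  have "openin D {x\<in>topspace D. f x \<in> V}"
    using coset_map_continuous[OF cT T(2) f] atlas_basic(1)[OF V] by (auto simp: continuous_map_def)
  then have "openin D (U \<inter> {x\<in>topspace D. f x \<in> V})"
    using atlas_basic(1)[OF U] by blast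
  moreover have "U \<inter> {x\<in>topspace D. f x \<in> V} = {x\<in>U. f x \<in> V}"
    using atlas_basic(4)[OF U] by (auto simp: topspace_D)
  ultimately show op: "open (\<phi> ` {x\<in>U. f x \<in> V})"
    by (intro atlas_open_image[OF U]) auto
  assume "z \<in> \<phi> ` {x\<in>U. f x \<in> V}"
  then obtain x where x: "x \<in> U" "f x \<in> V" "z = \<phi> x"
    by auto
  have inv: "inv_into U \<phi> (\<phi> x) = x" if "x \<in> U" for x
    using atlas_basic(2)[OF U] that by simp
  have "z \<in> \<phi> ` U"
    using x by blast
  then obtain W s where W: "z \<in> W" "open W" "W \<subseteq> \<phi> ` U" "holomorphic_map_on W s"
    "\<And>w. w \<in> W \<Longrightarrow> s w \<in> G \<and> \<pi> (s w) = inv_into U \<phi> w"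
    using atlas_section[OF U] by blast
  have sz: "s z \<in> G" "\<pi> (T (s z)) = f x"
    using W(5)[OF W(1)] f[of "s z"] x inv by simp_all
  then obtain W2 F where F: "T (s z) \<in> W2" "holomorphic_map_on W2 F"
    "\<And>y. y \<in> G \<Longrightarrow> y \<in> W2 \<Longrightarrow> \<pi> y \<in> V \<Longrightarrow> F y = \<psi> (\<pi> y)"
    using atlas_projection[OF V, of "T (s z)"] T(2) x by metis
  have "continuous_on W (\<lambda>w. T (s w))"
    using W(5) by (intro continuous_on_compose2[OF cT holomorphic_map_on_continuous[OF W(4)]]) auto
  then have "open (W \<inter> (\<lambda>w. T (s w)) -` W2)"
    using W(2) F(2) by (intro continuous_open_preimage) (auto simp: holomorphic_map_on_def)
  moreover have "semidiff \<kappa> (\<lambda>w. F (T (s w))) z"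
    using semidiff_compose[OF _ semidiff_compose[of \<kappa> T s z "\<lambda>c. c"], of "\<lambda>c. c" F] T(1) sz F W(1,4)
    by (auto simp: holomorphic_map_on_iff)
  moreover have "F (T (s w)) = (\<psi> \<circ> f \<circ> inv_into U \<phi>) w"
    if "w \<in> (W \<inter> (\<lambda>w. T (s w)) -` W2) \<inter> \<phi> ` {x\<in>U. f x \<in> V}" for w
  proof -
    have w: "s w \<in> G" "\<pi> (s w) = inv_into U \<phi> w" "T (s w) \<in> W2"
      using that W(5)[of w] by auto
    have "f (inv_into U \<phi> w) = \<pi> (T (s w))"
      unfolding w(2)[symmetric] by (rule f[OF w(1)])
    moreover have "f (inv_into U \<phi> w) \<in> V"
      using that inv by auto
    ultimately show ?thesis
      using F(3)[OF T(2)[OF w(1)] w(3)] by simp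
  qed
  moreover have "z \<in> (W \<inter> (\<lambda>w. T (s w)) -` W2) \<inter> \<phi> ` {x\<in>U. f x \<in> V}"
    using W F x by auto
  ultimately show "semidiff \<kappa> (\<psi> \<circ> f \<circ> inv_into U \<phi>) z"
    using semidiff_transform[of \<kappa> "\<lambda>w. F (T (s w))" z "(W \<inter> (\<lambda>w. T (s w)) -` W2) \<inter> \<phi> ` {x\<in>U. f x \<in> V}"] op
    by (metis (no_types, lifting) open_Int)
qed

end

lemma semidiff_matrix_left: "semidiff (\<lambda>c. c) (\<lambda>g. a ** g) (z :: complex ^ 'm::finite ^ 'm)"
  for a :: "complex ^ 'm ^ 'm"
  by (intro cdiff_intros)

lemma semidiff_mcnj: "semidiff cnj (\<lambda>g. a ** mcnj g) (z :: complex ^ 'm::finite ^ 'm)"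
  for a :: "complex ^ 'm ^ 'm"
proof (rule semidiff_linear)
  have [simp]: "mcnj (x + y) = mcnj x + mcnj y" "mcnj (r *\<^sub>R x) = r *\<^sub>R mcnj x" for x y :: "complex ^ 'm ^ 'm" and r
    by (simp_all add: vec_eq_iff)
  show "linear (\<lambda>g. a ** mcnj g)"
    by (rule linearI) (simp_all add: vec_eq_iff matrix_matrix_mult_def algebra_simps sum.distrib scaleR_sum_right)
qed (simp add: scaleC_matrix)

section \<open>Charts of the quotient from invariant functions of matrices\<close>

context orthogonal_pair
begin

text \<open>A chart of the quotient described upstairs: \<open>\<Phi>\<close> is holomorphic on an
  open set of all matrices, and only its values on \<open>G\<close> are constrained.
  \<open>B\<close> is fixed separately, since \<open>\<Phi>\<close> may take values outside the
  wanted coordinate domain.\<close>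

definition model_chart ::
    "(complex ^ 'm ^ 'm) set \<Rightarrow> (complex ^ 'm ^ 'm \<Rightarrow> complex ^ 'n::finite) \<Rightarrow> (complex ^ 'n) set \<Rightarrow> bool"
  where "model_chart N \<Phi> B \<longleftrightarrow> holomorphic_map_on N \<Phi> \<and> open B \<and>
    (\<forall>g\<in>G \<inter> N. \<forall>h\<in>H. g ** h \<in> N \<and> \<Phi> (g ** h) = \<Phi> g) \<and>
    (\<forall>g\<in>G \<inter> N. \<forall>g'\<in>G \<inter> N. \<Phi> g = \<Phi> g' \<longrightarrow> transpose g ** g' \<in> H) \<and>
    (\<forall>p\<in>B. \<exists>W s. p \<in> W \<and> holomorphic_map_on W s \<and> (\<forall>w\<in>W \<inter> B. s w \<in> G \<inter> N \<and> \<Phi> (s w) = w))"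

definition chart_domain where "chart_domain N \<Phi> B = \<pi> ` {g \<in> G \<inter> N. \<Phi> g \<in> B}"

definition chart_map where "chart_map N \<Phi> x = \<Phi> (SOME g. g \<in> G \<inter> N \<and> \<pi> g = x)"

lemma chart_map_coset:
  assumes "model_chart N \<Phi> B" "g \<in> G \<inter> N"
  shows "chart_map N \<Phi> (\<pi> g) = \<Phi> g"
proof -
  define k where "k = (SOME k. k \<in> G \<inter> N \<and> \<pi> k = \<pi> g)"
  have k: "k \<in> G \<inter> N" "\<pi> k = \<pi> g"
    unfolding k_def using someI[of "\<lambda>k. k \<in> G \<inter> N \<and> \<pi> k = \<pi> g" g] assms(2) by blast+
  then have "transpose g ** k \<in> H"
    using coset_eq_iff[of g k] assms(2) by auto
  then have "\<Phi> (g ** (transpose g ** k)) = \<Phi> g"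
    using assms unfolding model_chart_def by blast
  then show ?thesis
    using assms(2) unfolding chart_map_def k_def[symmetric] by (simp add: G.cancel_left)
qed

lemma coset_in_chart_domain:
  assumes "model_chart N \<Phi> B" "g \<in> G"
  shows "\<pi> g \<in> chart_domain N \<Phi> B \<longleftrightarrow> g \<in> N \<and> \<Phi> g \<in> B"
proof
  assume "\<pi> g \<in> chart_domain N \<Phi> B"
  then obtain k where k: "k \<in> G \<inter> N" "\<Phi> k \<in> B" "\<pi> k = \<pi> g"
    unfolding chart_domain_def by auto
  then have "transpose k ** g \<in> H"
    using coset_eq_iff[of k g] assms(2) by auto
  then have "k ** (transpose k ** g) \<in> N \<and> \<Phi> (k ** (transpose k ** g)) = \<Phi> k"
    using assms k unfolding model_chart_def by blast
  then show "g \<in> N \<and> \<Phi> g \<in> B"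
    using k by (simp add: G.cancel_left)
qed (use assms in \<open>auto simp: chart_domain_def\<close>)

lemma model_chart_sectionE:
  assumes "model_chart N \<Phi> B" "p \<in> B"
  obtains W s where "p \<in> W" "holomorphic_map_on W s" "W \<subseteq> B"
    "\<And>w. w \<in> W \<Longrightarrow> s w \<in> G \<and> s w \<in> N \<and> \<Phi> (s w) = w"
proof -
  obtain W s where "p \<in> W" "holomorphic_map_on W s" "\<forall>w\<in>W \<inter> B. s w \<in> G \<inter> N \<and> \<Phi> (s w) = w"
    using assms unfolding model_chart_def by blast
  moreover have "open B"
    using assms by (simp add: model_chart_def)
  ultimately show ?thesis
    using that[of "W \<inter> B" s] assms(2) by (auto simp: holomorphic_map_on_def)
qed

lemma chart_map_image:
  assumes m: "model_chart N \<Phi> B"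
  shows "chart_map N \<Phi> ` chart_domain N \<Phi> B = B"
proof
  show "chart_map N \<Phi> ` chart_domain N \<Phi> B \<subseteq> B"
    unfolding chart_domain_def using chart_map_coset[OF m] by auto
  show "B \<subseteq> chart_map N \<Phi> ` chart_domain N \<Phi> B"
  proof
    fix p assume p: "p \<in> B"
    obtain W s where "p \<in> W" "s p \<in> G \<inter> N" "\<Phi> (s p) = p"
      by (rule model_chart_sectionE[OF m p]) blast
    then show "p \<in> chart_map N \<Phi> ` chart_domain N \<Phi> B"
      using chart_map_coset[OF m, of "s p"] \<open>p \<in> B\<close> unfolding chart_domain_def
      by (intro image_eqI[of _ _ "\<pi> (s p)"]) auto
  qed
qed

lemma chart_map_inj:
  assumes m: "model_chart N \<Phi> B"
  shows "inj_on (chart_map N \<Phi>) (chart_domain N \<Phi> B)"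
proof (rule inj_onI)
  fix x y assume "x \<in> chart_domain N \<Phi> B" "y \<in> chart_domain N \<Phi> B" and eq: "chart_map N \<Phi> x = chart_map N \<Phi> y"
  then obtain g k where gk: "g \<in> G \<inter> N" "x = \<pi> g" "k \<in> G \<inter> N" "y = \<pi> k"
    unfolding chart_domain_def by auto
  then have "transpose g ** k \<in> H"
    using eq chart_map_coset[OF m] m unfolding model_chart_def by metis
  then show "x = y"
    using coset_eq_iff[of g k] gk by auto
qed

lemma chart_in_atlas:
  assumes m: "model_chart N \<Phi> B"
  shows "(chart_domain N \<Phi> B, chart_map N \<Phi>) \<in> coset_atlas G H"
  unfolding coset_atlas_def mem_Collect_eq split_conv
proof (intro conjI)
  have hol: "holomorphic_map_on N \<Phi>" and "open B"
    using m by (auto simp: model_chart_def)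
  then have op: "open (N \<inter> \<Phi> -` B)"
    using holomorphic_map_on_continuous continuous_open_preimage holomorphic_map_on_def by blast
  have dom: "{g\<in>G. \<pi> g \<in> chart_domain N \<Phi> B} = G \<inter> (N \<inter> \<Phi> -` B)"
    using coset_in_chart_domain[OF m] by auto
  then show "openin (coset_topology G H) (chart_domain N \<Phi> B)"
    using op unfolding openin_D by (auto simp: chart_domain_def openin_open)
  show "inj_on (chart_map N \<Phi>) (chart_domain N \<Phi> B)"
    by (rule chart_map_inj[OF m])
  show "open (chart_map N \<Phi> ` chart_domain N \<Phi> B)"
    using \<open>open B\<close> by (simp add: chart_map_image[OF m])
  show "locally_holomorphic_map_on {g\<in>G. \<pi> g \<in> chart_domain N \<Phi> B} (\<lambda>g. chart_map N \<Phi> (\<pi> g))"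
    unfolding dom locally_holomorphic_map_on_def
    by (intro ballI exI[of _ N] exI[of _ \<Phi>]) (auto simp: hol chart_map_coset[OF m])
  show "\<forall>p\<in>chart_map N \<Phi> ` chart_domain N \<Phi> B. \<exists>W s. p \<in> W \<and> W \<subseteq> chart_map N \<Phi> ` chart_domain N \<Phi> B \<and>
      holomorphic_map_on W s \<and> (\<forall>w\<in>W. s w \<in> G \<and> \<pi> (s w) = inv_into (chart_domain N \<Phi> B) (chart_map N \<Phi>) w)"
    unfolding chart_map_image[OF m]
  proof
    fix p assume p: "p \<in> B"
    obtain W s where W: "p \<in> W" "holomorphic_map_on W s" "W \<subseteq> B"
      "\<And>w. w \<in> W \<Longrightarrow> s w \<in> G \<and> s w \<in> N \<and> \<Phi> (s w) = w"
      by (rule model_chart_sectionE[OF m p]) blast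
    have "\<pi> (s w) = inv_into (chart_domain N \<Phi> B) (chart_map N \<Phi>) w" if "w \<in> W" for w
    proof -
      have "\<pi> (s w) \<in> chart_domain N \<Phi> B" "chart_map N \<Phi> (\<pi> (s w)) = w"
        using W(3,4) that coset_in_chart_domain[OF m] chart_map_coset[OF m] by auto
      then show ?thesis
        using inv_into_f_f[OF chart_map_inj[OF m]] by metis
    qed
    then show "\<exists>W s. p \<in> W \<and> W \<subseteq> B \<and> holomorphic_map_on W s \<and>
        (\<forall>w\<in>W. s w \<in> G \<and> \<pi> (s w) = inv_into (chart_domain N \<Phi> B) (chart_map N \<Phi>) w)"
      using W by blast
  qed
qed

text \<open>Used twice: the translates of one chart cover the quotient, and the translate by the
  element conjugating the real points to \<open>Gu\<close> contains the slice.\<close>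

lemma model_chart_translate:
  assumes m: "model_chart N \<Phi> B" and a: "a \<in> G"
  shows "model_chart {g. transpose a ** g \<in> N} (\<lambda>g. \<Phi> (transpose a ** g)) B"
  unfolding model_chart_def
proof (intro conjI ballI impI)
  have hol: "holomorphic_map_on N \<Phi>"
    using m by (auto simp: model_chart_def)
  have at: "transpose a \<in> G"
    by (rule G.transp[OF a])
  have "continuous_on UNIV (\<lambda>g::complex ^ 'm ^ 'm. transpose a ** g)"
    by (intro continuous_intros)
  then have "open ((\<lambda>g::complex ^ 'm ^ 'm. transpose a ** g) -` N)"
    using hol by (intro open_vimage) (auto simp: holomorphic_map_on_def)
  moreover have "cdiff (\<lambda>g. \<Phi> (transpose a ** g)) z" if "transpose a ** z \<in> N" for z
    using semidiff_compose[OF _ semidiff_matrix_left, of "\<lambda>c. c" \<Phi> "transpose a" z] hol that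
    by (simp add: holomorphic_map_on_iff)
  ultimately show "holomorphic_map_on {g. transpose a ** g \<in> N} (\<lambda>g. \<Phi> (transpose a ** g))"
    by (simp add: holomorphic_map_on_iff vimage_def)
  show "open B"
    using m by (simp add: model_chart_def)
  fix g assume g: "g \<in> G \<inter> {g. transpose a ** g \<in> N}"
  then have g': "transpose a ** g \<in> G \<inter> N"
    using G.mult at by auto
  fix h assume "h \<in> H"
  with g' have "(transpose a ** g) ** h \<in> N \<and> \<Phi> ((transpose a ** g) ** h) = \<Phi> (transpose a ** g)"
    using m unfolding model_chart_def by blast
  then show "g ** h \<in> {g. transpose a ** g \<in> N}" "\<Phi> (transpose a ** (g ** h)) = \<Phi> (transpose a ** g)"
    by (simp_all add: matrix_mul_assoc)
next
  fix g k assume g: "g \<in> G \<inter> {g. transpose a ** g \<in> N}" and k: "k \<in> G \<inter> {g. transpose a ** g \<in> N}"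
    and eq: "\<Phi> (transpose a ** g) = \<Phi> (transpose a ** k)"
  then have "transpose a ** g \<in> G \<inter> N" "transpose a ** k \<in> G \<inter> N"
    using G.mult G.transp[OF a] by auto
  then have "transpose (transpose a ** g) ** (transpose a ** k) \<in> H"
    using m eq unfolding model_chart_def by blast
  moreover have "transpose (transpose a ** g) ** (transpose a ** k) = transpose g ** (a ** (transpose a ** k))"
    by (simp add: matrix_transpose_mul matrix_mul_assoc)
  ultimately show "transpose g ** k \<in> H"
    by (simp add: G.cancel_left[OF a])
next
  fix p assume p: "p \<in> B"
  obtain W s where W: "p \<in> W" "holomorphic_map_on W s" "W \<subseteq> B"
    "\<And>w. w \<in> W \<Longrightarrow> s w \<in> G \<and> s w \<in> N \<and> \<Phi> (s w) = w"
    by (rule model_chart_sectionE[OF m p]) blast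
  have "holomorphic_map_on W (\<lambda>w. a ** s w)"
    using W(2) by (auto simp: holomorphic_map_on_iff intro!: cdiff_intros)
  then show "\<exists>W s. p \<in> W \<and> holomorphic_map_on W s \<and>
      (\<forall>w\<in>W \<inter> B. s w \<in> G \<inter> {g. transpose a ** g \<in> N} \<and> \<Phi> (transpose a ** s w) = w)"
    using W a by (intro exI[of _ W] exI[of _ "\<lambda>w. a ** s w"]) (auto simp: G.cancel_left G.mult)
qed

lemma holomorphic_transition:
  fixes \<phi> \<psi> :: "(complex ^ 'm ^ 'm) set \<Rightarrow> complex ^ 'n::finite"
  assumes U: "(U, \<phi>) \<in> coset_atlas G H" and V: "(V, \<psi>) \<in> coset_atlas G H"
  shows "holomorphic_map_on (\<phi> ` (U \<inter> V)) (\<psi> \<circ> inv_into U \<phi>)"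
proof -
  have eq: "{x\<in>U. x \<in> V} = U \<inter> V"
    by blast
  show ?thesis
    using coset_map_in_charts[of "\<lambda>c. c" "\<lambda>g. g" "\<lambda>x. x", OF _ _ _ U V]
    by (simp add: holomorphic_map_on_iff eq o_def cdiff_id)
qed

lemma complex_manifold_D:
  fixes \<Phi> :: "complex ^ 'm ^ 'm \<Rightarrow> complex ^ 'n::finite"
  assumes m: "model_chart N \<Phi> B" and "B \<noteq> {}"
  shows "complex_manifold D (coset_atlas G H :: ((complex ^ 'm ^ 'm) set, 'n) chart set)"
  unfolding complex_manifold_def
proof (intro conjI)
  show "Hausdorff_space D" "second_countable D"
    by (rule Hausdorff_D second_countable_D)+
  show "\<forall>c\<in>coset_atlas G H. topological_chart D (c :: (_, 'n) chart)"
    using atlas_topological_chart by auto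
  show "\<forall>(U, \<phi>)\<in>(coset_atlas G H :: (_, 'n) chart set). \<forall>(V, \<psi>)\<in>(coset_atlas G H :: (_, 'n) chart set).
      holomorphic_map_on (\<phi> ` (U \<inter> V)) (\<psi> \<circ> inv_into U \<phi>)"
    by (auto intro!: holomorphic_transition)
  show "topspace D = (\<Union>(U, \<phi>)\<in>(coset_atlas G H :: (_, 'n) chart set). U)"
  proof
    show "(\<Union>(U, \<phi>)\<in>(coset_atlas G H :: (_, 'n) chart set). U) \<subseteq> topspace D"
      using atlas_basic(4) by (auto simp: topspace_D)
    show "topspace D \<subseteq> (\<Union>(U, \<phi>)\<in>(coset_atlas G H :: (_, 'n) chart set). U)"
    proof
      fix x assume "x \<in> topspace D"
      then obtain g where g: "g \<in> G" "x = \<pi> g"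
        by (auto simp: topspace_D)
      obtain p where p: "p \<in> B"
        using \<open>B \<noteq> {}\<close> by blast
      obtain k where k: "k \<in> G" "k \<in> N" "\<Phi> k \<in> B"
        by (rule model_chart_sectionE[OF m p]) (use p in metis)
      \<comment> \<open>\<open>k\<close> represents a point of the given chart domain; translation
        by \<open>a\<close> carries its coset to that of \<open>g\<close>.\<close>
      define a where "a = g ** transpose k"
      have a: "a \<in> G"
        using g k by (simp add: a_def G.mult G.transp)
      have "transpose a ** g = k"
        using g k by (simp add: a_def matrix_transpose_mul matrix_mul_assoc[symmetric] G.orthogonal)
      then have "x \<in> chart_domain {g. transpose a ** g \<in> N} (\<lambda>g. \<Phi> (transpose a ** g)) B"
        using coset_in_chart_domain[OF model_chart_translate[OF m a] g(1)] k g by simp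
      then show "x \<in> (\<Union>(U, \<phi>)\<in>(coset_atlas G H :: (_, 'n) chart set). U)"
        using chart_in_atlas[OF model_chart_translate[OF m a]] by blast
    qed
  qed
qed

lemma atlas_smooth_chart:
  fixes \<phi> :: "(complex ^ 'm ^ 'm) set \<Rightarrow> complex ^ 'n::finite"
  assumes U: "(U, \<phi>) \<in> coset_atlas G H"
  shows "smooth_chart D (coset_atlas G H) (U, \<phi>)"
  unfolding smooth_chart_def split_conv
proof (intro conjI ballI)
  show "topological_chart D (U, \<phi>)"
    by (rule atlas_topological_chart[OF U])
  fix c :: "(_, 'n) chart" assume "c \<in> coset_atlas G H"
  then obtain V \<psi> where c: "c = (V, \<psi>)" and V: "(V, \<psi>) \<in> coset_atlas G H"
    by (cases c) auto
  have "smooth_map_on (\<phi> ` (U \<inter> V)) (\<psi> \<circ> inv_into U \<phi>)"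
    "smooth_map_on (\<psi> ` (U \<inter> V)) (\<phi> \<circ> inv_into V \<psi>)"
    using holomorphic_transition[OF U V] holomorphic_transition[OF V U]
    by (simp_all add: holomorphic_imp_smooth_map_on Int_commute)
  then show "case c of (V, \<psi>) \<Rightarrow> smooth_map_on (\<phi> ` (U \<inter> V)) (\<psi> \<circ> inv_into U \<phi>) \<and>
      smooth_map_on (\<psi> ` (U \<inter> V)) (\<phi> \<circ> inv_into V \<psi>)"
    by (simp add: c)
qed

text \<open>The set is linear in the coordinates of a single chart, so this chart serves as slice
  chart at each of its points.\<close>

lemma real_submanifold_chart:
  fixes \<Phi> :: "complex ^ 'm ^ 'm \<Rightarrow> complex ^ 'n::finite"
  assumes m: "model_chart N \<Phi> B" and V: "subspace V"
  shows "real_submanifold (dim V) D (coset_atlas G H :: (_, 'n) chart set) (chart_domain N \<Phi> (B \<inter> V))"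
  unfolding real_submanifold_def
proof (intro conjI ballI)
  show "chart_domain N \<Phi> (B \<inter> V) \<subseteq> topspace D"
    by (auto simp: chart_domain_def topspace_D)
  fix p assume p: "p \<in> chart_domain N \<Phi> (B \<inter> V)"
  have sub: "chart_domain N \<Phi> (B \<inter> V) \<subseteq> chart_domain N \<Phi> B"
    by (auto simp: chart_domain_def)
  have "chart_map N \<Phi> ` chart_domain N \<Phi> (B \<inter> V) = B \<inter> V"
  proof
    show "chart_map N \<Phi> ` chart_domain N \<Phi> (B \<inter> V) \<subseteq> B \<inter> V"
      by (auto simp: chart_domain_def chart_map_coset[OF m])
    show "B \<inter> V \<subseteq> chart_map N \<Phi> ` chart_domain N \<Phi> (B \<inter> V)"
    proof
      fix q assume q: "q \<in> B \<inter> V"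
      then have "q \<in> chart_map N \<Phi> ` chart_domain N \<Phi> B"
        using chart_map_image[OF m] by simp
      then obtain g where "g \<in> G \<inter> N" "\<Phi> g = q"
        by (auto simp: chart_domain_def chart_map_coset[OF m])
      then show "q \<in> chart_map N \<Phi> ` chart_domain N \<Phi> (B \<inter> V)"
        using q by (intro image_eqI[of _ _ "\<pi> g"]) (auto simp: chart_domain_def chart_map_coset[OF m])
    qed
  qed
  then have "chart_map N \<Phi> ` (chart_domain N \<Phi> B \<inter> chart_domain N \<Phi> (B \<inter> V)) =
      chart_map N \<Phi> ` chart_domain N \<Phi> B \<inter> V"
    using chart_map_image[OF m] sub by (simp add: Int_absorb1)
  then show "\<exists>U \<phi> V'. smooth_chart D (coset_atlas G H) (U, \<phi> :: _ \<Rightarrow> complex ^ 'n) \<and> p \<in> U \<and>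
      subspace V' \<and> dim V' = dim V \<and> \<phi> ` (U \<inter> chart_domain N \<Phi> (B \<inter> V)) = \<phi> ` U \<inter> V'"
    using atlas_smooth_chart[OF chart_in_atlas[OF m]] V p sub by blast
qed

lemma holomorphic_left_translation:
  assumes "a \<in> G"
  shows "holomorphic_self_map D (coset_atlas G H :: (_, 'n::finite) chart set) (left_translation a)"
proof -
  have T: "\<And>g. g \<in> G \<Longrightarrow> semidiff (\<lambda>c. c) (\<lambda>g. a ** g) g" "\<And>g. g \<in> G \<Longrightarrow> a ** g \<in> G"
    and f: "\<And>g. g \<in> G \<Longrightarrow> left_translation a (\<pi> g) = \<pi> (a ** g)"
    using assms semidiff_matrix_left G.mult left_translation_coset by auto
  have "continuous_map D D (left_translation a)"
    by (rule coset_map_continuous[where T = "\<lambda>g. a ** g", OF _ T(2) f]) (auto intro!: continuous_intros)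
  then show ?thesis
    unfolding holomorphic_self_map_def holomorphic_map_on_iff
    using coset_map_in_charts[where T = "\<lambda>g. a ** g" and \<kappa> = "\<lambda>c. c", OF T f] by blast
qed

definition conj_map :: "complex ^ 'm ^ 'm \<Rightarrow> (complex ^ 'm ^ 'm) set \<Rightarrow> (complex ^ 'm ^ 'm) set"
  where "conj_map a x = (\<lambda>g. a ** mcnj g) ` x"

lemma conj_map_coset: "conj_map a (\<pi> g) = \<pi> (a ** mcnj g)"
proof -
  have "mcnj ` H = H"
    using H.conj by (force intro!: image_eqI[of _ _ "mcnj _"])
  then have "\<pi> (a ** mcnj g) = (\<lambda>h. (a ** mcnj g) ** h) ` (mcnj ` H)"
    by (simp add: coset_eq_image)
  then show ?thesis
    by (simp add: conj_map_def coset_eq_image image_image matrix_mul_assoc)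
qed

lemma antiholomorphic_conj_map:
  assumes "a \<in> G"
  shows "antiholomorphic_self_map D (coset_atlas G H :: (_, 'n::finite) chart set) (conj_map a)"
proof -
  have T: "\<And>g. g \<in> G \<Longrightarrow> semidiff cnj (\<lambda>g. a ** mcnj g) g" "\<And>g. g \<in> G \<Longrightarrow> a ** mcnj g \<in> G"
    and f: "\<And>g. g \<in> G \<Longrightarrow> conj_map a (\<pi> g) = \<pi> (a ** mcnj g)"
    using assms semidiff_mcnj G.mult G.conj conj_map_coset by auto
  have "continuous_map D D (conj_map a)"
    by (rule coset_map_continuous[where T = "\<lambda>g. a ** mcnj g", OF _ T(2) f])
      (use T(1) in \<open>auto intro!: continuous_at_imp_continuous_on semidiff_continuous\<close>)
  then show ?thesis
    unfolding antiholomorphic_self_map_def antiholomorphic_map_on_iff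
    using coset_map_in_charts[where T = "\<lambda>g. a ** mcnj g" and \<kappa> = "cnj", OF T f] by blast
qed

lemma antiholomorphic_diffeo_conj_map:
  assumes a: "a \<in> G"
  shows "antiholomorphic_diffeo D (coset_atlas G H :: (_, 'n::finite) chart set) (conj_map a)"
proof -
  \<comment> \<open>Solving \<open>g = a ** mcnj h\<close> for \<open>h\<close> gives
    \<open>h = b ** mcnj g\<close>, so the inverse is a map of the same kind.\<close>
  define b where "b = mcnj (transpose a)"
  have b: "b \<in> G"
    using a by (simp add: b_def G.conj G.transp del: mcnj_simps)
  have ab: "a ** (mcnj b ** g) = g" "b ** (mcnj a ** g) = g" for g :: "complex ^ 'm ^ 'm"
    using G.cancel_left(2)[OF a, of g] G.cancel_left(1)[OF G.conj[OF a], of g] by (simp_all add: b_def)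
  have inv: "conj_map a (conj_map b x) = x" "conj_map b (conj_map a x) = x" if "x \<in> topspace D" for x
    using that by (auto simp: topspace_D conj_map_coset ab)
  have maps: "conj_map c x \<in> topspace D" if "c \<in> G" "x \<in> topspace D" for c x
    using that by (auto simp: topspace_D conj_map_coset G.mult G.conj)
  have bij: "bij_betw (conj_map a) (topspace D) (topspace D)"
    by (rule bij_betw_byWitness[where f' = "conj_map b"]) (use inv maps a b in auto)
  have eq: "inv_into (topspace D) (conj_map a) x = conj_map b x" if "x \<in> topspace D" for x
    using that inv maps[OF b] bij by (metis bij_betw_inv_into_left)
  \<comment> \<open>\<open>inv_into\<close> is known to agree with \<open>conj_map b\<close> only on
    \<open>topspace D\<close>, so the chart lemma is applied to it directly, with \<open>T\<close>
    built from \<open>b\<close>.\<close>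
  have "antiholomorphic_self_map D (coset_atlas G H :: (_, 'n) chart set) (inv_into (topspace D) (conj_map a))"
    (is "antiholomorphic_self_map D ?A ?f")
  proof -
    have T: "\<And>g. g \<in> G \<Longrightarrow> semidiff cnj (\<lambda>g. b ** mcnj g) g" "\<And>g. g \<in> G \<Longrightarrow> b ** mcnj g \<in> G"
      and f: "\<And>g. g \<in> G \<Longrightarrow> ?f (\<pi> g) = \<pi> (b ** mcnj g)"
      using b semidiff_mcnj G.mult G.conj conj_map_coset eq by (auto simp: topspace_D)
    have "continuous_map D D ?f"
      by (rule coset_map_continuous[where T = "\<lambda>g. b ** mcnj g", OF _ T(2) f])
        (use T(1) in \<open>auto intro!: continuous_at_imp_continuous_on semidiff_continuous\<close>)
    then show ?thesis
      unfolding antiholomorphic_self_map_def antiholomorphic_map_on_iff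
      using coset_map_in_charts[where T = "\<lambda>g. b ** mcnj g" and \<kappa> = "cnj", OF T f] by blast
  qed
  then show ?thesis
    unfolding antiholomorphic_diffeo_def using bij antiholomorphic_conj_map[OF a] by blast
qed

end

section \<open>Positive Hermitian matrices\<close>

text \<open>A maximizer of the Rayleigh quotient on the unit sphere of \<open>S\<close> is an
  eigenvector, because the residual \<open>f x - m x\<close> stays in \<open>S\<close> and would be
  a direction of increase.\<close>

lemma selfadjoint_eigenvector:
  fixes f :: "'a::euclidean_space \<Rightarrow> 'a"
  assumes f: "linear f" and sym: "\<And>x y. f x \<bullet> y = x \<bullet> f y"
    and S: "subspace S" "\<And>x. x \<in> S \<Longrightarrow> f x \<in> S" "S \<noteq> {0}"
  obtains x l where "x \<in> S" "norm x = 1" "f x = l *\<^sub>R x"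
proof -
  obtain y where "y \<in> S" "y \<noteq> 0"
    using S(1,3) subspace_0 by blast
  then have "(1 / norm y) *\<^sub>R y \<in> S \<inter> sphere 0 1"
    using S(1) by (simp add: subspace_scale)
  then have "S \<inter> sphere 0 1 \<noteq> {}"
    by blast
  moreover have "compact (S \<inter> sphere 0 1)"
    using closed_subspace[OF S(1)] by (simp add: closed_Int_compact)
  moreover have "continuous_on (S \<inter> sphere 0 1) (\<lambda>x. x \<bullet> f x)"
    using f by (intro continuous_intros linear_continuous_on) (simp add: linear_conv_bounded_linear)
  ultimately obtain x where "x \<in> S \<inter> sphere 0 1" "\<forall>y\<in>S \<inter> sphere 0 1. y \<bullet> f y \<le> x \<bullet> f x"
    using continuous_attains_sup[of "S \<inter> sphere 0 1" "\<lambda>x. x \<bullet> f x"] by blast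
  then have x: "x \<in> S" "norm x = 1" "\<And>y. y \<in> S \<Longrightarrow> norm y = 1 \<Longrightarrow> y \<bullet> f y \<le> x \<bullet> f x"
    by auto
  define m where "m = x \<bullet> f x"
  have le: "y \<bullet> f y \<le> m * (y \<bullet> y)" if "y \<in> S" for y
  proof (cases "y = 0")
    case False
    then have "((1 / norm y) *\<^sub>R y) \<bullet> f ((1 / norm y) *\<^sub>R y) \<le> m"
      unfolding m_def using that S(1) by (intro x(3)) (auto simp: subspace_scale)
    then have "y \<bullet> f y / (norm y)\<^sup>2 \<le> m"
      by (simp add: linear_cmul[OF f] power2_eq_square)
    with False show ?thesis
      by (simp add: divide_le_eq power2_norm_eq_inner)
  qed (simp add: linear_0[OF f])
  define w where "w = f x - m *\<^sub>R x"
  have w: "w \<in> S"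
    using S x(1) by (simp add: w_def subspace_diff subspace_scale)
  \<comment> \<open>On \<open>S\<close> the quantity \<open>m (y, y) - (y, f y)\<close> is
    nonnegative, and it is zero at \<open>x\<close>. Along \<open>x + t w\<close> its slope at zero
    is \<open>- 2 (w, w)\<close>, which forces \<open>w = 0\<close>.\<close>
  have "0 \<le> t * (2 * - (w \<bullet> w)) + t\<^sup>2 * (m * (w \<bullet> w) - w \<bullet> f w)" for t
  proof -
    have "x + t *\<^sub>R w \<in> S"
      using S(1) x(1) w by (simp add: subspace_add subspace_scale)
    from le[OF this] have "(x + t *\<^sub>R w) \<bullet> f (x + t *\<^sub>R w) \<le> m * ((x + t *\<^sub>R w) \<bullet> (x + t *\<^sub>R w))" .
    moreover have "(x + t *\<^sub>R w) \<bullet> f (x + t *\<^sub>R w) = m + 2 * t * (w \<bullet> f x) + t\<^sup>2 * (w \<bullet> f w)"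
      using sym[of x w]
      by (simp add: linear_add[OF f] linear_cmul[OF f] inner_add_left inner_add_right m_def
          power2_eq_square inner_commute algebra_simps)
    moreover have "(x + t *\<^sub>R w) \<bullet> (x + t *\<^sub>R w) = 1 + 2 * t * (w \<bullet> x) + t\<^sup>2 * (w \<bullet> w)"
      using x(2) by (simp add: inner_add_left inner_add_right power2_eq_square inner_commute norm_eq_1 algebra_simps)
    ultimately have "m + 2 * t * (w \<bullet> f x) + t\<^sup>2 * (w \<bullet> f w) \<le> m * (1 + 2 * t * (w \<bullet> x) + t\<^sup>2 * (w \<bullet> w))"
      by (simp only:)
    moreover have "w \<bullet> f x = w \<bullet> w + m * (w \<bullet> x)"
      by (simp add: w_def inner_diff_right inner_diff_left)
    ultimately have "m + 2 * t * (w \<bullet> w + m * (w \<bullet> x)) + t\<^sup>2 * (w \<bullet> f w) \<le> m * (1 + 2 * t * (w \<bullet> x) + t\<^sup>2 * (w \<bullet> w))"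
      by (simp only:)
    then show ?thesis
      by (simp add: algebra_simps)
  qed
  note quad = this
  have "w \<bullet> w = 0"
  proof (rule ccontr)
    assume "w \<bullet> w \<noteq> 0"
    then have pos: "w \<bullet> w > 0"
      by simp
    \<comment> \<open>With this \<open>t\<close> the quadratic term is at most
      \<open>t (w, w)\<close>, half the size of the negative linear term. The summand 1 keeps
      \<open>q\<close> positive.\<close>
    define q where "q = \<bar>m * (w \<bullet> w) - w \<bullet> f w\<bar> + 1"
    define t where "t = (w \<bullet> w) / q"
    have "q > 0" "t > 0"
      using pos by (simp_all add: q_def t_def add_nonneg_pos)
    have "t\<^sup>2 * (m * (w \<bullet> w) - w \<bullet> f w) \<le> t\<^sup>2 * q"
      by (intro mult_left_mono) (auto simp: q_def)
    also have "\<dots> = t * (w \<bullet> w)"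
      using \<open>q > 0\<close> by (simp add: t_def power2_eq_square)
    finally have "0 \<le> - (t * (w \<bullet> w))"
      using quad[of t] by simp
    with \<open>t > 0\<close> pos show False
      by (smt (verit) mult_pos_pos)
  qed
  then have "f x = m *\<^sub>R x"
    by (simp add: w_def)
  then show ?thesis
    using that x by blast
qed

text \<open>An orthonormal system of eigenvectors of maximal cardinality is complete: its orthogonal
  complement is invariant by symmetry and, if nonzero, would contain a further eigenvector.\<close>

lemma selfadjoint_eigenbasis:
  fixes f :: "'a::euclidean_space \<Rightarrow> 'a"
  assumes f: "linear f" and sym: "\<And>x y. f x \<bullet> y = x \<bullet> f y"
  obtains B l where "finite B" "pairwise orthogonal B" "\<And>b. b \<in> B \<Longrightarrow> norm b = 1" "span B = UNIV"
    "\<And>b. b \<in> B \<Longrightarrow> f b = l b *\<^sub>R b"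
proof -
  define P where "P = (\<lambda>B. pairwise orthogonal B \<and> (\<forall>b\<in>B. norm b = 1 \<and> (\<exists>l. f b = l *\<^sub>R b)))"
  have indep: "independent B" if "P B" for B
    using that by (intro pairwise_orthogonal_independent) (auto simp: P_def)
  have card: "finite B \<and> card B \<le> DIM('a)" if "P B" for B
    using independent_bound indep[OF that] by blast
  have "\<exists>B. P B \<and> (\<forall>C. P C \<longrightarrow> card C \<le> card B)"
    by (rule ex_has_greatest_nat[of P "{}" card "Suc DIM('a)"]) (use card in \<open>auto simp: P_def less_Suc_eq_le\<close>)
  then obtain B where B: "P B" "\<And>C. P C \<Longrightarrow> card C \<le> card B"
    by blast
  define S where "S = {x. \<forall>b\<in>B. b \<bullet> x = 0}"
  have S: "subspace S"
    by (auto simp: S_def subspace_def inner_add_right)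
  have fS: "f x \<in> S" if "x \<in> S" for x
    unfolding S_def mem_Collect_eq
  proof
    fix b assume "b \<in> B"
    then obtain l where "f b = l *\<^sub>R b"
      using B(1) by (auto simp: P_def)
    then show "b \<bullet> f x = 0"
      using that \<open>b \<in> B\<close> sym[of b x] by (simp add: S_def)
  qed
  have "S = {0}"
  proof (rule ccontr)
    assume "S \<noteq> {0}"
    then obtain x l where x: "x \<in> S" "norm x = 1" "f x = l *\<^sub>R x"
      using selfadjoint_eigenvector[OF f sym S fS] by blast
    have "x \<notin> B"
      using x by (auto simp: S_def norm_eq_1)
    moreover have "P (insert x B)"
      using B(1) x by (auto simp: P_def pairwise_insert orthogonal_def S_def inner_commute)
    ultimately show False
      using B(2)[of "insert x B"] card[OF B(1)] by simp
  qed
  moreover have "span B = UNIV"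
  proof (rule ccontr)
    assume "span B \<noteq> UNIV"
    then obtain a where "a \<noteq> 0" "\<forall>x\<in>span B. a \<bullet> x = 0"
      using span_not_UNIV_orthogonal by blast
    then have "a \<in> S"
      by (auto simp: S_def span_base inner_commute)
    with \<open>S = {0}\<close> \<open>a \<noteq> 0\<close> show False
      by simp
  qed
  moreover obtain l where "\<And>b. b \<in> B \<Longrightarrow> f b = l b *\<^sub>R b"
    using B(1) unfolding P_def by metis
  ultimately show ?thesis
    using that[of B l] B(1) card[OF B(1)] by (auto simp: P_def)
qed

lemma orthonormal_expansion:
  fixes B :: "'a::euclidean_space set"
  assumes "finite B" "pairwise orthogonal B" "\<And>b. b \<in> B \<Longrightarrow> norm b = 1" "span B = UNIV"
  shows "x = (\<Sum>b\<in>B. (x \<bullet> b) *\<^sub>R b)"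
proof -
  have "linear (\<lambda>x. \<Sum>b\<in>B. (x \<bullet> b) *\<^sub>R b)"
    by (rule linearI) (simp_all add: inner_add_left scaleR_add_left sum.distrib scaleR_sum_right)
  moreover have "(\<Sum>b\<in>B. (c \<bullet> b) *\<^sub>R b) = c" if "c \<in> B" for c
  proof -
    have "(\<Sum>b\<in>B. (c \<bullet> b) *\<^sub>R b) = (\<Sum>b\<in>B. if b = c then c else 0)"
      using assms that by (intro sum.cong) (auto simp: pairwise_def orthogonal_def norm_eq_1)
    then show ?thesis
      using that assms(1) by simp
  qed
  ultimately have "(\<Sum>b\<in>B. (x \<bullet> b) *\<^sub>R b) = id x"
    using linear_eq_on_span[of "\<lambda>x. \<Sum>b\<in>B. (x \<bullet> b) *\<^sub>R b" id B x] assms(4) by (simp add: linear_id)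
  then show ?thesis
    by simp
qed

section \<open>Hermitian matrices and positive square roots\<close>

definition adjoint_matrix :: "complex ^ 'n::finite ^ 'm::finite \<Rightarrow> complex ^ 'm ^ 'n"
  where "adjoint_matrix M = transpose (mcnj M)"

lemma inner_eq_cdot: "x \<bullet> y = Re (cdot x (vcnj y))"
  by (simp add: inner_vec_def cdot_def inner_complex_def)

lemma inner_adjoint_matrix: "(M *v x) \<bullet> y = x \<bullet> (adjoint_matrix M *v y)"
  for M :: "complex ^ 'n::finite ^ 'm::finite"
  by (simp add: inner_eq_cdot adjoint_matrix_def cdot_matrix)

lemma inner_adjoint_matrix_mult: "(A ** X) \<bullet> Y = X \<bullet> (adjoint_matrix A ** Y)"
  for A :: "complex ^ 'n::finite ^ 'm::finite" and X :: "complex ^ 'k::finite ^ 'n"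
proof -
  have col: "M \<bullet> N = (\<Sum>j\<in>UNIV. column j M \<bullet> column j N)" for M N :: "complex ^ 'a::finite ^ 'b::finite"
    unfolding inner_vec_def column_def vec_lambda_beta by (rule sum.swap)
  have "column j (M ** N) = M *v column j N" for j and M :: "complex ^ 'c::finite ^ 'd::finite" and N :: "complex ^ 'e::finite ^ 'c"
    by (simp add: column_def matrix_matrix_mult_def matrix_vector_mult_def vec_eq_iff)
  note column_mult = this
  show ?thesis
    by (simp add: col column_mult inner_adjoint_matrix)
qed

definition positive_hermitian :: "complex ^ 'n::finite ^ 'n \<Rightarrow> bool"
  where "positive_hermitian p \<longleftrightarrow> adjoint_matrix p = p \<and> (\<forall>x. x \<noteq> 0 \<longrightarrow> x \<bullet> (p *v x) > 0)"

lemma linear_matrix_vector: "linear (\<lambda>x. M *v x)" for M :: "complex ^ 'n::finite ^ 'm::finite"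
  by (rule linearI) (simp_all add: vec_eq_iff matrix_vector_mult_def algebra_simps sum.distrib scaleR_sum_right)

lemma matrix_eq_on_span:
  fixes M N :: "complex ^ 'n::finite ^ 'm::finite"
  assumes "span B = UNIV" "\<And>b. b \<in> B \<Longrightarrow> M *v b = N *v b"
  shows "M = N"
  by (rule matrix_eqI, rule linear_eq_on_span[OF linear_matrix_vector linear_matrix_vector, where B = B])
    (use assms in auto)

text \<open>The span is the real one, so the basis has twice the complex dimension. Hermitian
  symmetry becomes self-adjointness for the real inner product.\<close>

lemma hermitian_eigenbasis:
  fixes p :: "complex ^ 'n::finite ^ 'n"
  assumes p: "adjoint_matrix p = p"
  obtains B l where "finite B" "pairwise orthogonal B" "\<And>b. b \<in> B \<Longrightarrow> norm b = 1" "span B = UNIV"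
    "\<And>b. b \<in> B \<Longrightarrow> p *v b = l b *\<^sub>R b"
  by (rule selfadjoint_eigenbasis[OF linear_matrix_vector, of p]) (use inner_adjoint_matrix[of p] p in auto)

lemma positive_hermitianI:
  fixes p :: "complex ^ 'n::finite ^ 'n"
  assumes p: "adjoint_matrix p = p" and pos: "\<And>x l. x \<noteq> 0 \<Longrightarrow> p *v x = l *\<^sub>R x \<Longrightarrow> l > 0"
  shows "positive_hermitian p"
  unfolding positive_hermitian_def
proof (intro conjI allI impI p)
  fix x :: "complex ^ 'n" assume "x \<noteq> 0"
  obtain B l where B: "finite B" "pairwise orthogonal B" "\<And>b. b \<in> B \<Longrightarrow> norm b = 1" "span B = UNIV"
    "\<And>b. b \<in> B \<Longrightarrow> p *v b = l b *\<^sub>R b"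
    using hermitian_eigenbasis[OF p] by metis
  have l: "l b > 0" if "b \<in> B" for b
    using B(3,5)[OF that] by (intro pos[of b]) auto
  note ex = orthonormal_expansion[OF B(1-4), of x]
  have "p *v x = p *v (\<Sum>b\<in>B. (x \<bullet> b) *\<^sub>R b)"
    by (simp only: ex[symmetric])
  also have "\<dots> = (\<Sum>b\<in>B. (x \<bullet> b) *\<^sub>R (p *v b))"
    by (simp add: linear_sum[OF linear_matrix_vector] linear_cmul[OF linear_matrix_vector])
  also have "\<dots> = (\<Sum>b\<in>B. (l b * (x \<bullet> b)) *\<^sub>R b)"
    using B(5) by (intro sum.cong) (auto simp: mult.commute)
  finally have eq: "x \<bullet> (p *v x) = (\<Sum>b\<in>B. l b * (x \<bullet> b)\<^sup>2)"
    by (simp add: inner_sum_right power2_eq_square mult_ac)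
  obtain b where "b \<in> B" "x \<bullet> b \<noteq> 0"
    using ex \<open>x \<noteq> 0\<close> by (metis (no_types, lifting) scaleR_eq_0_iff sum.neutral)
  then show "x \<bullet> (p *v x) > 0"
    unfolding eq using l B(1)
    by (intro sum_pos2[of _ b]) (auto intro!: mult_pos_pos mult_nonneg_nonneg less_imp_le[OF l])
qed

lemma positive_hermitian_eigenvalue:
  assumes "positive_hermitian p" "x \<noteq> 0" "p *v x = l *\<^sub>R x"
  shows "l > 0"
proof -
  have "l * (x \<bullet> x) > 0"
    using assms by (metis inner_scaleR_right positive_hermitian_def)
  then show ?thesis
    using zero_less_mult_pos2[of l "x \<bullet> x"] assms(2) by simp
qed

text \<open>The last clause speaks about all eigenvectors of \<open>p\<close>, not about one basis.
  It is the means by which algebraic identities satisfied by \<open>p\<close> pass to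
  \<open>r\<close>.\<close>

definition square_root_of :: "complex ^ 'n::finite ^ 'n \<Rightarrow> complex ^ 'n ^ 'n \<Rightarrow> bool"
  where "square_root_of p r \<longleftrightarrow> positive_hermitian r \<and> r ** r = p \<and>
    (\<forall>x l. p *v x = l *\<^sub>R x \<longrightarrow> r *v x = sqrt l *\<^sub>R x)"

lemma square_root_exists:
  fixes p :: "complex ^ 'n::finite ^ 'n"
  assumes p: "positive_hermitian p"
  obtains r where "square_root_of p r"
proof -
  have herm: "adjoint_matrix p = p"
    using p by (simp add: positive_hermitian_def)
  obtain B l where B: "finite B" "pairwise orthogonal B" "\<And>b. b \<in> B \<Longrightarrow> norm b = 1" "span B = UNIV"
    "\<And>b. b \<in> B \<Longrightarrow> p *v b = l b *\<^sub>R b"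
    using hermitian_eigenbasis[OF herm] by metis
  have l: "l b > 0" if "b \<in> B" for b
    using B(3,5)[OF that] by (intro positive_hermitian_eigenvalue[OF p, of b]) auto
  define R where "R = (\<lambda>x. \<Sum>b\<in>B. (sqrt (l b) * (x \<bullet> b)) *\<^sub>R b)"
  have linR: "linear R"
    unfolding R_def
    by (rule linearI) (simp_all add: inner_add_left distrib_left scaleR_add_left sum.distrib scaleR_sum_right mult_ac)
  \<comment> \<open>An eigenvector for \<open>m\<close> is orthogonal to each \<open>b\<close> with
    another eigenvalue, so only terms with \<open>l b = m\<close> contribute.\<close>
  have eig: "R x = sqrt m *\<^sub>R x" if x: "p *v x = m *\<^sub>R x" for x m
  proof -
    have "sqrt (l b) * (x \<bullet> b) = sqrt m * (x \<bullet> b)" if "b \<in> B" for b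
    proof -
      have "(p *v x) \<bullet> b = x \<bullet> (p *v b)"
        using inner_adjoint_matrix[of p] herm by simp
      then have "m * (x \<bullet> b) = l b * (x \<bullet> b)"
        using B(5)[OF that] x by simp
      then show ?thesis
        by auto
    qed
    then have "R x = sqrt m *\<^sub>R (\<Sum>b\<in>B. (x \<bullet> b) *\<^sub>R b)"
      unfolding R_def scaleR_sum_right by (intro sum.cong) auto
    then show ?thesis
      using orthonormal_expansion[OF B(1-4), of x] by simp
  qed
  \<comment> \<open>\<open>B\<close> spans over the real numbers, so complex linearity needs its own
    argument: \<open>c *s b\<close> is again an eigenvector of \<open>p\<close> for the eigenvalue
    \<open>l b\<close>, although usually not in \<open>B\<close>.\<close>
  have Rc: "R (c *s x) = c *s R x" for c x
  proof -
    have 1: "linear (\<lambda>x. R (c *s x))"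
      by (rule linear_compose[OF _ linR, unfolded o_def]) (rule linearI; simp add: vec_eq_iff algebra_simps)
    have 2: "linear (\<lambda>x. c *s R x)"
      by (rule linear_compose[OF linR, unfolded o_def]) (rule linearI; simp add: vec_eq_iff algebra_simps)
    have "R (c *s b) = c *s R b" if "b \<in> B" for b
    proof -
      have "p *v (c *s b) = l b *\<^sub>R (c *s b)"
        by (simp add: vector_scalar_commute B(5)[OF that]) (simp add: vec_eq_iff)
      then have "R (c *s b) = sqrt (l b) *\<^sub>R (c *s b)"
        by (rule eig)
      also have "\<dots> = c *s R b"
        using eig[OF B(5)[OF that]] by (simp add: vec_eq_iff)
      finally show ?thesis .
    qed
    then show ?thesis
      using linear_eq_on_span[OF 1 2, of B x] B(4) by auto
  qed
  define r where "r = matrix R"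
  have "Vector_Spaces.linear (*s) (*s) R"
    by (intro Vector_Spaces.linear.intro vec.vector_space_axioms module_hom.intro module_hom_axioms.intro vec.module_axioms)
      (use linR Rc in \<open>auto simp: linear_add\<close>)
  then have r: "r *v x = R x" for x
    by (simp add: r_def)
  have adj: "adjoint_matrix r = r"
  proof (rule matrix_eqI)
    fix y
    have "x \<bullet> (adjoint_matrix r *v y) = x \<bullet> (r *v y)" for x
      unfolding inner_adjoint_matrix[symmetric] r R_def
      by (simp add: inner_sum_left inner_sum_right mult_ac inner_commute)
    then show "adjoint_matrix r *v y = r *v y"
      using vector_eq_rdot by (metis inner_commute)
  qed
  have rb: "r *v b = sqrt (l b) *\<^sub>R b" if "b \<in> B" for b
    using eig[OF B(5)[OF that]] by (simp add: r)
  have "r ** r = p"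
    by (rule matrix_eq_on_span[OF B(4)])
      (use rb B(5) l in \<open>simp add: matrix_vector_mul_assoc[symmetric] linear_cmul[OF linear_matrix_vector] less_imp_le\<close>)
  moreover have "positive_hermitian r"
    unfolding positive_hermitian_def
  proof (intro conjI allI impI adj)
    fix x :: "complex ^ 'n" assume "x \<noteq> 0"
    have eq: "x \<bullet> (r *v x) = (\<Sum>b\<in>B. sqrt (l b) * (x \<bullet> b)\<^sup>2)"
      by (simp add: r R_def inner_sum_right power2_eq_square mult_ac)
    obtain b where "b \<in> B" "x \<bullet> b \<noteq> 0"
      using orthonormal_expansion[OF B(1-4), of x] \<open>x \<noteq> 0\<close> by (metis (no_types, lifting) scaleR_eq_0_iff sum.neutral)
    then show "x \<bullet> (r *v x) > 0"
      unfolding eq using l B(1)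
      by (intro sum_pos2[of _ b]) (auto intro!: mult_pos_pos mult_nonneg_nonneg less_imp_le[OF l])
  qed
  ultimately show ?thesis
    using that[of r] eig unfolding square_root_of_def r by blast
qed

section \<open>Maximal compact subgroups\<close>

lemma bilinear_eq_on_basis:
  assumes "bilinear f" "bilinear g" "span B = UNIV" "span C = UNIV"
    "\<And>x y. x \<in> B \<Longrightarrow> y \<in> C \<Longrightarrow> f x y = g x y"
  shows "f x y = g x y"
  using bilinear_eq[of f g UNIV B UNIV C x y] assms by simp

text \<open>Orthogonality of \<open>p\<close> on two eigenvectors says that either the bilinear form
  vanishes on them or their eigenvalues have product one. In the latter case the square roots have
  product one as well.\<close>

lemma square_root_orthogonal:
  fixes p r :: "complex ^ 'n::finite ^ 'n"
  assumes p: "transpose p ** p = mat 1" "positive_hermitian p" and r: "square_root_of p r"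
  shows "transpose r ** r = mat 1"
proof -
  have herm: "adjoint_matrix p = p"
    using p by (simp add: positive_hermitian_def)
  obtain B l where B: "finite B" "pairwise orthogonal B" "\<And>b. b \<in> B \<Longrightarrow> norm b = 1" "span B = UNIV"
    "\<And>b. b \<in> B \<Longrightarrow> p *v b = l b *\<^sub>R b"
    using hermitian_eigenbasis[OF herm] by metis
  have bil: "bilinear (\<lambda>x y. cdot (r *v x) (r *v y))" "bilinear (\<lambda>x y::complex ^ 'n. cdot x y)"
    by (auto simp: bilinear_def linear_iff linear_add[OF linear_matrix_vector] linear_cmul[OF linear_matrix_vector]
        cdot_def scaleR_sum_right distrib_left distrib_right sum.distrib)
  have sc: "cdot (a *\<^sub>R x) (b *\<^sub>R y) = of_real (a * b) * cdot x y" for a b and x y :: "complex ^ 'n"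
    by (simp add: cdot_def sum_distrib_left scaleR_conv_of_real[where 'a = complex] mult_ac)
  have "cdot (r *v x) (r *v y) = cdot x y" for x y
  proof (rule bilinear_eq_on_basis[OF bil B(4) B(4)])
    fix b c assume b: "b \<in> B" and c: "c \<in> B"
    have "cdot (p *v b) (p *v c) = cdot b c"
      using cdot_orthogonal[OF p(1)] by simp
    then have "of_real (l b * l c) * cdot b c = cdot b c"
      by (simp add: B(5) b c sc del: of_real_mult)
    then have "l b * l c = 1 \<or> cdot b c = 0"
      by (metis mult_cancel_right1 of_real_eq_1_iff)
    then have "of_real (sqrt (l b) * sqrt (l c)) * cdot b c = cdot b c"
      by (auto simp flip: real_sqrt_mult simp del: of_real_mult)
    moreover have "r *v b = sqrt (l b) *\<^sub>R b" "r *v c = sqrt (l c) *\<^sub>R c"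
      using r B(5) b c by (auto simp: square_root_of_def)
    ultimately show "cdot (r *v b) (r *v c) = cdot b c"
      by (simp add: sc del: of_real_mult)
  qed
  then show ?thesis
    by (intro matrix_eqI cdot_eqI)
      (metis cdot_matrix cdot_sym matrix_vector_mul_assoc matrix_vector_mul_lid)
qed

text \<open>For the determinant the root is taken once more: \<open>r\<close> is itself the square
  of an orthogonal matrix.\<close>

lemma square_root_SO8C:
  assumes p: "p \<in> SO8C" "positive_hermitian p" and r: "square_root_of p r"
  shows "r \<in> SO8C"
proof -
  have orth: "transpose r ** r = mat 1"
    using square_root_orthogonal[OF _ p(2) r] p(1) by (simp add: SO8C_def)
  have "positive_hermitian r"
    using r by (simp add: square_root_of_def)
  then obtain c where c: "square_root_of r c"
    using square_root_exists by blast
  then have "c ** c = r"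
    by (simp add: square_root_of_def)
  then have "det r = (det c)\<^sup>2"
    by (metis det_mul power2_eq_square)
  also have "\<dots> = 1"
    by (rule det_square_orthogonal, rule square_root_orthogonal[OF orth _ c]) fact
  finally show ?thesis
    using orth by (simp add: SO8C_def)
qed

lemma square_root_fix:
  assumes "square_root_of p r" "p *v x = x"
  shows "r *v x = x"
proof -
  have "p *v x = 1 *\<^sub>R x"
    using assms(2) by simp
  then have "r *v x = sqrt 1 *\<^sub>R x"
    using assms(1) unfolding square_root_of_def by blast
  then show ?thesis
    by simp
qed

lemma square_root_SO7C:
  assumes "p \<in> SO7C" "positive_hermitian p" "square_root_of p r"
  shows "r \<in> SO7C"
  using assms square_root_SO8C square_root_fix by (auto simp: SO7C_def)

lemma vector_rep_transpose:
  assumes g: "g \<in> Spin7C"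
  shows "vector_rep (transpose g) = transpose (vector_rep g)"
proof -
  have g8: "g \<in> SO8C" "vector_rep g \<in> SO8C"
    using g by (auto simp: Spin7C_iff spin_lift_def SO7C_def SO8C_def)
  have "mat 1 \<in> G2C"
    by (simp add: G2C_def SO8C_def)
  then have "vector_rep (transpose g) ** vector_rep g = mat 1"
    using vector_rep_hom[OF Spin7C_transpose[OF g] g] vector_rep_G2C[of "mat 1"] SO8C_inverse(1)[OF g8(1)]
    by simp
  then have "vector_rep (transpose g) ** (vector_rep g ** transpose (vector_rep g)) = transpose (vector_rep g)"
    by (simp add: matrix_mul_assoc)
  then show ?thesis
    by (simp add: SO8C_inverse(2)[OF g8(2)])
qed

text \<open>The partner \<open>p0\<close> is positive too and has a root \<open>r0\<close>. By the
  spin relation \<open>p\<close> acts on a product of eigenvectors of \<open>p0\<close> and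
  \<open>p\<close> by the product of the eigenvalues. Since \<open>sqrt\<close> is multiplicative,
  \<open>r0\<close> and \<open>r\<close> satisfy the relation on eigenbases, hence
  everywhere.\<close>

lemma square_root_Spin7C:
  assumes p: "p \<in> Spin7C" "positive_hermitian p" and r: "square_root_of p r"
  shows "r \<in> Spin7C"
proof -
  define p0 where "p0 = vector_rep p"
  have sl: "spin_lift p p0 1"
    using p(1) by (simp add: Spin7C_iff p0_def)
  then have p8: "p \<in> SO8C" and p07: "p0 \<in> SO7C" and hom: "\<And>x y. (p0 *v x) \<odot> (p *v y) = p *v (x \<odot> y)"
    by (auto simp: spin_lift_def SO8C_def)
  have herm: "adjoint_matrix p = p"
    using p(2) by (simp add: positive_hermitian_def)
  then have "mcnj p = transpose p"
    by (metis adjoint_matrix_def transpose_transpose)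
  then have "mcnj p0 = transpose p0"
    unfolding p0_def by (metis p(1) vector_rep_mcnj vector_rep_transpose)
  then have herm0: "adjoint_matrix p0 = p0"
    by (simp add: adjoint_matrix_def)
  obtain B l where B: "finite B" "pairwise orthogonal B" "\<And>b. b \<in> B \<Longrightarrow> norm b = 1" "span B = UNIV"
    "\<And>b. b \<in> B \<Longrightarrow> p *v b = l b *\<^sub>R b"
    using hermitian_eigenbasis[OF herm] by metis
  obtain C m where C: "finite C" "pairwise orthogonal C" "\<And>b. b \<in> C \<Longrightarrow> norm b = 1" "span C = UNIV"
    "\<And>b. b \<in> C \<Longrightarrow> p0 *v b = m b *\<^sub>R b"
    using hermitian_eigenbasis[OF herm0] by metis
  have l: "l b > 0" if "b \<in> B" for b
    using B(3,5)[OF that] by (intro positive_hermitian_eigenvalue[OF p(2), of b]) auto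
  have scale: "(a *\<^sub>R x) \<odot> (b *\<^sub>R y) = (a * b) *\<^sub>R (x \<odot> y)" for a b x y
    by (simp add: cayley_mult_def vec_eq_iff scaleR_sum_right mult_ac)
  have lin: "linear (\<lambda>y. x \<odot> y)" "linear (\<lambda>x. x \<odot> y)" for x y
    using scale[of 1 x] scale[of _ _ 1 y] by (auto simp: linear_iff cayley_linear)
  \<comment> \<open>\<open>B\<close> spans and \<open>x\<close> times the unit is \<open>x\<close>,
    so some product \<open>x \<odot> b\<close> is nonzero. It is an eigenvector of \<open>p\<close>
    for \<open>k * l b\<close>, and \<open>l b\<close> is positive.\<close>
  have pos0: "positive_hermitian p0"
  proof (rule positive_hermitianI[OF herm0])
    fix x k assume x: "x \<noteq> 0" "p0 *v x = k *\<^sub>R x"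
    have "\<exists>b\<in>B. x \<odot> b \<noteq> 0"
    proof (rule ccontr)
      assume "\<not> (\<exists>b\<in>B. x \<odot> b \<noteq> 0)"
      then have "x \<odot> axis 0 1 = 0"
        using linear_eq_on_span[OF lin(1)[of x] linear_zero, of B "axis 0 1"] B(4) by auto
      with x(1) show False
        by simp
    qed
    then obtain b where b: "b \<in> B" "x \<odot> b \<noteq> 0"
      by blast
    have "p *v (x \<odot> b) = (k * l b) *\<^sub>R (x \<odot> b)"
      by (simp add: hom[symmetric] x(2) B(5)[OF b(1)] scale)
    then have "k * l b > 0"
      by (rule positive_hermitian_eigenvalue[OF p(2) b(2)])
    then show "k > 0"
      using l[OF b(1)] zero_less_mult_pos2 by blast
  qed
  then obtain r0 where r0: "square_root_of p0 r0"
    using square_root_exists by blast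
  have "(r0 *v x) \<odot> (r *v y) = r *v (x \<odot> y)" for x y
  proof (rule bilinear_eq_on_basis[OF _ _ C(4) B(4), of "\<lambda>x y. (r0 *v x) \<odot> (r *v y)" "\<lambda>x y. r *v (x \<odot> y)"])
    show "bilinear (\<lambda>x y. (r0 *v x) \<odot> (r *v y))" "bilinear (\<lambda>x y. r *v (x \<odot> y))"
      unfolding bilinear_def
      using linear_compose[OF linear_matrix_vector lin(1), unfolded o_def]
        linear_compose[OF linear_matrix_vector lin(2), unfolded o_def]
        linear_compose[OF lin(1) linear_matrix_vector, unfolded o_def]
        linear_compose[OF lin(2) linear_matrix_vector, unfolded o_def]
      by blast+
    fix c b assume c: "c \<in> C" and b: "b \<in> B"
    have "p *v (c \<odot> b) = (m c * l b) *\<^sub>R (c \<odot> b)"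
      by (simp add: hom[symmetric] C(5)[OF c] B(5)[OF b] scale)
    then have "r *v (c \<odot> b) = sqrt (m c * l b) *\<^sub>R (c \<odot> b)"
      using r by (auto simp: square_root_of_def)
    moreover have "r *v b = sqrt (l b) *\<^sub>R b" "r0 *v c = sqrt (m c) *\<^sub>R c"
      using r r0 B(5)[OF b] C(5)[OF c] by (auto simp: square_root_of_def)
    ultimately show "(r0 *v c) \<odot> (r *v b) = r *v (c \<odot> b)"
      by (simp add: scale real_sqrt_mult)
  qed
  then show ?thesis
    using square_root_SO8C[OF p8 p(2) r] square_root_SO7C[OF p07 pos0 r0] by (auto simp: Spin7C_def)
qed

lemma square_root_G2C:
  assumes "p \<in> G2C" "positive_hermitian p" "square_root_of p r"
  shows "r \<in> G2C"
  using assms square_root_Spin7C[of p r] square_root_fix[of p r "axis 0 1"] G2C_iff[of p] G2C_iff[of r]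
  by blast

section \<open>Cartan's fixed point argument\<close>

lemma bounded_bilinear_matrix_mult:
  "bounded_bilinear ((**) :: complex ^ 'n::finite ^ 'm::finite \<Rightarrow> complex ^ 'k::finite ^ 'n \<Rightarrow> complex ^ 'k ^ 'm)"
  unfolding bilinear_conv_bounded_bilinear[symmetric] bilinear_def linear_iff
  by (auto simp: vec_eq_iff matrix_matrix_mult_def algebra_simps sum.distrib scaleR_sum_right)

text \<open>Closure under positive square roots stands in for the exponential map: it keeps
  midpoints of geodesics inside the group.\<close>

locale polar_group = orthogonal_group G
  for G :: "(complex ^ 'm::finite ^ 'm) set" +
  assumes square_root: "p \<in> G \<Longrightarrow> positive_hermitian p \<Longrightarrow> square_root_of p r \<Longrightarrow> r \<in> G"
begin

text \<open>The idea of Cartan's fixed point theorem: the largest Hilbert--Schmidt norm over a coset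
  \<open>g K\<close> is strictly convex along geodesics, so its minimizer is unique up to real matrices.\<close>

lemma strict_convexity:
  assumes g: "g \<in> G" "h \<in> G"
  obtains c r where "c \<in> G" "positive_hermitian r" "r ** r = adjoint_matrix h ** h"
    "\<And>X :: complex ^ 'm ^ 'm. (norm (c ** X))\<^sup>2 =
      ((norm X)\<^sup>2 + (norm (h ** X))\<^sup>2 - (norm (X - r ** X))\<^sup>2) / 2"
proof -
  have adj_mult: "adjoint_matrix (A ** B) = adjoint_matrix B ** adjoint_matrix A" for A B :: "complex ^ 'm ^ 'm"
    by (simp add: adjoint_matrix_def matrix_transpose_mul)
  have adj_adj: "adjoint_matrix (adjoint_matrix A) = A" for A :: "complex ^ 'm ^ 'm"
    by (simp add: adjoint_matrix_def)
  define p where "p = adjoint_matrix h ** h"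
  have pG: "p \<in> G"
    unfolding p_def adjoint_matrix_def using g(2) by (intro mult transp conj)
  have "positive_hermitian p"
    unfolding positive_hermitian_def
  proof (intro conjI allI impI)
    show "adjoint_matrix p = p"
      by (simp add: p_def adj_mult adj_adj)
    fix x :: "complex ^ 'm" assume "x \<noteq> 0"
    have "x \<bullet> (p *v x) = (h *v x) \<bullet> (h *v x)"
      by (simp add: p_def inner_adjoint_matrix matrix_vector_mul_assoc[symmetric])
    moreover have "h *v x \<noteq> 0"
      using \<open>x \<noteq> 0\<close> orthogonal[OF g(2)] by (metis matrix_vector_mul_assoc matrix_vector_mul_lid matrix_vector_mult_0_right)
    ultimately show "x \<bullet> (p *v x) > 0"
      by simp
  qed
  then obtain r where r: "square_root_of p r"
    using square_root_exists by blast
  then have rp: "positive_hermitian r" "r ** r = p" and rG: "r \<in> G"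
    using square_root[OF pG \<open>positive_hermitian p\<close>] by (auto simp: square_root_of_def)
  \<comment> \<open>\<open>c\<close> is the fourth root of \<open>p\<close>. Then the squared norm
    of \<open>c ** X\<close> is \<open>X \<bullet> (r ** X)\<close>, the mixed term in the
    polarization identity for \<open>X\<close> and \<open>r ** X\<close>.\<close>
  then obtain c where c: "square_root_of r c"
    using square_root_exists by blast
  have cG: "c \<in> G" and cc: "adjoint_matrix c ** c = r" and rr: "adjoint_matrix r = r"
    using square_root[OF rG rp(1) c] c rp(1) by (auto simp: square_root_of_def positive_hermitian_def)
  have "(norm (c ** X))\<^sup>2 = ((norm X)\<^sup>2 + (norm (h ** X))\<^sup>2 - (norm (X - r ** X))\<^sup>2) / 2" for X :: "complex ^ 'm ^ 'm"
  proof -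
    have "(c ** X) \<bullet> (c ** X) = X \<bullet> (r ** X)"
      by (simp add: inner_adjoint_matrix_mult matrix_mul_assoc cc)
    moreover have "(h ** X) \<bullet> (h ** X) = (r ** X) \<bullet> (r ** X)"
      by (simp add: inner_adjoint_matrix_mult matrix_mul_assoc rr rp(2) p_def)
    ultimately show ?thesis
      by (simp add: power2_norm_eq_inner inner_diff_left inner_diff_right inner_commute)
  qed
  then show ?thesis
    using that[OF cG rp(1)] rp(2) p_def by blast
qed

text \<open>Right translation by an element of \<open>K\<close> does not increase \<open>f\<close>,
  so together with \<open>g\<close> every \<open>g ** k\<close> is a minimizer. Uniqueness up to
  real left factors then makes \<open>g ** k ** transpose g\<close> real.\<close>

lemma compact_subgroup_conjugate_real:
  assumes K: "K \<subseteq> G" "compact K" "mat 1 \<in> K" and K_mult: "\<And>k l. k \<in> K \<Longrightarrow> l \<in> K \<Longrightarrow> k ** l \<in> K"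
  obtains a where "a \<in> G" "\<And>k. k \<in> K \<Longrightarrow> mcnj (a ** k ** transpose a) = a ** k ** transpose a"
proof -
  define f where "f = (\<lambda>g::complex ^ 'm ^ 'm. Sup ((\<lambda>k. norm (g ** k)) ` K))"
  have cont: "continuous_on A (\<lambda>k. norm (g ** k))" for A and g :: "complex ^ 'm ^ 'm"
    unfolding matrix_matrix_mult_def by (intro continuous_intros)
  have bdd: "bdd_above ((\<lambda>k. norm (g ** k)) ` K)" for g :: "complex ^ 'm ^ 'm"
    by (rule bounded_imp_bdd_above[OF compact_imp_bounded[OF compact_continuous_image[OF cont K(2)]]])
  have upper: "norm (g ** k) \<le> f g" if "k \<in> K" for g k
    unfolding f_def using that bdd by (intro cSUP_upper)
  have attained: "\<exists>k\<in>K. f g = norm (g ** k)" for g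
  proof -
    obtain k where k: "k \<in> K" "\<And>l. l \<in> K \<Longrightarrow> norm (g ** l) \<le> norm (g ** k)"
      using continuous_attains_sup[OF K(2) _ cont, of g] K(3) by blast
    then have "f g \<le> norm (g ** k)"
      unfolding f_def using K(3) by (intro cSUP_least) auto
    with upper[OF k(1)] k(1) show ?thesis
      by (metis order_antisym)
  qed
  obtain R where R: "\<And>k. k \<in> K \<Longrightarrow> norm k \<le> R"
    using K(2) compact_imp_bounded bounded_iff by metis
  obtain C where C: "C > 0" "\<And>(A :: complex ^ 'm ^ 'm) (B :: complex ^ 'm ^ 'm). norm (A ** B) \<le> norm A * norm B * C"
    using bounded_bilinear.pos_bounded[OF bounded_bilinear_matrix_mult] by blast
  have lip: "f g \<le> f g' + norm (g - g') * (R * C)" for g g'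
  proof -
    obtain k where k: "k \<in> K" "f g = norm (g ** k)"
      using attained by blast
    have "g ** k = g' ** k + (g - g') ** k"
      by (simp add: bounded_bilinear.diff_left[OF bounded_bilinear_matrix_mult])
    then have "norm (g ** k) \<le> norm (g' ** k) + norm ((g - g') ** k)"
      by (metis norm_triangle_ineq)
    also have "norm ((g - g') ** k) \<le> norm (g - g') * norm k * C"
      by (rule C(2))
    also have "\<dots> \<le> norm (g - g') * R * C"
      using R[OF k(1)] C(1) by (intro mult_right_mono mult_left_mono) auto
    finally show ?thesis
      using upper[OF k(1), of g'] k(2) by (simp add: mult.assoc)
  qed
  have "R * C \<ge> 0"
    using R[OF K(3)] C(1) by (metis dual_order.trans less_imp_le norm_ge_zero zero_le_mult_iff)
  then have "(R * C)-lipschitz_on UNIV f"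
  proof (intro lipschitz_onI)
    show "dist (f x) (f y) \<le> R * C * dist x y" for x y
      using lip[of x y] lip[of y x] by (simp add: dist_norm norm_minus_commute abs_le_iff mult.commute)
  qed auto
  then have contf: "continuous_on A f" for A
    using lipschitz_on_continuous_on continuous_on_subset by blast
  \<comment> \<open>\<open>f\<close> dominates the norm, so a value below \<open>f (mat 1)\<close>
    is attained only inside a compact ball.\<close>
  define M where "M = G \<inter> cball 0 (f (mat 1))"
  have norm_le: "norm g \<le> f g" for g
    using upper[OF K(3), of g] by simp
  have "compact M"
    unfolding M_def using closed by (simp add: closed_Int_compact)
  moreover have "mat 1 \<in> M"
    using one norm_le[of "mat 1"] by (simp add: M_def)
  ultimately obtain g where g: "g \<in> M" "\<And>h. h \<in> M \<Longrightarrow> f g \<le> f h"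
    using continuous_attains_inf[of M f] contf by blast
  have gG: "g \<in> G"
    using g(1) by (simp add: M_def)
  have min: "f g \<le> f h" if "h \<in> G" for h
  proof (cases "h \<in> M")
    case False
    then have "f (mat 1) \<le> f h"
      using norm_le[of h] that by (simp add: M_def)
    then show ?thesis
      using g(2)[OF \<open>mat 1 \<in> M\<close>] by simp
  qed (use g in blast)
  \<comment> \<open>The midpoint \<open>c ** g\<close> between \<open>g\<close> and
    \<open>h ** g\<close> is tested at its maximizing \<open>k\<close>. Minimality of
    \<open>g\<close> squeezes the convexity defect to zero, so \<open>r ** X = X\<close> and
    \<open>r = mat 1\<close>. Thus \<open>h\<close> is unitary, and being orthogonal as well it is
    real.\<close>
  have real: "mcnj h = h" if h: "h \<in> G" "f (h ** g) \<le> f g" for h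
  proof -
    obtain c r where c: "c \<in> G" "positive_hermitian r" "r ** r = adjoint_matrix h ** h"
      "\<And>X :: complex ^ 'm ^ 'm. (norm (c ** X))\<^sup>2 = ((norm X)\<^sup>2 + (norm (h ** X))\<^sup>2 - (norm (X - r ** X))\<^sup>2) / 2"
      using strict_convexity[OF gG h(1)] by metis
    obtain k where k: "k \<in> K" "f (c ** g) = norm ((c ** g) ** k)"
      using attained by blast
    define X where "X = g ** k"
    have XG: "X \<in> G"
      using gG k K(1) by (auto simp: X_def mult)
    have nonneg: "f g \<ge> 0"
      using norm_le[of g] norm_ge_zero order_trans by blast
    have "f g \<le> norm (c ** X)"
      using min[OF mult[OF c(1) gG]] k by (simp add: X_def matrix_mul_assoc)
    then have "(f g)\<^sup>2 \<le> (norm (c ** X))\<^sup>2"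
      using nonneg by (intro power_mono)
    moreover have "(norm X)\<^sup>2 \<le> (f g)\<^sup>2"
      using upper[OF k(1), of g] by (intro power_mono) (auto simp: X_def)
    moreover have "norm (h ** X) \<le> f g"
      using upper[OF k(1), of "h ** g"] h(2) by (simp add: X_def matrix_mul_assoc)
    then have "(norm (h ** X))\<^sup>2 \<le> (f g)\<^sup>2"
      by (intro power_mono) auto
    moreover have "(norm (X - r ** X))\<^sup>2 = (norm X)\<^sup>2 + (norm (h ** X))\<^sup>2 - 2 * (norm (c ** X))\<^sup>2"
      using c(4)[of X] by (simp add: field_simps)
    ultimately have "(norm (X - r ** X))\<^sup>2 \<le> 0"
      by linarith
    then have "X = r ** X"
      by simp
    then have "r = mat 1"
      using cancel_right(2)[OF XG, of "mat 1"] cancel_right(2)[OF XG, of r] by simp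
    then have "adjoint_matrix h ** h = mat 1"
      using c(3) by simp
    then have "adjoint_matrix h ** (h ** transpose h) = transpose h"
      by (simp add: matrix_mul_assoc)
    then have "adjoint_matrix h = transpose h"
      by (simp add: orthogonal'[OF h(1)])
    then show ?thesis
      by (metis adjoint_matrix_def transpose_transpose)
  qed
  have "mcnj (g ** k ** transpose g) = g ** k ** transpose g" if k: "k \<in> K" for k
  proof (rule real)
    show "g ** k ** transpose g \<in> G"
      using gG k K(1) by (auto intro: mult transp)
    have "f (g ** k ** transpose g ** g) = f (g ** k)"
      by (simp add: cancel_right[OF gG])
    also have "f (g ** k) \<le> f g"
    proof -
      obtain l where l: "l \<in> K" "f (g ** k) = norm ((g ** k) ** l)"
        using attained by blast
      then show ?thesis
        using upper[OF K_mult[OF k l(1)], of g] by (simp add: matrix_mul_assoc)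
    qed
    finally show "f (g ** k ** transpose g ** g) \<le> f g" .
  qed
  then show ?thesis
    using that gG by blast
qed

end

section \<open>Strongly visible actions on coset spaces\<close>

context orthogonal_group
begin

lemma group: "group (matrix_group G)"
proof (rule group_matrix_group[OF one mult])
  show "\<exists>h\<in>G. h ** g = mat 1" if "g \<in> G" for g
    using that transp orthogonal by blast
qed

lemma inv_eq_transpose: "g \<in> G \<Longrightarrow> inv\<^bsub>matrix_group G\<^esub> g = transpose g"
  by (rule group.inv_equality[OF group]) (use transp orthogonal in \<open>auto simp: matrix_group_def\<close>)

lemma subgroup_iff:
  "subgroup K (matrix_group G) \<longleftrightarrow> K \<subseteq> G \<and> mat 1 \<in> K \<and> (\<forall>k\<in>K. \<forall>l\<in>K. k ** l \<in> K) \<and> (\<forall>k\<in>K. transpose k \<in> K)"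
proof
  assume K: "subgroup K (matrix_group G)"
  then have "K \<subseteq> G"
    using subgroup.subset[OF K] by (simp add: matrix_group_def)
  moreover have "transpose k \<in> K" if "k \<in> K" for k
    using subgroup.m_inv_closed[OF K that] inv_eq_transpose[of k] that \<open>K \<subseteq> G\<close> by auto
  ultimately show "K \<subseteq> G \<and> mat 1 \<in> K \<and> (\<forall>k\<in>K. \<forall>l\<in>K. k ** l \<in> K) \<and> (\<forall>k\<in>K. transpose k \<in> K)"
    using subgroup.one_closed[OF K] subgroup.m_closed[OF K] by (auto simp: matrix_group_def)
next
  assume K: "K \<subseteq> G \<and> mat 1 \<in> K \<and> (\<forall>k\<in>K. \<forall>l\<in>K. k ** l \<in> K) \<and> (\<forall>k\<in>K. transpose k \<in> K)"
  show "subgroup K (matrix_group G)"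
    by (rule subgroup.intro) (use K inv_eq_transpose in \<open>auto simp: matrix_group_def subset_iff\<close>)
qed

definition real_points :: "(complex ^ 'm ^ 'm) set"
  where "real_points = {g \<in> G. mcnj g = g}"

lemma real_points_group:
  "mat 1 \<in> real_points" "k \<in> real_points \<Longrightarrow> l \<in> real_points \<Longrightarrow> k ** l \<in> real_points"
  "k \<in> real_points \<Longrightarrow> transpose k \<in> real_points"
  by (auto simp: real_points_def one mult transp)

text \<open>Real orthogonal matrices are unitary, so all of them have the Hilbert--Schmidt norm of
  the identity.\<close>

lemma compact_real_points: "compact real_points"
proof -
  have "continuous_on UNIV (mcnj :: complex ^ 'm ^ 'm \<Rightarrow> complex ^ 'm ^ 'm)"
    using semidiff_mcnj[of "mat 1"] by (auto intro!: continuous_at_imp_continuous_on semidiff_continuous)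
  then have "closed {g :: complex ^ 'm ^ 'm. mcnj g = g}"
    by (intro closed_Collect_eq continuous_intros) auto
  then have "closed real_points"
    using closed by (auto simp: real_points_def Collect_conj_eq)
  moreover have "norm u \<le> norm (mat 1 :: complex ^ 'm ^ 'm)" if "u \<in> real_points" for u
  proof -
    have "adjoint_matrix u ** u = mat 1"
      using that orthogonal by (simp add: real_points_def adjoint_matrix_def)
    then have "u \<bullet> u = mat 1 \<bullet> (mat 1 :: complex ^ 'm ^ 'm)"
      using inner_adjoint_matrix_mult[of u "mat 1" u] by simp
    then show ?thesis
      by (simp add: norm_eq_sqrt_inner)
  qed
  then have "bounded real_points"
    unfolding bounded_iff by blast
  ultimately show ?thesis
    by (simp add: compact_eq_bounded_closed)
qed

end

context polar_group
begin

text \<open>A conjugate of the real points contains \<open>Gu\<close> and is itself a compact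
  subgroup, so maximality of \<open>Gu\<close> gives equality.\<close>

lemma maximal_compact_conjugate:
  assumes Gu: "maximal_compact_subgroup Gu G"
  obtains b where "b \<in> G" "Gu = (\<lambda>u. b ** u ** transpose b) ` real_points"
proof -
  have sub: "subgroup Gu (matrix_group G)" and "compact Gu"
    using Gu by (auto simp: maximal_compact_subgroup_def)
  then obtain a where a: "a \<in> G" "\<And>k. k \<in> Gu \<Longrightarrow> mcnj (a ** k ** transpose a) = a ** k ** transpose a"
    using compact_subgroup_conjugate_real[of Gu] unfolding subgroup_iff by metis
  define b where "b = transpose a"
  have b: "b \<in> G" "transpose b = a"
    using a(1) transp by (simp_all add: b_def)
  define L where "L = (\<lambda>u. b ** u ** transpose b) ` real_points"
  have mult_conj: "(b ** u ** transpose b) ** (b ** v ** transpose b) = b ** (u ** v) ** transpose b" for u v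
    by (simp add: matrix_mul_assoc[symmetric] cancel_left[OF b(1)])
  have "subgroup L (matrix_group G)"
    unfolding subgroup_iff
  proof (intro conjI ballI)
    show "L \<subseteq> G"
      using b(1) by (auto simp: L_def real_points_def intro!: mult transp)
    show "mat 1 \<in> L"
      unfolding L_def by (rule image_eqI[of _ _ "mat 1"]) (simp_all add: orthogonal'[OF b(1)] real_points_group)
    show "k ** l \<in> L" if "k \<in> L" "l \<in> L" for k l
      using that real_points_group(2) unfolding L_def by (auto simp: mult_conj)
    show "transpose k \<in> L" if "k \<in> L" for k
      using that real_points_group(3) unfolding L_def
      by (auto simp: matrix_transpose_mul matrix_mul_assoc)
  qed
  moreover have "continuous_on real_points (\<lambda>u. b ** u ** transpose b)"
    unfolding matrix_matrix_mult_def by (intro continuous_intros)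
  then have "compact L"
    unfolding L_def using compact_real_points by (rule compact_continuous_image)
  moreover have "Gu \<subseteq> L"
  proof
    fix k assume k: "k \<in> Gu"
    then have "k \<in> G"
      using sub by (auto simp: subgroup_iff)
    then have "a ** k ** transpose a \<in> real_points"
      using a k by (auto simp: real_points_def intro!: mult transp)
    moreover have "k = b ** (a ** k ** transpose a) ** transpose b"
      by (simp add: b_def matrix_mul_assoc orthogonal[OF a(1)] cancel_right(1)[OF a(1)])
    ultimately show "k \<in> L"
      unfolding L_def by blast
  qed
  ultimately have "L = Gu"
    using Gu by (auto simp: maximal_compact_subgroup_def)
  then show ?thesis
    using that b(1) unfolding L_def by blast
qed

end

section \<open>The action of subgroups on the quotient\<close>

context orthogonal_pair
begin

lemma left_translation_topspace:
  "a \<in> G \<Longrightarrow> x \<in> topspace D \<Longrightarrow> left_translation a x \<in> topspace D"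
  by (auto simp: topspace_D left_translation_coset G.mult)

lemma left_translation_mult: "x \<in> topspace D \<Longrightarrow> left_translation a (left_translation b x) = left_translation (a ** b) x"
  by (auto simp: topspace_D left_translation_coset matrix_mul_assoc)

lemma left_translation_one: "x \<in> topspace D \<Longrightarrow> left_translation (mat 1) x = x"
  by (auto simp: topspace_D left_translation_coset)

lemma group_action_D:
  assumes K: "subgroup K (matrix_group G)"
  shows "group_action (matrix_group K) (topspace D) (\<lambda>g. restrict (left_translation g) (topspace D))"
proof -
  note K' = K[unfolded G.subgroup_iff]
  have bij: "bij_betw (left_translation a) (topspace D) (topspace D)" if "a \<in> K" for a
  proof (rule bij_betw_byWitness[where f' = "left_translation (transpose a)"])
    show "\<forall>x\<in>topspace D. left_translation (transpose a) (left_translation a x) = x"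
      "\<forall>x\<in>topspace D. left_translation a (left_translation (transpose a) x) = x"
      using K' that G.orthogonal[of a] G.orthogonal'[of a] by (auto simp: left_translation_mult left_translation_one)
    show "left_translation a ` topspace D \<subseteq> topspace D" "left_translation (transpose a) ` topspace D \<subseteq> topspace D"
      using K' that left_translation_topspace by blast+
  qed
  have "group (matrix_group K)"
    by (rule group_matrix_group) (use K' G.orthogonal in blast)+
  moreover have "(\<lambda>g. restrict (left_translation g) (topspace D)) \<in> hom (matrix_group K) (BijGroup (topspace D))"
  proof -
    have Bij: "restrict (left_translation a) (topspace D) \<in> Bij (topspace D)" if "a \<in> K" for a
      using bij[OF that] bij_betw_cong[of "topspace D" "restrict (left_translation a) (topspace D)" "left_translation a"]
      by (auto simp: Bij_def)
    have "restrict (left_translation (a ** b)) (topspace D) =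
        compose (topspace D) (restrict (left_translation a) (topspace D)) (restrict (left_translation b) (topspace D))"
      if "a \<in> K" "b \<in> K" for a b
    proof
      fix x
      show "restrict (left_translation (a ** b)) (topspace D) x =
        compose (topspace D) (restrict (left_translation a) (topspace D)) (restrict (left_translation b) (topspace D)) x"
        using K' that left_translation_topspace[of b x] by (auto simp: compose_def left_translation_mult)
    qed
    with Bij show ?thesis
      by (intro homI) (simp_all add: BijGroup_def matrix_group_def)
  qed
  ultimately show ?thesis
    by (intro group_action.intro group_hom.intro group_hom_axioms.intro group_BijGroup)
qed

text \<open>The product of \<open>K\<close> with a quotient map is in general not a quotient map, so
  the topology of \<open>D\<close> alone does not decide continuity. Openness of the coset
  projection provides the product neighbourhoods.\<close>

lemma continuous_action:
  assumes "K \<subseteq> G"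
  shows "continuous_map (prod_topology (top_of_set K) D) D (\<lambda>(g, x). left_translation g x)"
proof -
  have "\<exists>A B. openin (top_of_set K) A \<and> openin D B \<and> (k, x) \<in> A \<times> B \<and>
      A \<times> B \<subseteq> {p \<in> K \<times> topspace D. left_translation (fst p) (snd p) \<in> U}"
    if U: "openin D U" and k: "k \<in> K" and x: "x \<in> topspace D" "left_translation k x \<in> U" for U k x
  proof -
    obtain g where g: "g \<in> G" "x = \<pi> g"
      using x by (auto simp: topspace_D)
    have "openin (top_of_set G) {g\<in>G. \<pi> g \<in> U}"
      using U openin_D by blast
    then obtain O' where O': "open O'" "{g\<in>G. \<pi> g \<in> U} = G \<inter> O'"
      unfolding openin_open by blast
    have "continuous_on UNIV (\<lambda>p::(complex ^ 'm ^ 'm) \<times> (complex ^ 'm ^ 'm). fst p ** snd p)"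
      by (intro continuous_at_imp_continuous_on ballI isCont_cdiff cdiff_intros)
    then have "open ((\<lambda>p::(complex ^ 'm ^ 'm) \<times> (complex ^ 'm ^ 'm). fst p ** snd p) -` O')"
      using O'(1) by (intro open_vimage)
    moreover have kg: "k ** g \<in> {g\<in>G. \<pi> g \<in> U}"
      using x(2) g k assms by (auto simp: left_translation_coset G.mult)
    then have "(k, g) \<in> (\<lambda>p::(complex ^ 'm ^ 'm) \<times> (complex ^ 'm ^ 'm). fst p ** snd p) -` O'"
      unfolding O'(2) by simp
    ultimately obtain A B where AB: "open A" "open B" "(k, g) \<in> A \<times> B"
      "A \<times> B \<subseteq> (\<lambda>p::(complex ^ 'm ^ 'm) \<times> (complex ^ 'm ^ 'm). fst p ** snd p) -` O'"
      by (rule open_prod_elim)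
    have "openin D (\<pi> ` (G \<inter> B))"
      using AB(2) open_map_coset unfolding open_map_def by (auto simp: openin_open_Int)
    moreover have "openin (top_of_set K) (K \<inter> A)"
      using AB(1) by (simp add: openin_open_Int)
    moreover have "(k, x) \<in> (K \<inter> A) \<times> \<pi> ` (G \<inter> B)"
      using k g AB(3) by auto
    moreover have "left_translation a (\<pi> b) \<in> U" if "a \<in> K" "a \<in> A" "b \<in> G" "b \<in> B" for a b
    proof -
      have "a ** b \<in> G \<inter> O'"
        using that assms AB(4) by (auto intro!: G.mult)
      then show ?thesis
        unfolding O'(2)[symmetric] by (simp add: left_translation_coset)
    qed
    ultimately show ?thesis
      by (intro exI[of _ "K \<inter> A"] exI[of _ "\<pi> ` (G \<inter> B)"]) (auto simp: topspace_D)
  qed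
  then have "openin (prod_topology (top_of_set K) D) {p \<in> K \<times> topspace D. left_translation (fst p) (snd p) \<in> U}"
    if "openin D U" for U
    using that unfolding openin_prod_topology_alt by fastforce
  then show ?thesis
    unfolding continuous_map_def using assms left_translation_topspace
    by (auto simp: topspace_prod_topology case_prod_unfold)
qed

text \<open>In coordinates the action is \<open>F (g ** s w)\<close>, which makes sense on an open
  set of pairs of arbitrary matrices and vectors. It is jointly holomorphic there, hence a smooth
  extension.\<close>

lemma smooth_action:
  fixes \<phi> \<psi> :: "(complex ^ 'm ^ 'm) set \<Rightarrow> complex ^ 'n::finite"
  assumes K: "K \<subseteq> G" and U: "(U, \<phi>) \<in> coset_atlas G H" and V: "(V, \<psi>) \<in> coset_atlas G H"
  shows "smooth_map_on {(g, z). g \<in> K \<and> z \<in> \<phi> ` U \<and> left_translation g (inv_into U \<phi> z) \<in> V}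
    (\<lambda>(g, z). \<psi> (left_translation g (inv_into U \<phi> z)))"
  unfolding smooth_map_on_def
proof
  fix p assume "p \<in> {(g, z). g \<in> K \<and> z \<in> \<phi> ` U \<and> left_translation g (inv_into U \<phi> z) \<in> V}"
  then obtain k z where p: "p = (k, z)" "k \<in> K" "z \<in> \<phi> ` U" "left_translation k (inv_into U \<phi> z) \<in> V"
    by blast
  obtain W s where W: "z \<in> W" "open W" "W \<subseteq> \<phi> ` U" "holomorphic_map_on W s"
    "\<And>w. w \<in> W \<Longrightarrow> s w \<in> G \<and> \<pi> (s w) = inv_into U \<phi> w"
    using atlas_section[OF U p(3)] by blast
  have lt: "left_translation g (inv_into U \<phi> w) = \<pi> (g ** s w)" if "w \<in> W" for g w
    using W(5)[OF that] left_translation_coset by metis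
  have "k ** s z \<in> G" "\<pi> (k ** s z) \<in> V"
    using p K W(5)[OF W(1)] lt[OF W(1)] by (auto intro: G.mult)
  then obtain W2 F where F: "k ** s z \<in> W2" "holomorphic_map_on W2 F"
    "\<And>y. y \<in> G \<Longrightarrow> y \<in> W2 \<Longrightarrow> \<pi> y \<in> V \<Longrightarrow> F y = \<psi> (\<pi> y)"
    using atlas_projection[OF V] by blast
  have cs: "cdiff (\<lambda>q::(complex ^ 'm ^ 'm) \<times> (complex ^ 'n). fst q ** s (snd q)) q" if "snd q \<in> W" for q
  proof -
    have "cdiff s (snd q)"
      using W(4) that by (simp add: holomorphic_map_on_iff)
    then have "cdiff (\<lambda>q::(complex ^ 'm ^ 'm) \<times> (complex ^ 'n). s (snd q)) q"
      by (rule semidiff_compose) (intro cdiff_intros)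
    then show ?thesis
      by (intro cdiff_intros)
  qed
  define W' where "W' = (UNIV \<times> W) \<inter> (\<lambda>q::(complex ^ 'm ^ 'm) \<times> (complex ^ 'n). fst q ** s (snd q)) -` W2"
  have "continuous_on (UNIV \<times> W) (\<lambda>q::(complex ^ 'm ^ 'm) \<times> (complex ^ 'n). fst q ** s (snd q))"
    using cs by (intro continuous_at_imp_continuous_on ballI isCont_cdiff) auto
  moreover have "open ((UNIV::(complex ^ 'm ^ 'm) set) \<times> W)"
    using W(2) by (simp add: open_Times)
  ultimately have "open W'"
    unfolding W'_def using F(2) by (intro continuous_open_preimage) (auto simp: holomorphic_map_on_def)
  moreover have "cdiff (\<lambda>q. F (fst q ** s (snd q))) q" if "q \<in> W'" for q
  proof -
    have "cdiff F (fst q ** s (snd q))"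
      using F(2) that by (simp add: holomorphic_map_on_iff W'_def)
    then show ?thesis
      by (rule semidiff_compose) (use that in \<open>auto simp: W'_def intro: cs\<close>)
  qed
  ultimately have "holomorphic_map_on W' (\<lambda>q. F (fst q ** s (snd q)))"
    by (simp add: holomorphic_map_on_iff)
  then have "\<forall>k. Ck_on k W' (\<lambda>q. F (fst q ** s (snd q)))"
    using holomorphic_imp_Ck_on by blast
  moreover have "p \<in> W'"
    using p(1) W(1) F(1) by (simp add: W'_def)
  moreover have "F (g ** s w) = \<psi> (left_translation g (inv_into U \<phi> w))"
    if "g \<in> K" "left_translation g (inv_into U \<phi> w) \<in> V" "(g, w) \<in> W'" for g w
  proof -
    have w: "w \<in> W" "g ** s w \<in> W2"
      using that(3) by (auto simp: W'_def)
    have "g ** s w \<in> G"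
      using that(1) K W(5)[OF w(1)] by (auto intro: G.mult)
    then show ?thesis
      using F(3)[of "g ** s w"] w that(2) by (simp add: lt)
  qed
  ultimately show "\<exists>W F. open W \<and> p \<in> W \<and> (\<forall>k. Ck_on k W F) \<and>
      (\<forall>x\<in>{(g, z). g \<in> K \<and> z \<in> \<phi> ` U \<and> left_translation g (inv_into U \<phi> z) \<in> V} \<inter> W.
        F x = (case x of (g, z) \<Rightarrow> \<psi> (left_translation g (inv_into U \<phi> z))))"
    using \<open>open W'\<close> by (intro exI[of _ W'] exI[of _ "\<lambda>q. F (fst q ** s (snd q))"]) auto
qed

lemma holomorphic_action_D:
  assumes K: "subgroup K (matrix_group G)"
  shows "holomorphic_action K left_translation D (coset_atlas G H :: (_, 'n::finite) chart set)"
proof -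
  have "K \<subseteq> G"
    using K by (simp add: G.subgroup_iff)
  then show ?thesis
    unfolding holomorphic_action_def
    using group_action_D[OF K] continuous_action smooth_action holomorphic_left_translation by blast
qed

text \<open>Connectedness is inherited from a parametrizing set \<open>Q\<close>; the local lifts to
  \<open>G\<close> make the parametrization \<open>f\<close> continuous.\<close>

lemma connected_D:
  fixes Q :: "(complex ^ 'k::finite) set"
  assumes Q: "connected Q" and surj: "\<And>g. g \<in> G \<Longrightarrow> \<pi> g \<in> f ` Q"
    and lift: "\<And>v. v \<in> Q \<Longrightarrow> \<exists>W s. v \<in> W \<and> open W \<and> continuous_on W s \<and> (\<forall>u\<in>W \<inter> Q. s u \<in> G \<and> f u = \<pi> (s u))"
  shows "connected_space D"
proof -
  have fD: "f u \<in> topspace D" if "u \<in> Q" for u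
    using lift[OF that] that by (auto simp: topspace_D)
  have "continuous_map (top_of_set Q) D f"
    unfolding continuous_map_def
  proof (intro conjI allI impI)
    fix U assume U: "openin D U"
    show "openin (top_of_set Q) {x \<in> topspace (top_of_set Q). f x \<in> U}"
    proof (subst openin_subopen, intro ballI)
      fix v assume "v \<in> {x \<in> topspace (top_of_set Q). f x \<in> U}"
      then have v: "v \<in> Q" "f v \<in> U"
        by auto
      obtain W s where W: "v \<in> W" "open W" "continuous_on W s" "\<And>u. u \<in> W \<inter> Q \<Longrightarrow> s u \<in> G \<and> f u = \<pi> (s u)"
        using lift[OF v(1)] by blast
      have "openin (top_of_set G) {g\<in>G. \<pi> g \<in> U}"
        using U openin_D by blast
      then obtain O' where O': "open O'" "{g\<in>G. \<pi> g \<in> U} = G \<inter> O'"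
        unfolding openin_open by blast
      have "open (W \<inter> s -` O')"
        using W(2,3) O'(1) continuous_open_preimage by blast
      then have "openin (top_of_set Q) (Q \<inter> (W \<inter> s -` O'))"
        by (simp add: openin_open_Int)
      moreover have mem: "f u \<in> U \<longleftrightarrow> s u \<in> O'" if "u \<in> W" "u \<in> Q" for u
      proof -
        have "s u \<in> G" "f u = \<pi> (s u)"
          using W(4)[of u] that by auto
        moreover have "s u \<in> {g\<in>G. \<pi> g \<in> U} \<longleftrightarrow> s u \<in> G \<inter> O'"
          by (simp only: O'(2))
        ultimately show ?thesis
          by simp
      qed
      have "v \<in> Q \<inter> (W \<inter> s -` O')"
        using v W(1) mem by auto
      moreover have "Q \<inter> (W \<inter> s -` O') \<subseteq> {x \<in> topspace (top_of_set Q). f x \<in> U}"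
        using mem by auto
      ultimately show "\<exists>T. openin (top_of_set Q) T \<and> v \<in> T \<and> T \<subseteq> {x \<in> topspace (top_of_set Q). f x \<in> U}"
        by blast
    qed
  qed (use fD in auto)
  then have "connectedin D (f ` Q)"
    using connectedin_continuous_map_image[of "top_of_set Q" D f Q] Q by (simp add: connectedin_subtopology)
  moreover have "f ` Q = topspace D"
    using fD surj by (auto simp: topspace_D)
  ultimately show ?thesis
    by (simp add: connectedin_topspace)
qed

text \<open>\<open>\<Phi>\<close>, \<open>\<tau>\<close> and the normal form refer to the real
  points. Left translation by \<open>b\<close>, which conjugates the real points to
  \<open>Gu\<close>, transports the chart, the slice and the antiholomorphic map.\<close>

theorem strongly_visible_model:
  fixes \<Phi> :: "complex ^ 'm ^ 'm \<Rightarrow> complex ^ 'n::finite"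
  assumes polar: "polar_group G" and m: "model_chart N \<Phi> B" and V: "subspace V" "dim V = 1"
    and slice: "\<And>g. g \<in> G \<Longrightarrow> \<exists>u\<in>G.real_points. u ** g \<in> N \<and> \<Phi> (u ** g) \<in> B \<inter> V"
    and \<tau>: "\<tau> \<in> G.real_points"
      "\<And>g. g \<in> G \<inter> N \<Longrightarrow> \<Phi> g \<in> B \<inter> V \<Longrightarrow> \<tau> ** mcnj g \<in> N \<and> \<Phi> (\<tau> ** mcnj g) = \<Phi> g"
    and conn: "connected_space D" and Gu: "maximal_compact_subgroup Gu G"
  defines "\<A> \<equiv> coset_atlas G H :: (_, 'n) chart set"
  shows "strongly_visible Gu left_translation D \<A> \<and>
    (\<exists>S \<sigma>. real_submanifold 1 D \<A> S \<and> visible_slice Gu left_translation D \<A> S \<sigma>)"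
proof -
  interpret polar_group G
    by (rule polar)
  obtain b where b: "b \<in> G" "Gu = (\<lambda>u. b ** u ** transpose b) ` G.real_points"
    using maximal_compact_conjugate[OF Gu] by blast
  have sub: "subgroup Gu (matrix_group G)" and "compact Gu"
    using Gu by (auto simp: maximal_compact_subgroup_def)
  note Gu' = sub[unfolded G.subgroup_iff]
  have realG: "u \<in> G" "mcnj u = u" if "u \<in> G.real_points" for u
    using that by (auto simp: G.real_points_def)
  have bt: "transpose b \<in> G"
    by (rule G.transp[OF b(1)])
  note mb = model_chart_translate[OF m b(1)]
  define S where "S = chart_domain {g. transpose b ** g \<in> N} (\<lambda>g. \<Phi> (transpose b ** g)) (B \<inter> V)"
  have S_iff: "\<pi> g \<in> S" if "g \<in> G" "transpose b ** g \<in> N" "\<Phi> (transpose b ** g) \<in> B \<inter> V" for g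
    using that by (auto simp: S_def chart_domain_def)
  have S_sub: "\<exists>g\<in>G. x = \<pi> g \<and> transpose b ** g \<in> N \<and> \<Phi> (transpose b ** g) \<in> B \<inter> V" if "x \<in> S" for x
    using that by (auto simp: S_def chart_domain_def)
  \<comment> \<open>\<open>conj_map a\<close> is \<open>conj_map \<tau>\<close> conjugated by left
    translation with \<open>b\<close>; moving the inverse of \<open>b\<close> across complex
    conjugation produces the factor \<open>mcnj (transpose b)\<close>.\<close>
  define a where "a = b ** \<tau> ** mcnj (transpose b)"
  have aG: "a \<in> G"
    unfolding a_def using b(1) realG(1)[OF \<tau>(1)] by (intro G.mult G.conj G.transp)
  have \<sigma>: "conj_map a (\<pi> g) = \<pi> (b ** (\<tau> ** mcnj (transpose b ** g)))" for g
    by (simp add: conj_map_coset a_def matrix_mul_assoc)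
  have fixed: "\<pi> (\<tau> ** mcnj g) = \<pi> g" if "g \<in> G" "g \<in> N" "\<Phi> g \<in> B \<inter> V" for g
  proof -
    have "\<tau> ** mcnj g \<in> G"
      using that realG(1)[OF \<tau>(1)] by (intro G.mult G.conj)
    moreover have "transpose g ** (\<tau> ** mcnj g) \<in> H"
      using \<tau>(2)[of g] m that calculation unfolding model_chart_def by (metis IntI)
    ultimately show ?thesis
      using coset_eq_iff[of g "\<tau> ** mcnj g"] that by simp
  qed
  have submanifold: "real_submanifold 1 D \<A> S"
    using real_submanifold_chart[OF mb V(1)] V(2) by (simp add: S_def \<A>_def)
  have normal_form: "\<exists>u\<in>G.real_points. \<exists>k\<in>G. k \<in> N \<and> \<Phi> k \<in> B \<inter> V \<and> g = b ** (u ** k)" if g: "g \<in> G" for g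
  proof -
    obtain u where u: "u \<in> G.real_points" "u ** (transpose b ** g) \<in> N" "\<Phi> (u ** (transpose b ** g)) \<in> B \<inter> V"
      using slice[of "transpose b ** g"] g bt G.mult by blast
    have "g = b ** (transpose u ** (u ** (transpose b ** g)))"
      by (simp add: G.cancel_left realG(1)[OF u(1)] b(1))
    moreover have "u ** (transpose b ** g) \<in> G"
      using g bt realG(1)[OF u(1)] by (intro G.mult)
    ultimately show ?thesis
      using u G.real_points_group(3)[OF u(1)] by blast
  qed
  have "visible_slice Gu left_translation D \<A> S (conj_map a)"
    unfolding visible_slice_def
  proof (intro conjI ballI)
    show "antiholomorphic_diffeo D \<A> (conj_map a)"
      unfolding \<A>_def by (rule antiholomorphic_diffeo_conj_map[OF aG])
    show "topspace D = (\<Union>g\<in>Gu. left_translation g ` S)"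
    proof
      show "(\<Union>g\<in>Gu. left_translation g ` S) \<subseteq> topspace D"
      proof (intro UN_least image_subsetI)
        fix k x assume "k \<in> Gu" "x \<in> S"
        then have "k \<in> G" "x \<in> topspace D"
          using Gu' S_sub by (auto simp: topspace_D)
        then show "left_translation k x \<in> topspace D"
          by (rule left_translation_topspace)
      qed
      show "topspace D \<subseteq> (\<Union>g\<in>Gu. left_translation g ` S)"
      proof
        fix x assume "x \<in> topspace D"
        then obtain g where g: "g \<in> G" "x = \<pi> g"
          by (auto simp: topspace_D)
        obtain u k where uk: "u \<in> G.real_points" "k \<in> G" "k \<in> N" "\<Phi> k \<in> B \<inter> V" "g = b ** (u ** k)"
          using normal_form[OF g(1)] by blast
        have "\<pi> (b ** k) \<in> S"
          using uk b(1) by (intro S_iff) (auto simp: G.cancel_left intro: G.mult)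
        moreover have "left_translation (b ** u ** transpose b) (\<pi> (b ** k)) = x"
          by (simp add: left_translation_coset g uk(5) matrix_mul_assoc[symmetric] G.cancel_left[OF b(1)])
        moreover have "b ** u ** transpose b \<in> Gu"
          using uk(1) b(2) by blast
        ultimately show "x \<in> (\<Union>g\<in>Gu. left_translation g ` S)"
          by blast
      qed
    qed
    show "conj_map a x = x" if xS: "x \<in> S" for x
    proof -
      obtain g where g: "g \<in> G" "x = \<pi> g" "transpose b ** g \<in> N" "\<Phi> (transpose b ** g) \<in> B \<inter> V"
        using S_sub[OF xS] by blast
      have "conj_map a x = left_translation b (\<pi> (\<tau> ** mcnj (transpose b ** g)))"
        by (simp only: g(2) \<sigma> left_translation_coset)
      also have "\<dots> = left_translation b (\<pi> (transpose b ** g))"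
        using fixed[OF G.mult[OF bt g(1)] g(3,4)] by simp
      also have "\<dots> = x"
        by (simp add: left_translation_coset g(2) G.cancel_left[OF b(1)])
      finally show ?thesis .
    qed
    show "conj_map a x \<in> (\<lambda>g. left_translation g x) ` Gu" if xD: "x \<in> topspace D" for x
    proof -
      obtain g where g: "g \<in> G" "x = \<pi> g"
        using xD by (auto simp: topspace_D)
      obtain u k where uk: "u \<in> G.real_points" "k \<in> G" "k \<in> N" "\<Phi> k \<in> B \<inter> V" "g = b ** (u ** k)"
        using normal_form[OF g(1)] by blast
      note \<tau>G = realG(1)[OF \<tau>(1)] and uG = realG(1)[OF uk(1)]
      \<comment> \<open>For \<open>x = b u k H\<close> the image is
        \<open>b \<tau> u \<tau>^-1 k H\<close>, because \<open>k H\<close> is fixed. Inserting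
        \<open>u^-1 u\<close> before \<open>k\<close> shows that it is \<open>b w b^-1\<close>
        applied to \<open>x\<close>.\<close>
      define w where "w = \<tau> ** u ** transpose \<tau> ** transpose u"
      have w: "w \<in> G.real_points"
        unfolding w_def using \<tau>(1) uk(1) by (intro G.real_points_group)
      have "conj_map a x = \<pi> (b ** (\<tau> ** (u ** mcnj k)))"
        by (simp add: g(2) \<sigma> uk(5) G.cancel_left[OF b(1)] realG(2)[OF uk(1)])
      also have "\<dots> = left_translation (b ** (\<tau> ** (u ** transpose \<tau>))) (\<pi> (\<tau> ** mcnj k))"
        by (simp add: left_translation_coset matrix_mul_assoc[symmetric] G.cancel_left[OF \<tau>G])
      also have "\<dots> = left_translation (b ** (\<tau> ** (u ** transpose \<tau>))) (\<pi> k)"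
        using fixed[OF uk(2,3,4)] by simp
      also have "\<dots> = left_translation (b ** w ** transpose b) x"
        by (simp add: left_translation_coset g(2) uk(5) w_def matrix_mul_assoc[symmetric]
            G.cancel_left[OF b(1)] G.cancel_left[OF uG])
      finally show ?thesis
        using w b(2) by blast
    qed
  qed
  note visible = this
  have lie: "linear_Lie_group Gu"
    unfolding linear_Lie_group_def
  proof
    have inv: "invertible g" if "g \<in> G" for g
      using G.orthogonal[OF that] G.orthogonal'[OF that] by (auto simp: invertible_def)
    have grp: "group (matrix_group (general_linear :: (complex ^ 'm ^ 'm) set))"
    proof (rule group_matrix_group)
      show "(mat 1 :: complex ^ 'm ^ 'm) \<in> general_linear"
        using inv[OF G.one] by simp
      show "g ** h \<in> general_linear" if "g \<in> general_linear" "h \<in> general_linear"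
        for g h :: "complex ^ 'm ^ 'm"
        using that invertible_mult by simp
      show "\<exists>h\<in>general_linear. h ** g = mat 1" if "g \<in> general_linear" for g :: "complex ^ 'm ^ 'm"
        using that unfolding invertible_def by blast
    qed
    have "inv\<^bsub>matrix_group general_linear\<^esub> k = transpose k" if "k \<in> Gu" for k
      by (rule group.inv_equality[OF grp])
        (use that Gu' inv G.orthogonal in \<open>auto simp: matrix_group_def subset_iff\<close>)
    then show "subgroup Gu (matrix_group general_linear)"
      by (intro subgroup.intro) (use Gu' inv in \<open>auto simp: matrix_group_def subset_iff\<close>)
    show "closedin (top_of_set general_linear) Gu"
      using compact_imp_closed[OF \<open>compact Gu\<close>] Gu' inv by (intro closed_subset) auto
  qed
  obtain g where "g \<in> G" "\<Phi> g \<in> B"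
    using normal_form[OF G.one] by blast
  then have "B \<noteq> {}"
    by blast
  then have "complex_manifold D \<A>"
    unfolding \<A>_def by (rule complex_manifold_D[OF m])
  moreover have "holomorphic_action Gu left_translation D \<A>"
    unfolding \<A>_def by (rule holomorphic_action_D[OF sub])
  ultimately show ?thesis
    unfolding strongly_visible_def using lie conn submanifold visible by blast
qed

end

section \<open>The three homogeneous spaces\<close>

lemma cdot_norm_le: "norm (cdot w w) \<le> (norm (w :: complex ^ 'n::finite))\<^sup>2"
proof -
  have "norm (cdot w w) \<le> (\<Sum>i\<in>UNIV. norm (w $ i * w $ i))"
    unfolding cdot_def by (rule norm_sum)
  also have "\<dots> = (norm w)\<^sup>2"
    by (simp add: norm_vec_def L2_set_def norm_mult sum_nonneg power2_eq_square)
  finally show ?thesis .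
qed

lemma norm_axis_complex [simp]: "norm (axis k a :: complex ^ 'n::finite) = norm a"
  by (simp add: norm_vec_def L2_set_def axis_def if_distrib[where f = norm] if_distrib[where f = "\<lambda>u. u\<^sup>2"]
      cong: if_cong)

text \<open>On the unit ball \<open>1 + cdot w w\<close> stays in the right half plane, away from
  the branch cut, and its principal root has positive real part.\<close>

lemma csqrt_one_plus_cdot:
  assumes "norm (w :: complex ^ 'n::finite) < 1"
  shows "1 + cdot w w \<notin> \<real>\<^sub>\<le>\<^sub>0" "csqrt (1 + cdot w w) \<noteq> 0" "Re (1 / csqrt (1 + cdot w w)) > 0"
proof -
  have "(norm w)\<^sup>2 < 1"
    using assms by (simp add: abs_square_less_1)
  then have "norm (cdot w w) < 1"
    using cdot_norm_le[of w] by linarith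
  then have pos: "Re (1 + cdot w w) > 0"
    using abs_Re_le_cmod[of "cdot w w"] by simp
  then show *: "1 + cdot w w \<notin> \<real>\<^sub>\<le>\<^sub>0"
    by (auto simp: complex_nonpos_Reals_iff)
  show "csqrt (1 + cdot w w) \<noteq> 0"
  proof -
    have "1 + cdot w w \<noteq> 0"
      using pos by (metis less_irrefl zero_complex.sel(1))
    then show ?thesis
      by simp
  qed
  define c where "c = csqrt (1 + cdot w w)"
  have c: "c\<^sup>2 = 1 + cdot w w" "0 < Re c \<or> Re c = 0 \<and> 0 \<le> Im c"
    by (simp_all only: c_def power2_csqrt csqrt_principal)
  have "Re c > 0"
  proof (rule ccontr)
    assume "\<not> Re c > 0"
    with c(2) have "Re (c\<^sup>2) \<le> 0"
      by (simp add: power2_eq_square)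
    with pos show False
      by (simp only: c(1))
  qed
  then have "Re (1 / c) > 0"
  proof -
    have "c \<noteq> 0"
      using \<open>Re c > 0\<close> by auto
    with \<open>Re c > 0\<close> show ?thesis
      by (simp add: Re_divide' zero_less_divide_iff)
  qed
  then show "Re (1 / csqrt (1 + cdot w w)) > 0"
    by (simp only: c_def)
qed

text \<open>Projective coordinates on the unit quadric of the coordinate subspace of \<open>complex ^ 8\<close>
  spanned by the basis vectors with index \<open>p\<close> or \<open>\<iota> k\<close>.\<close>

locale quadric_chart =
  fixes p :: 8 and \<iota> :: "'n::finite \<Rightarrow> 8"
  assumes inj: "inj \<iota>" and p: "p \<notin> range \<iota>"
begin

definition quadric :: "(complex ^ 8) set"
  where "quadric = {v. cdot v v = 1 \<and> (\<forall>i. i \<notin> insert p (range \<iota>) \<longrightarrow> v $ i = 0)}"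

definition coords :: "complex ^ 8 \<Rightarrow> complex ^ 'n"
  where "coords v = (\<chi> k. v $ \<iota> k / v $ p)"

text \<open>The homogeneous vector with entry 1 at \<open>p\<close> and entries \<open>w\<close> is
  scaled onto the quadric; the principal root selects the representative with positive real part at
  \<open>p\<close>.\<close>

definition point :: "complex ^ 'n \<Rightarrow> complex ^ 8"
  where "point w = (1 / csqrt (1 + cdot w w)) *s (axis p 1 + (\<Sum>k\<in>UNIV. w $ k *s axis (\<iota> k) 1))"

lemma cdot_quadric:
  assumes "\<And>i. i \<notin> insert p (range \<iota>) \<Longrightarrow> v $ i = 0"
  shows "cdot v v = v $ p * v $ p + (\<Sum>k\<in>UNIV. v $ \<iota> k * v $ \<iota> k)"
proof -
  have "cdot v v = (\<Sum>i\<in>insert p (range \<iota>). v $ i * v $ i)"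
    unfolding cdot_def by (rule sum.mono_neutral_right) (use assms in auto)
  also have "\<dots> = v $ p * v $ p + (\<Sum>i\<in>range \<iota>. v $ i * v $ i)"
    using p by simp
  also have "(\<Sum>i\<in>range \<iota>. v $ i * v $ i) = (\<Sum>k\<in>UNIV. v $ \<iota> k * v $ \<iota> k)"
    by (rule sum.reindex_cong[OF inj]) auto
  finally show ?thesis .
qed

lemma point_nth:
  "point w $ p = 1 / csqrt (1 + cdot w w)" "point w $ \<iota> k = w $ k / csqrt (1 + cdot w w)"
  "i \<notin> insert p (range \<iota>) \<Longrightarrow> point w $ i = 0"
proof -
  have *: "(\<Sum>k\<in>UNIV. w $ k *s axis (\<iota> k) 1) $ i = (\<Sum>k\<in>UNIV. if \<iota> k = i then w $ k else 0)" for i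
    by (simp add: axis_nth_8 if_distrib[where f = "\<lambda>u. _ * u"] cong: if_cong)
  have \<iota>p: "\<iota> j \<noteq> p" for j
    using p by (metis rangeI)
  show "point w $ p = 1 / csqrt (1 + cdot w w)"
    unfolding point_def vector_smult_component vector_add_component * using \<iota>p by (simp add: axis_nth_8)
  show "point w $ \<iota> k = w $ k / csqrt (1 + cdot w w)"
    unfolding point_def vector_smult_component vector_add_component * using \<iota>p[of k] inj
    by (simp add: axis_nth_8 inj_eq eq_commute[of p])
  show "point w $ i = 0" if "i \<notin> insert p (range \<iota>)"
    unfolding point_def vector_smult_component vector_add_component * using that
    by (auto simp: axis_nth_8 intro!: sum.neutral)
qed

lemma point_quadric:
  assumes "norm w < 1"
  shows "point w \<in> quadric" "Re (point w $ p) > 0" "coords (point w) = w"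
proof -
  note c = csqrt_one_plus_cdot[OF assms]
  have "cdot (point w) (point w) = (1 + cdot w w) / (csqrt (1 + cdot w w))\<^sup>2"
    by (subst cdot_quadric) (auto simp: point_nth cdot_def power2_eq_square sum_divide_distrib[symmetric] add_divide_distrib)
  also have "\<dots> = 1"
    using c(2) by (metis divide_self power2_csqrt power_not_zero)
  finally show "point w \<in> quadric"
    by (simp add: quadric_def point_nth)
  show "Re (point w $ p) > 0"
    using c(3) by (simp only: point_nth)
  show "coords (point w) = w"
    using c(2) by (simp add: coords_def point_nth vec_eq_iff)
qed

lemma coords_equation:
  assumes "v \<in> quadric" "v $ p \<noteq> 0"
  shows "v $ p * v $ p * (1 + cdot (coords v) (coords v)) = 1"
proof -
  have "v $ p * v $ p + (\<Sum>k\<in>UNIV. v $ \<iota> k * v $ \<iota> k) = 1"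
    using assms(1) cdot_quadric[of v] by (auto simp: quadric_def)
  then show ?thesis
    using assms(2) by (simp add: coords_def cdot_def distrib_left sum_distrib_left)
qed

text \<open>\<open>coords_equation\<close> recovers the square of \<open>v $ p\<close> from the
  coordinates, and \<open>v $ p\<close> determines the other entries, so only a common sign is left
  open.\<close>

lemma quadric_eqI:
  assumes v: "v \<in> quadric" "v $ p \<noteq> 0" and u: "u \<in> quadric" "u $ p \<noteq> 0" and eq: "coords v = coords u"
  shows "v = u \<or> v = - u"
proof -
  have "v $ p * v $ p * (1 + cdot (coords u) (coords u)) = u $ p * u $ p * (1 + cdot (coords u) (coords u))"
    using coords_equation[OF v] coords_equation[OF u] eq by simp
  moreover have "1 + cdot (coords u) (coords u) \<noteq> 0"
    using coords_equation[OF u] by auto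
  ultimately have vp: "v $ p = u $ p \<or> v $ p = - u $ p"
    by (metis mult_right_cancel square_eq_iff)
  have "v $ \<iota> k = v $ p * coords v $ k" "u $ \<iota> k = u $ p * coords u $ k" for k
    using v(2) u(2) by (simp_all add: coords_def)
  then have "v $ \<iota> k = v $ p * coords u $ k" "u $ \<iota> k = u $ p * coords u $ k" for k
    by (simp_all add: eq)
  note coord = this
  have zero: "v $ i = 0" "u $ i = 0" if "i \<notin> insert p (range \<iota>)" for i
    using v(1) u(1) that unfolding quadric_def by blast+
  have "v $ i = (if v $ p = u $ p then u $ i else - u $ i)" for i
  proof -
    consider "i = p" | k where "i = \<iota> k" | "i \<notin> insert p (range \<iota>)"
      by blast
    then show ?thesis
    proof cases
      case (2 k)
      then show ?thesis
        using vp coord[of k] by auto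
    next
      case 3
      then show ?thesis
        using zero[of i] by simp
    qed (use vp in auto)
  qed
  note all = this
  show ?thesis
  proof (cases "v $ p = u $ p")
    case True
    have "v = u"
      unfolding vec_eq_iff using all True by simp
    then show ?thesis ..
  next
    case False
    have "v = - u"
      unfolding vec_eq_iff using all False by simp
    then show ?thesis ..
  qed
qed

lemma cdiff_coords [cdiff_intros]: "cdiff f z \<Longrightarrow> f z $ p \<noteq> 0 \<Longrightarrow> cdiff (\<lambda>x. coords (f x)) z"
  unfolding coords_def by (intro cdiff_intros)

lemma holomorphic_point: "holomorphic_map_on (ball 0 1) point"
  unfolding holomorphic_map_on_iff point_def
proof (intro conjI ballI open_ball cdiff_intros)
  fix w :: "complex ^ 'n" assume "w \<in> ball 0 1"
  then have "norm w < 1"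
    by simp
  from csqrt_one_plus_cdot[OF this] show "1 + cdot w w \<notin> \<real>\<^sub>\<le>\<^sub>0" "csqrt (1 + cdot w w) \<noteq> 0"
    by blast+
qed

lemma section_through_point:
  assumes "\<And>v. v \<in> quadric \<Longrightarrow> local_section G quadric a v" and w0: "norm w0 < 1"
  obtains W s where "w0 \<in> W" "W \<subseteq> ball 0 1" "holomorphic_map_on W s"
    "\<And>w. w \<in> W \<Longrightarrow> s w \<in> G \<and> s w *v a = point w"
proof -
  obtain W s where W: "point w0 \<in> W" "holomorphic_map_on W s" "\<And>u. u \<in> W \<inter> quadric \<Longrightarrow> s u \<in> G \<and> s u *v a = u"
    using assms(1)[OF point_quadric(1)[OF w0]] unfolding local_section_def by blast
  define W' where "W' = ball 0 1 \<inter> point -` W"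
  have "open W'"
    unfolding W'_def using holomorphic_map_on_continuous[OF holomorphic_point] W(2)
    by (intro continuous_open_preimage) (auto simp: holomorphic_map_on_def)
  moreover have "cdiff (\<lambda>w. s (point w)) w" if "w \<in> W'" for w
  proof -
    have "cdiff s (point w)" "cdiff point w"
      using W(2) holomorphic_point that by (auto simp: holomorphic_map_on_iff W'_def)
    then show ?thesis
      by (rule semidiff_compose)
  qed
  ultimately have "holomorphic_map_on W' (\<lambda>w. s (point w))"
    by (simp add: holomorphic_map_on_iff)
  then show ?thesis
    using that[of W' "\<lambda>w. s (point w)"] W point_quadric(1) w0 by (auto simp: W'_def)
qed

text \<open>The span is real: this is the imaginary axis of the \<open>k\<close>-th coordinate,
  where the normal forms have their coordinates \<open>\<i> * s / c\<close>.\<close>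

definition slice_direction :: "'n \<Rightarrow> (complex ^ 'n) set"
  where "slice_direction k = span {axis k \<i>}"

lemma slice_direction: "subspace (slice_direction k)" "dim (slice_direction k) = 1"
proof -
  have "axis k \<i> \<noteq> 0"
    by (simp add: axis_eq_0_iff)
  then show "subspace (slice_direction k)" "dim (slice_direction k) = 1"
    unfolding slice_direction_def by (simp_all add: dim_span dim_singleton)
qed

lemma slice_direction_iff: "w \<in> slice_direction k \<longleftrightarrow> (\<exists>t. w = axis k (\<i> * of_real t))"
proof -
  have "t *\<^sub>R axis k \<i> = (axis k (\<i> * of_real t) :: complex ^ 'n)" for t
    by (simp add: vec_eq_iff axis_def complex_eq_iff)
  then show ?thesis
    by (auto simp: slice_direction_def span_singleton)
qed

text \<open>\<open>c\<^sup>2 - s\<^sup>2 = 1\<close> forces \<open>\<bar>s\<bar> < c\<close>;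
  therefore the unit ball is large enough as coordinate domain.\<close>

lemma coords_polar:
  assumes "c > 0" "c\<^sup>2 = 1 + s\<^sup>2"
  shows "coords (of_real c *s axis p 1 + (\<i> * of_real s) *s axis (\<iota> k) 1) \<in> ball 0 1 \<inter> slice_direction k"
proof -
  have "\<iota> j \<noteq> p" for j
    using p by (metis rangeI)
  then have eq: "coords (of_real c *s axis p 1 + (\<i> * of_real s) *s axis (\<iota> k) 1) = axis k (\<i> * of_real (s / c))"
    using assms(1) inj by (auto simp: coords_def vec_eq_iff axis_nth_8 axis_def[of k] inj_eq)
  have "s\<^sup>2 < c\<^sup>2"
    using assms(2) by simp
  then have "\<bar>s\<bar> < c"
    using power2_less_imp_less[of "\<bar>s\<bar>" c] assms(1) by simp
  then have "norm (axis k (\<i> * of_real (s / c)) :: complex ^ 'n) < 1"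
    using assms(1) by (simp add: norm_mult norm_divide)
  then show ?thesis
    unfolding eq by (auto simp: slice_direction_iff simp del: of_real_divide)
qed

text \<open>On the slice \<open>v $ p\<close> is real, so conjugation changes only the sign of the imaginary
  coordinate \<open>\<iota> k\<close>.\<close>

lemma conjugate_slice:
  assumes v: "v \<in> quadric" "v $ p \<noteq> 0" "coords v \<in> ball 0 1 \<inter> slice_direction k"
    and \<tau>: "\<tau> *v axis p 1 = axis p 1" "\<tau> *v axis (\<iota> k) 1 = - axis (\<iota> k) 1"
  shows "\<tau> *v vcnj v = v"
proof -
  obtain t where t: "coords v = axis k (\<i> * of_real t)"
    using v(3) slice_direction_iff by auto
  then have "norm (axis k (\<i> * of_real t) :: complex ^ 'n) < 1"
    using v(3) by simp
  then have "\<bar>t\<bar> < 1"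
    by (simp add: norm_mult)
  then have t1: "1 - t * t > 0"
    by (metis abs_square_less_1 diff_gt_0_iff_gt power2_eq_square)
  have eq: "v $ p * v $ p * of_real (1 - t * t) = 1"
    using coords_equation[OF v(1,2)] unfolding t by (simp add: algebra_simps)
  have real: "cnj (v $ p) = v $ p"
  proof -
    have "v $ p * v $ p = of_real (1 / (1 - t * t))"
      using eq t1 by (simp add: field_simps del: of_real_diff of_real_mult)
    then have "(v $ p)\<^sup>2 = (of_real (sqrt (1 / (1 - t * t))))\<^sup>2"
      using t1 by (simp add: power2_eq_square[of "v $ p"] of_real_power[symmetric] del: of_real_power)
    then have "v $ p = of_real (sqrt (1 / (1 - t * t))) \<or> v $ p = - of_real (sqrt (1 / (1 - t * t)))"
      by (rule power2_eq_iff[THEN iffD1])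
    then show ?thesis
      by auto
  qed
  have "v = v $ p *s axis p 1 + (v $ p * \<i> * of_real t) *s axis (\<iota> k) 1"
  proof -
    have "v $ \<iota> j = v $ p * coords v $ j" for j
      using v(2) by (simp add: coords_def)
    then have coord: "v $ \<iota> j = (if j = k then v $ p * \<i> * of_real t else 0)" for j
      by (simp add: t axis_def)
    have \<iota>p: "\<iota> j \<noteq> p" for j
      using p by (metis rangeI)
    have zero: "v $ i = 0" if "i \<notin> insert p (range \<iota>)" for i
      using that v(1) unfolding quadric_def by blast
    have "v $ i = (v $ p *s axis p 1 + (v $ p * \<i> * of_real t) *s axis (\<iota> k) 1) $ i" for i
    proof -
      consider "i = p" | j where "i = \<iota> j" | "i \<notin> insert p (range \<iota>)"
        by blast
      then show ?thesis
      proof cases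
        case (2 j)
        then show ?thesis
          using \<iota>p[of j] coord[of j] inj by (simp add: axis_nth_8 inj_eq eq_commute[of k])
      next
        case 3
        then show ?thesis
          using zero[of i] by (auto simp: axis_nth_8)
      qed (use \<iota>p in \<open>simp add: axis_nth_8\<close>)
    qed
    then show ?thesis
      unfolding vec_eq_iff by blast
  qed
  moreover have "vcnj (v $ p *s axis p 1 + (v $ p * \<i> * of_real t) *s axis (\<iota> k) 1) =
      v $ p *s axis p 1 - (v $ p * \<i> * of_real t) *s axis (\<iota> k) 1"
    by (simp add: real vec_eq_iff)
  moreover have "\<tau> *v (v $ p *s axis p 1 - (v $ p * \<i> * of_real t) *s axis (\<iota> k) 1) =
      v $ p *s axis p 1 + (v $ p * \<i> * of_real t) *s axis (\<iota> k) 1"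
    by (simp add: matrix_vector_mult_diff_distrib vector_scalar_commute \<tau>)
  ultimately show ?thesis
    by metis
qed

text \<open>The quadric is the continuous image of pairs of real vectors with nonzero first entry:
  the second is made orthogonal to the first, and the first is rescaled so that the squared lengths
  differ by one.\<close>

lemma connected_quadric: "connected quadric"
proof -
  let ?I = "insert p (range \<iota>)"
  define A where "A = {x :: real ^ 8. \<forall>i. i \<notin> ?I \<longrightarrow> x $ i = 0}"
  have A: "subspace A"
    by (auto simp: A_def subspace_def)
  obtain k :: 'n where True by blast
  have "\<iota> k \<noteq> p"
    using p by (metis rangeI)
  have "independent {axis p 1, axis (\<iota> k) 1 :: real ^ 8}"
    by (rule independent_mono[OF independent_Basis]) (auto simp: Basis_vec_def)
  moreover have "{axis p 1, axis (\<iota> k) 1 :: real ^ 8} \<subseteq> A"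
    by (auto simp: A_def axis_def)
  ultimately have "card {axis p 1, axis (\<iota> k) 1 :: real ^ 8} \<le> dim A"
    by (metis independent_card_le_dim)
  moreover have "card {axis p 1, axis (\<iota> k) 1 :: real ^ 8} = 2"
    using \<open>\<iota> k \<noteq> p\<close> by (simp add: axis_eq_axis)
  \<comment> \<open>Dimension at least two matters: removing the origin would disconnect a
    line.\<close>
  ultimately have "aff_dim A \<noteq> 1"
    using A by (simp add: aff_dim_subspace)
  then have conn: "connected ((A - {0}) \<times> A)"
    using A subspace_imp_convex[OF A] by (intro connected_Times connected_punctured_convex convex_connected)
  define y' where "y' = (\<lambda>q :: (real ^ 8) \<times> (real ^ 8). snd q - ((fst q \<bullet> snd q) / (fst q \<bullet> fst q)) *\<^sub>R fst q)"
  define f where "f = (\<lambda>q :: (real ^ 8) \<times> (real ^ 8). \<chi> i.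
    of_real (sqrt (1 + y' q \<bullet> y' q) / norm (fst q) * fst q $ i) + \<i> * of_real (y' q $ i))"
  have "continuous_on ((A - {0}) \<times> A) f"
    unfolding f_def y'_def by (intro continuous_intros) (auto simp: add_nonneg_eq_0_iff)
  then have "connected (f ` ((A - {0}) \<times> A))"
    using conn connected_continuous_image by blast
  moreover have "f ` ((A - {0}) \<times> A) = quadric"
  proof
    show "f ` ((A - {0}) \<times> A) \<subseteq> quadric"
    proof (rule image_subsetI)
      fix q assume q: "q \<in> (A - {0}) \<times> A"
      define x where "x = (sqrt (1 + y' q \<bullet> y' q) / norm (fst q)) *\<^sub>R fst q"
      have fq: "f q = (\<chi> i. of_real (x $ i) + \<i> * of_real (y' q $ i))"
        by (simp add: f_def x_def)
      have y: "fst q \<bullet> y' q = 0" "y' q \<in> A" "x \<in> A"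
        using q A by (auto simp: y'_def x_def inner_diff_right intro!: subspace_diff subspace_scale)
      have "x \<bullet> x = 1 + y' q \<bullet> y' q"
      proof -
        have "fst q \<noteq> 0"
          using q by auto
        then show ?thesis
          by (simp add: x_def power2_norm_eq_inner[symmetric] power_divide flip: power2_eq_square)
      qed
      moreover have "x \<bullet> y' q = 0"
        using y(1) by (simp add: x_def)
      moreover have "cdot (f q) (f q) = of_real (x \<bullet> x - y' q \<bullet> y' q) + \<i> * of_real (2 * (x \<bullet> y' q))"
        unfolding fq cdot_def inner_vec_def
        by (simp add: algebra_simps sum.distrib sum_subtractf sum_distrib_left)
      ultimately show "f q \<in> quadric"
        using y(2,3) by (auto simp: quadric_def fq A_def)
    qed
    show "quadric \<subseteq> f ` ((A - {0}) \<times> A)"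
    proof
      fix v assume v: "v \<in> quadric"
      define x where "x = (\<chi> i. Re (v $ i))"
      define y where "y = (\<chi> i. Im (v $ i))"
      have veq: "v $ i = of_real (x $ i) + \<i> * of_real (y $ i)" for i
        by (simp add: x_def y_def complex_eq_iff)
      have "cdot v v = of_real (x \<bullet> x - y \<bullet> y) + \<i> * of_real (2 * (x \<bullet> y))"
        unfolding cdot_def inner_vec_def veq
        by (simp add: algebra_simps sum.distrib sum_subtractf sum_distrib_left)
      then have xy: "x \<bullet> x = 1 + y \<bullet> y" "x \<bullet> y = 0"
        using v by (auto simp: quadric_def complex_eq_iff)
      have "x \<noteq> 0"
        using xy(1) by (auto simp: add_nonneg_eq_0_iff)
      moreover have "x \<in> A" "y \<in> A"
        using v by (auto simp: quadric_def A_def x_def y_def)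
      moreover have "f (x, y) = v"
      proof -
        have y'eq: "y' (x, y) = y"
          by (simp add: y'_def xy)
        have sq: "sqrt (1 + y \<bullet> y) = norm x"
          by (simp add: norm_eq_sqrt_inner xy)
        have "f (x, y) $ i = v $ i" for i
          using \<open>x \<noteq> 0\<close> by (simp add: f_def y'eq sq veq)
        then show ?thesis
          unfolding vec_eq_iff by blast
      qed
      ultimately show "v \<in> f ` ((A - {0}) \<times> A)"
        by (intro image_eqI[of _ _ "(x, y)"]) auto
    qed
  qed
  ultimately show ?thesis
    by simp
qed

end

text \<open>The group \<open>G\<close> is presented by a group \<open>C\<close> acting on the quadric, which is \<open>G\<close> itself or its
  spin cover. The predicate \<open>R\<close> cuts out the domain of the coordinates.\<close>

locale cover_model = orthogonal_pair G H + quadric_chart p \<iota>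
  for G H :: "(complex ^ 8 ^ 8) set" and p :: 8 and \<iota> :: "'n::finite \<Rightarrow> 8" +
  fixes C :: "(complex ^ 8 ^ 8) set" and \<rho> :: "complex ^ 8 ^ 8 \<Rightarrow> complex ^ 8 ^ 8"
    and N :: "(complex ^ 8 ^ 8) set" and \<Phi> :: "complex ^ 8 ^ 8 \<Rightarrow> complex ^ 'n"
    and R :: "complex ^ 8 \<Rightarrow> bool" and k0 :: 'n and \<tau> :: "complex ^ 8 ^ 8"
  assumes C_SO8C: "C \<subseteq> SO8C" and C_mult: "k \<in> C \<Longrightarrow> l \<in> C \<Longrightarrow> k ** l \<in> C"
    and C_transpose: "k \<in> C \<Longrightarrow> transpose k \<in> C" and C_mcnj: "k \<in> C \<Longrightarrow> mcnj k \<in> C"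
    and G_eq: "G = \<rho> ` C" and H_eq: "H = \<rho> ` {k \<in> C. k *v axis p 1 = axis p 1}"
    and \<rho>_mult: "k \<in> C \<Longrightarrow> l \<in> C \<Longrightarrow> \<rho> (k ** l) = \<rho> k ** \<rho> l"
    and \<rho>_transpose: "k \<in> C \<Longrightarrow> \<rho> (transpose k) = transpose (\<rho> k)"
    and \<rho>_mcnj: "k \<in> C \<Longrightarrow> \<rho> (mcnj k) = mcnj (\<rho> k)"
    and cdiff_\<rho>: "cdiff \<rho> z"
    and orbit: "k \<in> C \<Longrightarrow> k *v axis p 1 \<in> quadric"
    and sections: "v \<in> quadric \<Longrightarrow> local_section C quadric (axis p 1) v"
    and polar: "polar_group G"
    and holomorphic: "holomorphic_map_on N \<Phi>"
    and N_iff: "k \<in> C \<Longrightarrow> \<rho> k \<in> N \<longleftrightarrow> R (k *v axis p 1)"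
    and \<Phi>_eq: "k \<in> C \<Longrightarrow> R (k *v axis p 1) \<Longrightarrow> \<Phi> (\<rho> k) = coords (k *v axis p 1)"
    and R_nonzero: "R v \<Longrightarrow> v $ p \<noteq> 0" and R_pos: "Re (v $ p) > 0 \<Longrightarrow> R v"
    and separation: "k \<in> C \<Longrightarrow> l \<in> C \<Longrightarrow> R (k *v axis p 1) \<Longrightarrow> R (l *v axis p 1) \<Longrightarrow>
      coords (k *v axis p 1) = coords (l *v axis p 1) \<Longrightarrow> transpose (\<rho> k) ** \<rho> l \<in> H"
    and normal_form: "v \<in> quadric \<Longrightarrow> \<exists>u\<in>C. mcnj u = u \<and> (\<exists>c s. c > 0 \<and> c\<^sup>2 = 1 + s\<^sup>2 \<and>
      u *v v = of_real c *s axis p 1 + (\<i> * of_real s) *s axis (\<iota> k0) 1)"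
    and \<tau>: "\<tau> \<in> C" "mcnj \<tau> = \<tau>" "\<tau> *v axis p 1 = axis p 1" "\<tau> *v axis (\<iota> k0) 1 = - axis (\<iota> k0) 1"
begin

lemma model_chart: "model_chart N \<Phi> (ball 0 1)"
  unfolding model_chart_def
proof (intro conjI ballI impI holomorphic open_ball)
  fix g h assume g: "g \<in> G \<inter> N" and h: "h \<in> H"
  obtain k l where k: "k \<in> C" "g = \<rho> k" and l: "l \<in> C" "h = \<rho> l" "l *v axis p 1 = axis p 1"
    using g h unfolding G_eq H_eq by blast
  have "R (k *v axis p 1)"
    using g k N_iff by auto
  moreover have "(k ** l) *v axis p 1 = k *v axis p 1"
    by (simp add: matrix_vector_mul_assoc[symmetric] l)
  moreover have "g ** h = \<rho> (k ** l)"
    by (simp add: k l \<rho>_mult)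
  ultimately show "g ** h \<in> N" "\<Phi> (g ** h) = \<Phi> g"
    using N_iff \<Phi>_eq C_mult[OF k(1) l(1)] k by auto
next
  fix g h assume "g \<in> G \<inter> N" "h \<in> G \<inter> N" and eq: "\<Phi> g = \<Phi> h"
  then obtain k l where "k \<in> C" "g = \<rho> k" "l \<in> C" "h = \<rho> l" "g \<in> N" "h \<in> N"
    unfolding G_eq by blast
  then show "transpose g ** h \<in> H"
    using separation[of k l] N_iff \<Phi>_eq eq by auto
next
  fix w0 :: "complex ^ 'n" assume "w0 \<in> ball 0 1"
  then have "norm w0 < 1"
    by simp
  then obtain W s where W: "w0 \<in> W" "W \<subseteq> ball 0 1" "holomorphic_map_on W s"
    "\<And>w. w \<in> W \<Longrightarrow> s w \<in> C \<and> s w *v axis p 1 = point w"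
    using section_through_point[OF sections] by metis
  have "holomorphic_map_on W (\<lambda>w. \<rho> (s w))"
    using W(3) semidiff_compose[OF cdiff_\<rho>] unfolding holomorphic_map_on_iff by blast
  moreover have "\<rho> (s w) \<in> G \<inter> N \<and> \<Phi> (\<rho> (s w)) = w" if "w \<in> W" for w
  proof -
    have "norm w < 1"
      using that W(2) by auto
    then have "R (point w)" "coords (point w) = w"
      using point_quadric R_pos by blast+
    then show ?thesis
      using W(4)[OF that] N_iff[of "s w"] \<Phi>_eq[of "s w"] by (auto simp: G_eq)
  qed
  ultimately show "\<exists>W s. w0 \<in> W \<and> holomorphic_map_on W s \<and> (\<forall>w\<in>W \<inter> ball 0 1. s w \<in> G \<inter> N \<and> \<Phi> (s w) = w)"
    using W(1) by blast
qed

lemma coset_cover_eq: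
  assumes "k \<in> C" "l \<in> C" "k *v axis p 1 = l *v axis p 1"
  shows "\<pi> (\<rho> k) = \<pi> (\<rho> l)"
proof -
  have "(transpose k ** l) *v axis p 1 = axis p 1"
    using assms C_SO8C SO8C_inverse(3)[of k] by (auto simp: matrix_vector_mul_assoc[symmetric] simp flip: assms(3))
  then have "\<rho> (transpose k ** l) \<in> H"
    using assms C_mult C_transpose unfolding H_eq by blast
  then have "transpose (\<rho> k) ** \<rho> l \<in> H"
    using assms by (simp add: \<rho>_mult \<rho>_transpose C_transpose)
  moreover have "\<rho> k \<in> G" "\<rho> l \<in> G"
    using assms by (auto simp: G_eq)
  ultimately show ?thesis
    using coset_eq_iff by blast
qed

text \<open>The parametrization sends the orbit point of \<open>k\<close> to the coset of
  \<open>\<rho> k\<close>, so the choice operator in \<open>f\<close> is harmless by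
  \<open>coset_cover_eq\<close>.\<close>

lemma connected: "connected_space D"
proof -
  define f where "f = (\<lambda>v. \<pi> (\<rho> (SOME k. k \<in> C \<and> k *v axis p 1 = v)))"
  have f: "f v = \<pi> (\<rho> k)" if "k \<in> C" "k *v axis p 1 = v" for k v
  proof -
    define l where "l = (SOME k. k \<in> C \<and> k *v axis p 1 = v)"
    have "l \<in> C \<and> l *v axis p 1 = v"
      unfolding l_def using someI[of "\<lambda>k. k \<in> C \<and> k *v axis p 1 = v" k] that by blast
    then have "\<pi> (\<rho> l) = \<pi> (\<rho> k)"
      using that by (intro coset_cover_eq) simp_all
    then show ?thesis
      by (simp add: f_def l_def)
  qed
  show ?thesis
  proof (rule connected_D[OF connected_quadric])
    fix g assume "g \<in> G"
    then obtain k where "k \<in> C" "g = \<rho> k"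
      by (auto simp: G_eq)
    then show "\<pi> g \<in> f ` quadric"
      using f[of k] orbit[of k] by auto
  next
    fix v assume v: "v \<in> quadric"
    obtain W s where W: "v \<in> W" "holomorphic_map_on W s" "\<And>u. u \<in> W \<inter> quadric \<Longrightarrow> s u \<in> C \<and> s u *v axis p 1 = u"
      using sections[OF v] unfolding local_section_def by blast
    have "continuous_on UNIV \<rho>"
      by (intro continuous_at_imp_continuous_on ballI isCont_cdiff cdiff_\<rho>)
    then have "continuous_on W (\<lambda>u. \<rho> (s u))"
      by (rule continuous_on_compose2[OF _ holomorphic_map_on_continuous[OF W(2)]]) simp
    moreover have "\<rho> (s u) \<in> G \<and> f u = \<pi> (\<rho> (s u))" if "u \<in> W \<inter> quadric" for u
      using W(3)[OF that] f by (auto simp: G_eq)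
    moreover have "open W"
      using W(2) by (simp add: holomorphic_map_on_def)
    ultimately show "\<exists>W s. v \<in> W \<and> open W \<and> continuous_on W s \<and> (\<forall>u\<in>W \<inter> quadric. s u \<in> G \<and> f u = \<pi> (s u))"
      using W(1) by blast
  qed
qed

theorem strongly_visible_cover:
  assumes "maximal_compact_subgroup Gu G"
  shows "strongly_visible Gu left_translation D (coset_atlas G H :: (_, 'n) chart set) \<and>
    (\<exists>S \<sigma>. real_submanifold 1 D (coset_atlas G H :: (_, 'n) chart set) S \<and>
      visible_slice Gu left_translation D (coset_atlas G H :: (_, 'n) chart set) S \<sigma>)"
proof (rule strongly_visible_model[OF polar model_chart slice_direction[of k0] _ _ _ connected assms])
  have real: "\<rho> u \<in> G.real_points" if "u \<in> C" "mcnj u = u" for u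
    unfolding G.real_points_def using that \<rho>_mcnj[of u] G_eq by auto
  show "\<rho> \<tau> \<in> G.real_points"
    using real \<tau> by blast
  show "\<exists>u\<in>G.real_points. u ** g \<in> N \<and> \<Phi> (u ** g) \<in> ball 0 1 \<inter> slice_direction k0" if gG: "g \<in> G" for g
  proof -
    obtain k where k: "k \<in> C" "g = \<rho> k"
      using gG by (auto simp: G_eq)
    obtain u c s where u: "u \<in> C" "mcnj u = u" "c > 0" "c\<^sup>2 = 1 + s\<^sup>2"
      "u *v (k *v axis p 1) = of_real c *s axis p 1 + (\<i> * of_real s) *s axis (\<iota> k0) 1"
      using normal_form[OF orbit[OF k(1)]] by blast
    have uk: "u ** k \<in> C" "u ** k *v axis p 1 = of_real c *s axis p 1 + (\<i> * of_real s) *s axis (\<iota> k0) 1"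
      using u k C_mult by (auto simp: matrix_vector_mul_assoc)
    have "\<iota> k0 \<noteq> p"
      using p by (metis rangeI)
    then have "R (u ** k *v axis p 1)"
      using u(3) uk(2) by (intro R_pos) (simp add: axis_nth_8)
    then have "\<rho> (u ** k) \<in> N" "\<Phi> (\<rho> (u ** k)) \<in> ball 0 1 \<inter> slice_direction k0"
      using N_iff[OF uk(1)] \<Phi>_eq[OF uk(1)] uk(2) coords_polar[OF u(3,4)] by auto
    then show ?thesis
      using real[OF u(1,2)] \<rho>_mult[OF u(1) k(1)] k(2) by auto
  qed
  show "\<rho> \<tau> ** mcnj g \<in> N \<and> \<Phi> (\<rho> \<tau> ** mcnj g) = \<Phi> g"
    if g: "g \<in> G \<inter> N" "\<Phi> g \<in> ball 0 1 \<inter> slice_direction k0" for g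
  proof -
    obtain k where k: "k \<in> C" "g = \<rho> k"
      using g by (auto simp: G_eq)
    have Rk: "R (k *v axis p 1)"
      using N_iff[OF k(1)] g k(2) by auto
    have kv: "\<tau> *v vcnj (k *v axis p 1) = k *v axis p 1"
      using conjugate_slice[OF orbit[OF k(1)] R_nonzero[OF Rk] _ \<tau>(3,4)] \<Phi>_eq[OF k(1) Rk] g(2) k(2) by simp
    have \<tau>k: "\<tau> ** mcnj k \<in> C" "(\<tau> ** mcnj k) *v axis p 1 = k *v axis p 1"
      using \<tau>(1) k(1) C_mult C_mcnj kv by (auto simp: matrix_vector_mul_assoc[symmetric])
    have "\<rho> \<tau> ** mcnj g = \<rho> (\<tau> ** mcnj k)"
      using \<tau>(1) k C_mcnj by (simp add: \<rho>_mult \<rho>_mcnj)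
    then show ?thesis
      using N_iff[OF \<tau>k(1)] \<Phi>_eq[OF \<tau>k(1)] \<Phi>_eq[OF k(1) Rk] Rk \<tau>k(2) k(2) by simp
  qed
qed

end

section \<open>The three pairs as instances of the model\<close>

lemma continuous_matrix_vector: "continuous_on A (\<lambda>g. g *v (x :: complex ^ 'n::finite))"
  for A :: "(complex ^ 'n ^ 'm::finite) set"
  by (intro continuous_at_imp_continuous_on ballI isCont_cdiff cdiff_intros)

lemma closed_SO8C: "closed SO8C"
proof -
  have "continuous_on UNIV (\<lambda>g::complex ^ 8 ^ 8. det g)"
    unfolding det_def by (intro continuous_intros)
  moreover have "continuous_on UNIV (\<lambda>g::complex ^ 8 ^ 8. transpose g ** g)"
    by (intro continuous_at_imp_continuous_on ballI isCont_cdiff cdiff_intros)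
  ultimately show ?thesis
    unfolding SO8C_def by (intro closed_Collect_conj closed_Collect_eq) auto
qed

lemma closed_SO7C: "closed SO7C"
proof -
  have eq: "SO7C = SO8C \<inter> {g. g *v cayley_basis 0 = cayley_basis 0}"
    by (auto simp: SO7C_def)
  show ?thesis
    unfolding eq by (intro closed_Int closed_SO8C closed_Collect_eq continuous_matrix_vector continuous_on_const)
qed

lemma continuous_cayley_mult:
  "continuous_on A f \<Longrightarrow> continuous_on A g \<Longrightarrow> continuous_on A (\<lambda>x. f x \<odot> g x)"
  unfolding cayley_mult_def by (intro continuous_intros)

lemma closed_G2C: "closed G2C"
proof -
  have eq: "G2C = SO8C \<inter> {g. \<forall>x y. (g *v x) \<odot> (g *v y) = g *v (x \<odot> y)}"
    by (auto simp: G2C_def)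
  show ?thesis
    unfolding eq
    by (intro closed_Int closed_SO8C closed_Collect_all closed_Collect_eq continuous_matrix_vector continuous_cayley_mult)
qed

lemma closed_SL3C: "closed SL3C"
proof -
  have eq: "SL3C = G2C \<inter> {g. g *v cayley_basis 1 = cayley_basis 1}"
    by (auto simp: SL3C_def)
  show ?thesis
    unfolding eq by (intro closed_Int closed_G2C closed_Collect_eq continuous_matrix_vector continuous_on_const)
qed

text \<open>An existential quantifier does not define a closed set by itself. Naming the partner by
  the continuous function \<open>vector_rep\<close> turns membership into closed conditions.\<close>

lemma closed_Spin7C: "closed Spin7C"
proof -
  have rep: "continuous_on UNIV vector_rep"
    by (intro continuous_at_imp_continuous_on ballI isCont_cdiff cdiff_intros)
  have eq: "Spin7C = SO8C \<inter> (vector_rep -` SO7C) \<inter> {g. \<forall>x y. (vector_rep g *v x) \<odot> (g *v y) = g *v (x \<odot> y)}"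
    by (auto simp: Spin7C_iff spin_lift_def SO8C_def)
  have vim: "closed (vector_rep -` SO7C)"
    using closed_SO7C rep by (rule closed_vimage)
  have app: "continuous_on UNIV (\<lambda>g. vector_rep g *v x)" for x
    by (intro continuous_at_imp_continuous_on ballI isCont_cdiff cdiff_intros)
  show ?thesis
    unfolding eq
    by (intro closed_Int closed_SO8C vim closed_Collect_all closed_Collect_eq app continuous_matrix_vector continuous_cayley_mult)
qed

lemma mat_1_G2C: "mat 1 \<in> G2C"
  by (simp add: G2C_def SO8C_def)

lemma orthogonal_groupI:
  assumes "G \<subseteq> SO8C" "mat 1 \<in> G" "\<And>g h. g \<in> G \<Longrightarrow> h \<in> G \<Longrightarrow> g ** h \<in> G"
    "\<And>g. g \<in> G \<Longrightarrow> transpose g \<in> G" "\<And>g. g \<in> G \<Longrightarrow> mcnj g \<in> G" "closed G"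
  shows "orthogonal_group G"
proof
  show "transpose g ** g = mat 1" if "g \<in> G" for g
    using that assms(1) SO8C_inverse(1) by blast
qed (fact assms)+

lemma G2C_subsets: "G2C \<subseteq> SO7C" "G2C \<subseteq> Spin7C" "G2C \<subseteq> SO8C" "SO7C \<subseteq> SO8C" "Spin7C \<subseteq> SO8C" "SL3C \<subseteq> G2C"
proof -
  show "G2C \<subseteq> SO7C"
    using G2C_spin_lift(2) unfolding spin_lift_def by blast
  show "G2C \<subseteq> Spin7C"
    using G2C_spin_lift(2) spin_lift_Spin7C by blast
qed (auto simp: SO7C_def Spin7C_def SL3C_def G2C_def)

lemma orthogonal_groups:
  "orthogonal_group SO7C" "orthogonal_group Spin7C" "orthogonal_group G2C" "orthogonal_group SL3C"
proof -
  note sub = G2C_subsets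
  show "orthogonal_group SO7C"
    using sub mat_1_G2C by (intro orthogonal_groupI SO7C_mult SO7C_transpose SO7C_mcnj closed_SO7C) auto
  show "orthogonal_group Spin7C"
    using sub mat_1_G2C by (intro orthogonal_groupI Spin7C_mult Spin7C_transpose Spin7C_mcnj closed_Spin7C) auto
  show "orthogonal_group G2C"
    using sub mat_1_G2C by (intro orthogonal_groupI G2C_mult G2C_transpose G2C_mcnj closed_G2C) auto
  show "orthogonal_group SL3C"
  proof (rule orthogonal_groupI)
    show "SL3C \<subseteq> SO8C" "mat 1 \<in> SL3C" "closed SL3C"
      using sub mat_1_G2C closed_SL3C by (auto simp: SL3C_def)
    show "g ** h \<in> SL3C" if "g \<in> SL3C" "h \<in> SL3C" for g h
      using that by (simp add: SL3C_def G2C_mult matrix_vector_mul_assoc[symmetric])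
    show "transpose g \<in> SL3C" if "g \<in> SL3C" for g
      using that SO8C_inverse(3)[of g "cayley_basis 1"] sub G2C_transpose by (auto simp: SL3C_def)
    show "mcnj g \<in> SL3C" if "g \<in> SL3C" for g
    proof -
      have "vcnj (g *v axis 1 1) = axis 1 1"
        using that by (simp add: SL3C_def cayley_basis_def del: mcnj_simps)
      then show ?thesis
        using that by (simp add: SL3C_def G2C_mcnj cayley_basis_def)
    qed
  qed
qed

lemma orthogonal_pairs: "orthogonal_pair SO7C G2C" "orthogonal_pair Spin7C G2C" "orthogonal_pair G2C SL3C"
  using orthogonal_groups G2C_subsets
  by (auto intro!: orthogonal_pair.intro orthogonal_pair_axioms.intro)

lemma polar_groups: "polar_group SO7C" "polar_group Spin7C" "polar_group G2C"
  using orthogonal_groups square_root_SO7C square_root_Spin7C square_root_G2C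
  by (auto intro!: polar_group.intro polar_group_axioms.intro)

text \<open>Here the quotient is the quadric itself, whereas \<open>coords\<close> identifies
  \<open>v\<close> with \<open>- v\<close>. Restricting to positive real part of
  \<open>v $ p\<close> keeps one of the two and restores injectivity.\<close>

lemma cover_model_orbit:
  fixes \<iota> :: "'n::finite \<Rightarrow> 8"
  assumes pair: "orthogonal_pair G H" and chart: "quadric_chart p \<iota>" and G: "G \<subseteq> SO8C"
    and H: "H = {g \<in> G. g *v axis p 1 = axis p 1}"
    and orbit: "\<And>g. g \<in> G \<Longrightarrow> g *v axis p 1 \<in> quadric_chart.quadric p \<iota>"
    and sections: "\<And>v. v \<in> quadric_chart.quadric p \<iota> \<Longrightarrow> local_section G (quadric_chart.quadric p \<iota>) (axis p 1) v"
    and polar: "polar_group G"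
    and normal_form: "\<And>v. v \<in> quadric_chart.quadric p \<iota> \<Longrightarrow> \<exists>u\<in>G. mcnj u = u \<and> (\<exists>c s. c > 0 \<and> c\<^sup>2 = 1 + s\<^sup>2 \<and>
      u *v v = of_real c *s axis p 1 + (\<i> * of_real s) *s axis (\<iota> k0) 1)"
    and \<tau>: "\<tau> \<in> G" "mcnj \<tau> = \<tau>" "\<tau> *v axis p 1 = axis p 1" "\<tau> *v axis (\<iota> k0) 1 = - axis (\<iota> k0) 1"
  shows "cover_model G H p \<iota> G (\<lambda>g. g) {g. Re ((g *v axis p 1) $ p) > 0}
    (\<lambda>g. quadric_chart.coords p \<iota> (g *v axis p 1)) (\<lambda>v. Re (v $ p) > 0) k0 \<tau>"
proof -
  interpret orthogonal_pair G H
    by (rule pair)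
  interpret quadric_chart p \<iota>
    by (rule chart)
  have "open {g :: complex ^ 8 ^ 8. Re ((g *v axis p 1) $ p) > 0}"
    by (intro open_Collect_less continuous_intros continuous_matrix_vector)
  then have hol: "holomorphic_map_on {g. Re ((g *v axis p 1) $ p) > 0} (\<lambda>g. coords (g *v axis p 1))"
    unfolding holomorphic_map_on_iff by (auto intro!: cdiff_intros)
  have sep: "transpose k ** l \<in> H"
    if kl: "k \<in> G" "l \<in> G" and pos: "Re ((k *v axis p 1) $ p) > 0" "Re ((l *v axis p 1) $ p) > 0"
      and eq: "coords (k *v axis p 1) = coords (l *v axis p 1)" for k l
  proof -
    have "(k *v axis p 1) $ p \<noteq> 0" "(l *v axis p 1) $ p \<noteq> 0"
      using pos by auto
    then have "k *v axis p 1 = l *v axis p 1 \<or> k *v axis p 1 = - (l *v axis p 1)"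
      using quadric_eqI[OF orbit[OF kl(1)] _ orbit[OF kl(2)] _ eq] by blast
    moreover have "k *v axis p 1 \<noteq> - (l *v axis p 1)"
    proof
      assume "k *v axis p 1 = - (l *v axis p 1)"
      then have "(k *v axis p 1) $ p = - (l *v axis p 1) $ p"
        by simp
      with pos show False
        by simp
    qed
    ultimately have "k *v axis p 1 = l *v axis p 1"
      by blast
    then have "(transpose k ** l) *v axis p 1 = axis p 1"
      using SO8C_inverse(3)[of k "axis p 1"] kl(1) G by (auto simp: matrix_vector_mul_assoc[symmetric])
    then show ?thesis
      using kl by (simp add: H G.mult G.transp)
  qed
  show ?thesis
  proof (rule cover_model.intro[OF pair chart], rule cover_model_axioms.intro[OF G G.mult G.transp G.conj _ _
        refl refl refl cdiff_id orbit sections polar hol _ refl _ _ sep normal_form \<tau>])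
    show "H = (\<lambda>g. g) ` {k \<in> G. k *v axis p 1 = axis p 1}"
      by (simp add: H)
  qed auto
qed

lemma index_map:
  assumes "CARD('n::finite) = card (UNIV - A :: 8 set)"
  obtains \<iota> :: "'n::finite \<Rightarrow> 8" where "inj \<iota>" "range \<iota> = UNIV - A"
proof -
  obtain \<iota> :: "'n \<Rightarrow> 8" where "bij_betw \<iota> UNIV (UNIV - A)"
    using finite_same_card_bij[of "UNIV :: 'n set" "UNIV - A"] assms by auto
  then show ?thesis
    using that by (auto simp: bij_betw_def)
qed

text \<open>Supplies \<open>\<tau>\<close> for the two seven-dimensional quotients, from the
  antipodal case of the real transport.\<close>

lemma real_G2_sign_change:
  obtains \<tau> where "\<tau> \<in> G2C" "mcnj \<tau> = \<tau>" "\<tau> *v axis 1 1 = - axis 1 1"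
  by (rule real_G2_transport[of "axis 1 1" "- axis 1 1" 0]) (auto simp: axis_nth_8)

lemma real_SL3_sign_change:
  obtains \<tau> where "\<tau> \<in> G2C" "mcnj \<tau> = \<tau>" "\<tau> *v axis 1 1 = axis 1 1" "\<tau> *v axis 2 1 = - axis 2 1"
  by (rule real_G2_transport[of "axis 2 1" "- axis 2 1" "axis 1 1"]) (auto simp: axis_nth_8)

lemma quadric_7:
  assumes "inj \<iota>" "range \<iota> = UNIV - {0}"
  shows "quadric_chart 0 \<iota>" "quadric_chart.quadric 0 \<iota> = {v. cdot v v = 1}"
proof -
  show 1: "quadric_chart 0 \<iota>"
    by unfold_locales (use assms in auto)
  show "quadric_chart.quadric 0 \<iota> = {v. cdot v v = 1}"
    unfolding quadric_chart.quadric_def[OF 1] using assms(2) by auto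
qed

lemma quadric_6:
  assumes "inj \<iota>" "range \<iota> = UNIV - {0, 1}"
  shows "quadric_chart 1 \<iota>" "quadric_chart.quadric 1 \<iota> = {v. v $ 0 = 0 \<and> cdot v v = 1}"
proof -
  show 1: "quadric_chart 1 \<iota>"
    by unfold_locales (use assms in auto)
  show "quadric_chart.quadric 1 \<iota> = {v. v $ 0 = 0 \<and> cdot v v = 1}"
    unfolding quadric_chart.quadric_def[OF 1] using assms(2) by auto
qed

lemma Spin7C_orbit: "g \<in> Spin7C \<Longrightarrow> cdot (g *v axis 0 1) (g *v axis 0 1) = 1"
proof -
  assume "g \<in> Spin7C"
  then have "g \<in> SO8C"
    using G2C_subsets(5) by blast
  then have "cdot (g *v axis 0 1) (g *v axis 0 1) = cdot (axis 0 1) (axis 0 1 :: complex ^ 8)"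
    by (rule cdot_SO8C)
  then show ?thesis
    by simp
qed

lemma Spin7C_model:
  fixes \<iota> :: "'n::finite \<Rightarrow> 8"
  assumes \<iota>: "inj \<iota>" "range \<iota> = UNIV - {0}" "\<iota> k0 = 1"
    and \<tau>: "\<tau> \<in> G2C" "mcnj \<tau> = \<tau>" "\<tau> *v axis 1 1 = - axis 1 1"
  shows "cover_model Spin7C G2C 0 \<iota> Spin7C (\<lambda>g. g) {g. Re ((g *v axis 0 1) $ 0) > 0}
    (\<lambda>g. quadric_chart.coords 0 \<iota> (g *v axis 0 1)) (\<lambda>v. Re (v $ 0) > 0) k0 \<tau>"
proof (rule cover_model_orbit[OF orthogonal_pairs(2) quadric_7(1)[OF \<iota>(1,2)] G2C_subsets(5) _ _ _ polar_groups(2) _ _ \<tau>(2)])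
  note Q = quadric_7(2)[OF \<iota>(1,2)]
  show "\<exists>u\<in>Spin7C. mcnj u = u \<and> (\<exists>c s. c > 0 \<and> c\<^sup>2 = 1 + s\<^sup>2 \<and>
      u *v v = of_real c *s axis 0 1 + (\<i> * of_real s) *s axis (\<iota> k0) 1)"
    if v: "v \<in> quadric_chart.quadric 0 \<iota>" for v
  proof -
    have "cdot v v = 1"
      using v unfolding Q by simp
    then show ?thesis
      by (rule Q7_polar) (auto simp: \<iota>(3))
  qed
  show "G2C = {g \<in> Spin7C. g *v axis 0 1 = axis 0 1}"
    using G2C_iff by blast
  show "g *v axis 0 1 \<in> quadric_chart.quadric 0 \<iota>" if "g \<in> Spin7C" for g
    unfolding Q using Spin7C_orbit[OF that] by simp
  show "local_section Spin7C (quadric_chart.quadric 0 \<iota>) (axis 0 1) v" if "v \<in> quadric_chart.quadric 0 \<iota>" for v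
    using that Spin7C_local_section unfolding Q by simp
  show "\<tau> \<in> Spin7C" "\<tau> *v axis 0 1 = axis 0 1"
    using \<tau>(1) G2C_iff by blast+
  show "\<tau> *v axis (\<iota> k0) 1 = - axis (\<iota> k0) 1"
    using \<tau>(3) \<iota>(3) by simp
qed

lemma G2C_model:
  fixes \<iota> :: "'n::finite \<Rightarrow> 8"
  assumes \<iota>: "inj \<iota>" "range \<iota> = UNIV - {0, 1}" "\<iota> k0 = 2"
    and \<tau>: "\<tau> \<in> G2C" "mcnj \<tau> = \<tau>" "\<tau> *v axis 1 1 = axis 1 1" "\<tau> *v axis 2 1 = - axis 2 1"
  shows "cover_model G2C SL3C 1 \<iota> G2C (\<lambda>g. g) {g. Re ((g *v axis 1 1) $ 1) > 0}
    (\<lambda>g. quadric_chart.coords 1 \<iota> (g *v axis 1 1)) (\<lambda>v. Re (v $ 1) > 0) k0 \<tau>"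
proof (rule cover_model_orbit[OF orthogonal_pairs(3) quadric_6(1)[OF \<iota>(1,2)] G2C_subsets(3) _ _ _ polar_groups(3) _ \<tau>(1,2,3)])
  note Q = quadric_6(2)[OF \<iota>(1,2)]
  show "\<exists>u\<in>G2C. mcnj u = u \<and> (\<exists>c s. c > 0 \<and> c\<^sup>2 = 1 + s\<^sup>2 \<and>
      u *v v = of_real c *s axis 1 1 + (\<i> * of_real s) *s axis (\<iota> k0) 1)"
    if v: "v \<in> quadric_chart.quadric 1 \<iota>" for v
  proof -
    have "v $ 0 = 0" "cdot v v = 1"
      using v unfolding Q by simp_all
    then show ?thesis
      by (rule Q6_polar) (auto simp: \<iota>(3))
  qed
  show "SL3C = {g \<in> G2C. g *v axis 1 1 = axis 1 1}"
    by (simp add: SL3C_def cayley_basis_def)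
  show "g *v axis 1 1 \<in> quadric_chart.quadric 1 \<iota>" if "g \<in> G2C" for g
  proof -
    have "cdot (g *v axis 1 1) (g *v axis 1 1) = cdot (axis 1 1) (axis 1 1 :: complex ^ 8)"
      by (rule cdot_SO8C) (use that G2C_subsets(3) in blast)
    then show ?thesis
      using G2C_nth_0[OF that, of "axis 1 1"] unfolding Q by (simp add: axis_nth_8)
  qed
  show "local_section G2C (quadric_chart.quadric 1 \<iota>) (axis 1 1) v" if "v \<in> quadric_chart.quadric 1 \<iota>" for v
    using that G2C_local_section unfolding Q by simp
  show "\<tau> *v axis (\<iota> k0) 1 = - axis (\<iota> k0) 1"
    using \<tau>(4) \<iota>(3) by simp
qed

text \<open>The quotient is the quadric modulo sign, so the domain is just
  \<open>v $ 0 \<noteq> 0\<close>. The first row of the spinor projection is \<open>v_0\<close>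
  times \<open>v\<close>, and dividing by its first entry gives the projective coordinates.\<close>

lemma SO7C_model:
  fixes \<iota> :: "'n::finite \<Rightarrow> 8"
  assumes \<iota>: "inj \<iota>" "range \<iota> = UNIV - {0}" "\<iota> k0 = 1"
    and \<tau>: "\<tau> \<in> G2C" "mcnj \<tau> = \<tau>" "\<tau> *v axis 1 1 = - axis 1 1"
  shows "cover_model SO7C G2C 0 \<iota> Spin7C vector_rep {g. spinor_projection g $ 0 $ 0 \<noteq> 0}
    (\<lambda>g. \<chi> k. spinor_projection g $ 0 $ \<iota> k / spinor_projection g $ 0 $ 0) (\<lambda>v. v $ 0 \<noteq> 0) k0 \<tau>"
proof -
  interpret spin: cover_model Spin7C G2C 0 \<iota> Spin7C "\<lambda>g. g" "{g. Re ((g *v axis 0 1) $ 0) > 0}"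
    "\<lambda>g. quadric_chart.coords 0 \<iota> (g *v axis 0 1)" "\<lambda>v. Re (v $ 0) > 0" k0 \<tau>
    by (rule Spin7C_model[OF assms])
  have H: "G2C = vector_rep ` {k \<in> Spin7C. k *v axis 0 1 = axis 0 1}"
    using vector_rep_G2C G2C_iff by force
  have "open {g. spinor_projection g $ 0 $ 0 \<noteq> 0}"
    by (intro open_cdiff_nonzero cdiff_intros)
  then have hol: "holomorphic_map_on {g. spinor_projection g $ 0 $ 0 \<noteq> 0}
      (\<lambda>g. \<chi> k. spinor_projection g $ 0 $ \<iota> k / spinor_projection g $ 0 $ 0)"
    unfolding holomorphic_map_on_iff by (auto intro!: cdiff_intros)
  have proj: "spinor_projection (vector_rep k) $ i $ j = (k *v axis 0 1) $ i * (k *v axis 0 1) $ j"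
    if "k \<in> Spin7C" for k i j
    by (simp add: spinor_projection_vector_rep[OF that] outer_def)
  have sep: "transpose (vector_rep k) ** vector_rep l \<in> G2C"
    if kl: "k \<in> Spin7C" "l \<in> Spin7C" and nz: "(k *v axis 0 1) $ 0 \<noteq> 0" "(l *v axis 0 1) $ 0 \<noteq> 0"
      and eq: "spin.coords (k *v axis 0 1) = spin.coords (l *v axis 0 1)" for k l
  proof -
    have *: "transpose (vector_rep k) ** vector_rep l \<in> G2C"
      if l: "l \<in> Spin7C" "k *v axis 0 1 = l *v axis 0 1" for l
    proof -
      have "(transpose k ** l) *v axis 0 1 = axis 0 1"
        using SO8C_inverse(3)[of k "axis 0 1"] kl(1) G2C_subsets l(2)
        by (auto simp: matrix_vector_mul_assoc[symmetric])
      then have "transpose k ** l \<in> G2C"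
        using G2C_iff Spin7C_mult Spin7C_transpose kl(1) l(1) by blast
      moreover have "vector_rep (transpose k ** l) = transpose (vector_rep k) ** vector_rep l"
        using kl(1) l(1) by (simp add: vector_rep_hom vector_rep_transpose Spin7C_transpose)
      ultimately show ?thesis
        using vector_rep_G2C by metis
    qed
    have "k *v axis 0 1 = l *v axis 0 1 \<or> k *v axis 0 1 = - (l *v axis 0 1)"
      by (rule spin.quadric_eqI[OF spin.orbit[OF kl(1)] nz(1) spin.orbit[OF kl(2)] nz(2) eq])
    then show ?thesis
    proof
      \<comment> \<open>The negative of \<open>l\<close> is a spin lift of the same rotation and
        sends the unit to the same point as \<open>k\<close>, so the equal case applies to
        it.\<close>
      assume "k *v axis 0 1 = - (l *v axis 0 1)"
      moreover have "spin_lift ((- 1) *\<^sub>C l) (vector_rep l) 1"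
        using spin_lift_scale[of l "vector_rep l" 1 "- 1"] kl(2) Spin7C_iff by simp
      then have "(- 1) *\<^sub>C l \<in> Spin7C" "vector_rep ((- 1) *\<^sub>C l) = vector_rep l"
        using spin_lift_Spin7C spin_lift_unique by metis+
      ultimately show ?thesis
        using *[of "(- 1) *\<^sub>C l"] by (simp add: scaleC_matrix)
    qed (rule *[OF kl(2)])
  qed
  show ?thesis
  proof (rule cover_model.intro[OF orthogonal_pairs(1) spin.quadric_chart_axioms],
      rule cover_model_axioms.intro[OF spin.C_SO8C spin.C_mult spin.C_transpose spin.C_mcnj SO7C_eq_vector_rep H
        vector_rep_hom vector_rep_transpose vector_rep_mcnj _ spin.orbit spin.sections polar_groups(1) hol _ _ _ _
        sep spin.normal_form spin.\<tau>])
    show "cdiff vector_rep z" for z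
      by (intro cdiff_intros)
    show "vector_rep k \<in> {g. spinor_projection g $ 0 $ 0 \<noteq> 0} \<longleftrightarrow> (k *v axis 0 1) $ 0 \<noteq> 0" if "k \<in> Spin7C" for k
      using proj[OF that] by simp
    show "(\<chi> i. spinor_projection (vector_rep k) $ 0 $ \<iota> i / spinor_projection (vector_rep k) $ 0 $ 0) =
        spin.coords (k *v axis 0 1)" if "k \<in> Spin7C" "(k *v axis 0 1) $ 0 \<noteq> 0" for k
      using that by (simp add: proj spin.coords_def)
  qed auto
qed

theorem theorem6p1:
  fixes G H Gu :: "(complex ^ 8 ^ 8) set"
    and \<theta> :: "complex ^ 8 ^ 8 \<Rightarrow> complex ^ 8 ^ 8"
    and D :: "(complex ^ 8 ^ 8) set topology"
    and \<A> :: "((complex ^ 8 ^ 8) set, 'n::finite) chart set"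
  assumes pair: "rank_one_pair G H CARD('n)"
    and theta: "Cartan_involution G \<theta>" "\<theta> ` H = H"
    and Gu: "Gu = fixed_points \<theta> G"
    and D: "D = coset_topology G H" "\<A> = coset_atlas G H"
  shows "strongly_visible Gu left_translation D \<A> \<and>
    (\<exists>S \<sigma>. real_submanifold 1 D \<A> S \<and> antiholomorphic_diffeo D \<A> \<sigma> \<and>
      topspace D = (\<Union>g\<in>Gu. left_translation g ` S) \<and>
      (\<forall>x\<in>S. \<sigma> x = x) \<and>
      (\<forall>x\<in>topspace D. \<sigma> x \<in> (\<lambda>g. left_translation g x) ` Gu))"
proof -
  have max: "maximal_compact_subgroup Gu G"
    using theta(1) Gu by (simp add: Cartan_involution_def)
  have card: "card (UNIV - {0} :: 8 set) = 7" "card (UNIV - {0, 1} :: 8 set) = 6"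
    by (simp_all add: card_Diff_subset)
  have "strongly_visible Gu left_translation D \<A> \<and>
      (\<exists>S \<sigma>. real_submanifold 1 D \<A> S \<and> visible_slice Gu left_translation D \<A> S \<sigma>)"
    using pair unfolding rank_one_pair_def
  proof (elim disjE conjE)
    assume GH: "G = SO7C" "H = G2C" and "CARD('n) = 7"
    then obtain \<iota> :: "'n \<Rightarrow> 8" where \<iota>: "inj \<iota>" "range \<iota> = UNIV - {0}"
      using index_map[of "{0}"] card by metis
    then obtain k0 where "\<iota> k0 = 1"
      by (metis Diff_iff UNIV_I imageE singletonD zero_neq_one)
    then show ?thesis
      using cover_model.strongly_visible_cover[OF SO7C_model[OF \<iota>]] real_G2_sign_change max
      unfolding D GH by metis
  next
    assume GH: "G = Spin7C" "H = G2C" and "CARD('n) = 7"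
    then obtain \<iota> :: "'n \<Rightarrow> 8" where \<iota>: "inj \<iota>" "range \<iota> = UNIV - {0}"
      using index_map[of "{0}"] card by metis
    then obtain k0 where "\<iota> k0 = 1"
      by (metis Diff_iff UNIV_I imageE singletonD zero_neq_one)
    then show ?thesis
      using cover_model.strongly_visible_cover[OF Spin7C_model[OF \<iota>]] real_G2_sign_change max
      unfolding D GH by metis
  next
    assume GH: "G = G2C" "H = SL3C" and "CARD('n) = 6"
    then obtain \<iota> :: "'n \<Rightarrow> 8" where \<iota>: "inj \<iota>" "range \<iota> = UNIV - {0, 1}"
      using index_map[of "{0, 1}"] card by metis
    \<comment> \<open>The normal form on the six-dimensional quadric uses \<open>axis 1 1\<close> as
      its real direction and \<open>axis 2 1\<close> as its imaginary one.\<close>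
    then have "2 \<in> range \<iota>"
      by simp
    then obtain k0 where "\<iota> k0 = 2"
      by (metis imageE)
    then show ?thesis
      using cover_model.strongly_visible_cover[OF G2C_model[OF \<iota>]] real_SL3_sign_change max
      unfolding D GH by metis
  qed
  then show ?thesis
    unfolding visible_slice_def by blast
qed

end
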